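(* Let $0<p,q<\infty$, $\phi\in S^q$, and let $\varphi\in S^q$ be an analytic self-map of $\mathbb D$ whose boundary values satisfy $|\varphi(\xi)|<1$ for $m$-a.e. $\xi\in\partial\mathbb D$. Then: (1) If $0<p<1$, $W_{\phi,\varphi}:S^p\to S^q$ is order bounded if and only if $$\int_{\partial\mathbb D}\frac{|\phi(\xi)\varphi'(\xi)|^q}{(1-|\varphi(\xi)|^2)^{q/p}}\,dm(\xi)+\int_{\partial\mathbb D}\frac{|\phi'(\xi)|^q}{(1-|\varphi(\xi)|^2)^{q(1-p)/p}}\,dm(\xi)<\infty.$$ (2) If $1\le p<\infty$, $W_{\phi,\varphi}:S^p\to S^q$ is order bounded if and only if $$\int_{\partial\mathbb D}\frac{|\phi(\xi)\varphi'(\xi)|^q}{(1-|\varphi(\xi)|^2)^{q/p}}\,dm(\xi)<\infty.$$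
   Context: $\mathbb D$ is the open unit disk, $m$ the normalized Lebesgue measure on $\partial\mathbb D$, and $H^p$ ($0<p<\infty$) the Hardy space with $\|f\|_{H^p}=\left(\sup_{0\le r<1}\int_{\partial\mathbb D}|f(r\xi)|^p\,dm(\xi)\right)^{1/p}$. The derivative Hardy space $S^p$ consists of analytic $f$ on $\mathbb D$ with $\|f\|_{S^p}=|f(0)|+\|f'\|_{H^p}<\infty$. For functions on $\mathbb D$, values at $\xi\in\partial\mathbb D$ (e.g. $\phi(\xi),\phi'(\xi),\varphi(\xi),\varphi'(\xi)$) denote radial boundary limits, which exist $m$-a.e. The weighted composition operator is $W_{\phi,\varphi}f(z)=\phi(z)f(\varphi(z))$. The operator $W_{\phi,\varphi}:S^p\to S^q$ is called order bounded if there exists $g\in L^q(m)$ such that for every $f\in S^p$ with $\|f\|_{S^p}\le1$, $|(W_{\phi,\varphi}f)'(\xi)|\le g(\xi)$ for $m$-a.e. $\xi\in\partial\mathbb D$. *)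

theory Defs
  imports "HOL-Analysis.Analysis"
begin

definition circle_measure :: "complex measure" where
  "circle_measure =
     distr (density (restrict_space lborel {0..<2*pi}) (\<lambda>_. ennreal (1 / (2*pi))))
           borel (\<lambda>t. cis t)"

definition radial_lim :: "(complex \<Rightarrow> complex) \<Rightarrow> complex \<Rightarrow> complex" where
  "radial_lim f \<xi> = Lim (at_left (1::real)) (\<lambda>r. f (complex_of_real r * \<xi>))"

definition has_radial_lim :: "(complex \<Rightarrow> complex) \<Rightarrow> complex \<Rightarrow> complex \<Rightarrow> bool" where
  "has_radial_lim f \<xi> L \<longleftrightarrow> ((\<lambda>r. f (complex_of_real r * \<xi>)) \<longlongrightarrow> L) (at_left (1::real))"

definition hardy_pow :: "real \<Rightarrow> (complex \<Rightarrow> complex) \<Rightarrow> ennreal" where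
  "hardy_pow p f =
     (SUP r\<in>{0..<1::real}. \<integral>\<^sup>+ \<xi>. ennreal (norm (f (complex_of_real r * \<xi>)) powr p) \<partial>circle_measure)"

definition hardy_norm :: "real \<Rightarrow> (complex \<Rightarrow> complex) \<Rightarrow> real" where
  "hardy_norm p f = enn2real (hardy_pow p f) powr (1 / p)"

definition in_Sp :: "real \<Rightarrow> (complex \<Rightarrow> complex) \<Rightarrow> bool" where
  "in_Sp p f \<longleftrightarrow> f holomorphic_on ball 0 1 \<and> hardy_pow p (deriv f) < \<infinity>"

definition Sp_norm :: "real \<Rightarrow> (complex \<Rightarrow> complex) \<Rightarrow> real" where
  "Sp_norm p f = norm (f 0) + hardy_norm p (deriv f)"

definition weighted_comp ::
  "(complex \<Rightarrow> complex) \<Rightarrow> (complex \<Rightarrow> complex) \<Rightarrow> (complex \<Rightarrow> complex) \<Rightarrow> complex \<Rightarrow> complex" where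
  "weighted_comp \<phi> \<psi> f = (\<lambda>z. \<phi> z * f (\<psi> z))"

definition order_bounded ::
  "real \<Rightarrow> real \<Rightarrow> (complex \<Rightarrow> complex) \<Rightarrow> (complex \<Rightarrow> complex) \<Rightarrow> bool" where
  "order_bounded p q \<phi> \<psi> \<longleftrightarrow>
     (\<exists>g :: complex \<Rightarrow> real. g \<in> borel_measurable circle_measure \<and>
        (\<integral>\<^sup>+ \<xi>. ennreal (\<bar>g \<xi>\<bar> powr q) \<partial>circle_measure) < \<infinity> \<and>
        (\<forall>f. in_Sp p f \<and> Sp_norm p f \<le> 1 \<longrightarrow>
           (AE \<xi> in circle_measure. \<exists>L. has_radial_lim (deriv (weighted_comp \<phi> \<psi> f)) \<xi> L
                                      \<and> norm L \<le> g \<xi>)))"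

end

theory Submission
  imports Defs "HOL-Complex_Analysis.Complex_Analysis"
begin

text \<open>
  A function in the unit ball of \<open>S\<^sup>p\<close> satisfies \<open>\<bar>f' w\<bar> \<le> C (1 - \<bar>w\<bar>) powr (- 1 / p)\<close>;
  integrating \<open>f'\<close> along the radius, it is \<open>O((1 - \<bar>w\<bar>) powr (1 - 1 / p))\<close> if \<open>p < 1\<close>, and integrating
  along circles centred at \<open>0\<close>, it is bounded if \<open>p \<ge> 1\<close>. Inserting \<open>w = \<psi> \<xi>\<close> into the boundary values
  \<open>\<phi>' f(\<psi>) + \<phi> f'(\<psi>) \<psi>'\<close> gives sufficiency. For necessity the bound by \<open>g\<close> is tested on
  \<open>(1 - \<bar>w\<bar>\<^sup>2) powr (k + 1 - 1 / p) / (1 - cnj w * z) ^ k\<close>: it holds almost everywhere for all \<open>w\<close> in a countable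
  dense set, hence by continuity for \<open>w = \<psi> \<xi>\<close>.

  Radial limits of \<open>h \<in> H\<^sup>q\<close> exist for every \<open>q > 0\<close> because \<open>h = b F powr (2 / q)\<close> with \<open>\<bar>b\<bar> \<le> 1\<close>, \<open>Re F \<ge> 1\<close>
  and \<open>F \<in> H\<^sup>2\<close>. On a smaller disc \<open>F\<close> is a polynomial whose real part approximates \<open>\<bar>h\<bar> powr (q / 2)\<close>
  on the circle from above (Stone-Weierstrass), so the maximum principle yields \<open>\<bar>h\<bar> \<le> \<bar>F\<bar> powr (2 / q)\<close>
  without any factorization of zeros; Montel's theorem gives \<open>F\<close> on the whole disc.
  For \<open>H\<^sup>2\<close> the limits follow from a weak-type maximal inequality (Poisson kernel and Vitali covering)
  and the density of polynomials.
\<close>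

section \<open>Poisson integrals and real parts of polynomials on the circle\<close>

text \<open>The range q < 1 shapes the treatment of radial limits: the power
  \<open>norm h powr (q / 2)\<close> has bounded square means on circles whatever q is, so every
  estimate is routed through H^2. There the imaginary part of the majorant costs only a factor 2:
  the mean of F^2 is the square of F 0, and with F 0 real this makes Re F control the modulus of F
  in L^2. Two growth arguments are needed because integrating (1 - r)^(-1) along a radius produces a
  logarithm at p = 1; the oscillation of f on a circle only costs the mean of |f'|. For p >= 1 the
  functions f are therefore uniformly bounded, and \<phi>' being in L^q takes care of the term
  \<phi>' f(\<psi>) without any weight. The exponent k is left free so that (k + 1) p >= 2 can be
  arranged: the p-th power of the derivative of a test function is then dominated by a multiple of a
  Poisson kernel, whose mean is explicit, and no asymptotics of fractional powers are
  required.\<close>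

lemma norm_one_minus_cnj_mult_sq:
  fixes w u :: complex
  assumes "norm u = 1"
  shows "of_real ((norm (1 - cnj w * u))\<^sup>2) * u = (1 - cnj w * u) * (u - w)"
proof -
  have 1: "u * cnj u = 1" using assms by (simp add: complex_norm_square[symmetric])
  have "of_real ((norm (1 - cnj w * u))\<^sup>2) * u = (1 - cnj w * u) * (u - w * (u * cnj u))"
    unfolding complex_norm_square by (simp add: algebra_simps)
  then show ?thesis unfolding 1 by simp
qed

lemma one_minus_cnj_mult_nonzero:
  fixes w u :: complex
  assumes "norm w < 1" "norm u \<le> 1"
  shows "1 - cnj w * u \<noteq> 0"
proof
  assume "1 - cnj w * u = 0"
  then have "norm (cnj w * u) = 1" by (metis eq_iff_diff_eq_0 norm_one)
  then have "norm w * norm u = 1" by (simp add: norm_mult)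
  moreover have "norm w * norm u \<le> norm w * 1" using assms by (intro mult_left_mono) auto
  ultimately show False using assms by linarith
qed

lemma one_minus_cnj_mult_norm_ge:
  fixes w u :: complex
  assumes "norm u \<le> 1"
  shows "1 - norm w \<le> norm (1 - cnj w * u)"
proof -
  have "norm (1::complex) - norm (cnj w * u) \<le> norm (1 - cnj w * u)" by (rule norm_triangle_ineq2)
  moreover have "norm w * norm u \<le> norm w * 1" using assms by (intro mult_left_mono) auto
  ultimately show ?thesis by (simp add: norm_mult)
qed

text \<open>Cauchy's formula at \<open>w\<close> for H(u) / (1 - cnj w * u). On the unit circle cnj
  u = 1 / u, so \<open>norm_one_minus_cnj_mult_sq\<close> turns the Cauchy kernel, multiplied by the
  factor u of du = i u dt, into the Poisson kernel. The value of the extra denominator at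
  \<open>w\<close> is 1 - |w|^2.\<close>

lemma poisson_has_integral:
  fixes H :: "complex \<Rightarrow> complex"
  assumes "continuous_on (cball 0 1) H" "H holomorphic_on ball 0 1" "norm w < 1"
  shows "((\<lambda>t. H (cis t) / of_real ((norm (1 - cnj w * cis t))\<^sup>2)) has_integral
           (2 * pi * H w / of_real (1 - (norm w)\<^sup>2))) {0..2*pi}"
proof -
  let ?f = "\<lambda>u. H u / (1 - cnj w * u)"
  have c: "continuous_on (cball 0 1) ?f"
    using assms one_minus_cnj_mult_nonzero[OF assms(3)] by (intro continuous_intros) auto
  have h: "?f holomorphic_on ball 0 1"
    using assms one_minus_cnj_mult_nonzero[OF assms(3)] by (intro holomorphic_intros) auto
  have "((\<lambda>u. ?f u / (u - w)) has_contour_integral (2 * of_real pi * \<i> * ?f w))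
     (part_circlepath 0 1 0 (2*pi))"
    using Cauchy_integral_circlepath[OF c h] assms(3) by (simp add: circlepath_def)
  then have "((\<lambda>t. ?f (cis t) / (cis t - w) * \<i> * cis t) has_integral (2 * of_real pi * \<i> * ?f w)) {0..2*pi}"
    by (subst (asm) has_contour_integral_part_circlepath_iff) auto
  then have "((\<lambda>t. (-\<i>) * (?f (cis t) / (cis t - w) * \<i> * cis t)) has_integral (-\<i>) * (2 * of_real pi * \<i> * ?f w)) {0..2*pi}"
    by (rule has_integral_mult_right)
  moreover have "(-\<i>) * (?f (cis t) / (cis t - w) * \<i> * cis t) = H (cis t) / of_real ((norm (1 - cnj w * cis t))\<^sup>2)" for t
  proof -
    have nz: "1 - cnj w * cis t \<noteq> 0" using one_minus_cnj_mult_nonzero[OF assms(3)] by auto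
    have e: "of_real ((norm (1 - cnj w * cis t))\<^sup>2) = (1 - cnj w * cis t) * (cis t - w) / cis t"
      using norm_one_minus_cnj_mult_sq[of "cis t" w] by (simp add: field_simps)
    have nz2: "cis t - w \<noteq> 0" using assms(3) by (metis eq_iff_diff_eq_0 less_irrefl norm_cis)
    show ?thesis unfolding e using nz nz2 by (simp add: field_simps)
  qed
  moreover have "(-\<i>) * (2 * of_real pi * \<i> * ?f w) = 2 * pi * H w / of_real (1 - (norm w)\<^sup>2)"
  proof -
    have "1 - cnj w * w = of_real (1 - (norm w)\<^sup>2)"
      by (simp add: complex_norm_square mult.commute del: of_real_power)
    then show ?thesis by (simp add: field_simps)
  qed
  ultimately show ?thesis by simp
qed

lemma mean_value_has_integral:
  fixes H :: "complex \<Rightarrow> complex"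
  assumes "continuous_on (cball 0 1) H" "H holomorphic_on ball 0 1"
  shows "((\<lambda>t. H (cis t)) has_integral (2 * pi * H 0)) {0..2*pi}"
  using poisson_has_integral[OF assms, of 0] by simp

lemma poisson_kernel_has_integral:
  fixes w :: complex
  assumes "norm w < 1"
  shows "((\<lambda>t. 1 / (norm (1 - cnj w * cis t))\<^sup>2) has_integral (2 * pi / (1 - (norm w)\<^sup>2))) {0..2*pi}"
proof -
  have "((\<lambda>t. Re (1 / of_real ((norm (1 - cnj w * cis t))\<^sup>2))) has_integral
           Re (complex_of_real (2 * pi) * 1 / of_real (1 - (norm w)\<^sup>2))) {0..2*pi}"
    by (rule has_integral_Re[OF poisson_has_integral[of "\<lambda>_. 1", OF _ _ assms]]) auto
  moreover have 1: "Re (1 / of_real x) = 1 / x" for x by (metis Re_complex_of_real of_real_1 of_real_divide)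
  moreover have 2: "Re (complex_of_real (2 * pi) * 1 / of_real x) = 2 * pi / x" for x
    by (metis Re_complex_of_real mult.right_neutral of_real_divide)
  ultimately show ?thesis unfolding 1 2 by blast
qed

text \<open>A real linear form is Re(\<alpha> z), so the product is half the real part of \<alpha> z
  P + cnj(\<alpha> z) P. As cnj z * z = 1 on the circle, the second summand is a polynomial except
  for the term coming from the constant coefficient of P; that term is replaced by its conjugate,
  which has the same real part.\<close>

lemma Re_poly_mult_linear:
  fixes f :: "complex \<Rightarrow> real" and P :: "complex poly"
  assumes "bounded_linear f"
  shows "\<exists>Q. \<forall>z\<in>sphere 0 1. f z * Re (poly P z) = Re (poly Q z)"
proof -
  define \<alpha> where "\<alpha> = Complex (f 1) (- f \<i>)"
  have f: "f z = Re (\<alpha> * z)" for z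
  proof -
    interpret bounded_linear f by fact
    have "f (Re z *\<^sub>R 1 + Im z *\<^sub>R \<i>) = Re z * f 1 + Im z * f \<i>"
      unfolding add scaleR by simp
    moreover have "Re z *\<^sub>R 1 + Im z *\<^sub>R \<i> = z" by (simp add: complex_eq_iff)
    ultimately show ?thesis by (simp add: \<alpha>_def)
  qed
  obtain a R where P: "P = pCons a R" by (cases P)
  define Q where "Q = smult (1/2) (smult \<alpha> (pCons 0 P) + pCons 0 [:\<alpha> * cnj a:] + smult (cnj \<alpha>) R)"
  have "f z * Re (poly P z) = Re (poly Q z)" if "z \<in> sphere 0 1" for z
  proof -
    have zz: "cnj z * z = 1" using that by (simp add: complex_norm_square[symmetric] mult.commute)
    have "f z * Re (poly P z) = Re (\<alpha> * z * poly P z + cnj (\<alpha> * z) * poly P z) / 2"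
      unfolding f by (simp add: field_simps)
    also have "cnj (\<alpha> * z) * poly P z = cnj \<alpha> * cnj z * a + cnj \<alpha> * (cnj z * z) * poly R z"
      by (simp add: P algebra_simps)
    also have "\<dots> = cnj (\<alpha> * cnj a * z) + cnj \<alpha> * poly R z" by (simp add: zz)
    also have "Re (\<alpha> * z * poly P z + (cnj (\<alpha> * cnj a * z) + cnj \<alpha> * poly R z))
       = Re (\<alpha> * z * poly P z + (\<alpha> * cnj a * z + cnj \<alpha> * poly R z))"
      by (simp only: plus_complex.sel cnj.sel)
    also have "\<alpha> * z * poly P z + (\<alpha> * cnj a * z + cnj \<alpha> * poly R z) = 2 * poly Q z"
      by (simp add: Q_def algebra_simps)
    also have "Re (2 * poly Q z) / 2 = Re (poly Q z)" by simp
    finally show ?thesis .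
  qed
  then show ?thesis by blast
qed

text \<open>The factor Re P makes the induction work: a product of two functions is absorbed one
  factor after the other. The case P = 1 says that a real polynomial on the circle is the real part
  of a complex one.\<close>

lemma Re_poly_mult_real_polynomial_function:
  fixes f :: "complex \<Rightarrow> real"
  assumes "real_polynomial_function f"
  shows "\<exists>Q::complex poly. \<forall>z\<in>sphere 0 1. f z * Re (poly P z) = Re (poly Q z)"
  using assms
proof (induction f arbitrary: P rule: real_polynomial_function.induct)
  case (linear f)
  then show ?case by (rule Re_poly_mult_linear)
next
  case (const c)
  then show ?case by (intro exI[of _ "smult (of_real c) P"]) simp
next
  case (add f g)
  obtain Q1 Q2 where "\<forall>z\<in>sphere 0 1. f z * Re (poly P z) = Re (poly Q1 z)"
    "\<forall>z\<in>sphere 0 1. g z * Re (poly P z) = Re (poly Q2 z)" using add.IH by blast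
  then show ?case by (intro exI[of _ "Q1 + Q2"]) (simp add: distrib_right)
next
  case (mult f g)
  obtain Q1 where Q1: "\<forall>z\<in>sphere 0 1. g z * Re (poly P z) = Re (poly Q1 z)"
    using mult.IH by blast
  obtain Q2 where "\<forall>z\<in>sphere 0 1. f z * Re (poly Q1 z) = Re (poly Q2 z)" using mult.IH by blast
  with Q1 show ?case by (intro exI[of _ Q2]) (simp add: mult.assoc)
qed

lemma circle_approx_Re_poly:
  fixes u :: "complex \<Rightarrow> real"
  assumes "continuous_on (sphere 0 1) u" "e > 0"
  obtains P :: "complex poly" where "Im (poly P 0) = 0" "\<And>z. z \<in> sphere 0 1 \<Longrightarrow> \<bar>u z - Re (poly P z)\<bar> < e"
proof -
  obtain g where g: "real_polynomial_function g" "\<And>z. z \<in> sphere 0 1 \<Longrightarrow> \<bar>u z - g z\<bar> < e"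
    using Stone_Weierstrass_real_polynomial_function[OF compact_sphere assms] by blast
  obtain Q :: "complex poly" where Q: "\<forall>z\<in>sphere 0 1. g z = Re (poly Q z)"
    using Re_poly_mult_real_polynomial_function[OF g(1), of "[:1:]"] by auto
  \<comment> \<open>Subtracting an imaginary constant leaves the real part alone and makes the value
    at 0 real, as \<open>integral_norm_sq_le_Re\<close> requires.\<close>
  define P where "P = Q - [:\<i> * Im (poly Q 0):]"
  show ?thesis
    by (rule that[of P]) (use Q g in \<open>auto simp: P_def\<close>)
qed

section \<open>Maximum principles and the L^2 control of an analytic function by its real
  part\<close>

lemma norm_le_on_disc:
  fixes f :: "complex \<Rightarrow> complex"
  assumes "continuous_on (cball 0 1) f" "f holomorphic_on ball 0 1"
    "\<And>z. norm z = 1 \<Longrightarrow> norm (f z) \<le> B" "norm z \<le> 1"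
  shows "norm (f z) \<le> B"
  by (rule maximum_modulus_frontier[of f "cball 0 1"]) (use assms in auto)

lemma Re_ge_on_disc:
  fixes f :: "complex \<Rightarrow> complex"
  assumes "continuous_on (cball 0 1) f" "f holomorphic_on ball 0 1"
    "\<And>z. norm z = 1 \<Longrightarrow> Re (f z) \<ge> B" "norm z \<le> 1"
  shows "Re (f z) \<ge> B"
proof -
  have "norm (exp (- f z)) \<le> exp (- B)"
    by (rule norm_le_on_disc) (use assms in \<open>auto intro!: continuous_intros holomorphic_intros\<close>)
  then show ?thesis by simp
qed

text \<open>Pointwise |F|^2 = 2 (Re F)^2 - Re(F^2), and the mean of F^2 is the square of the real
  number F 0, hence nonnegative.\<close>

lemma integral_norm_sq_le_Re:
  fixes F :: "complex \<Rightarrow> complex"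
  assumes c: "continuous_on (cball 0 1) F" and h: "F holomorphic_on ball 0 1" and "Im (F 0) = 0"
  shows "integral {0..2*pi} (\<lambda>t. (norm (F (cis t)))\<^sup>2) \<le> 2 * integral {0..2*pi} (\<lambda>t. (Re (F (cis t)))\<^sup>2)"
proof -
  have cc: "continuous_on {0..2*pi} (\<lambda>t. F (cis t))"
    by (rule continuous_on_compose2[OF c]) (auto intro!: continuous_intros)
  have "((\<lambda>t. (F (cis t))\<^sup>2) has_integral (2 * pi * (F 0)\<^sup>2)) {0..2*pi}"
    using mean_value_has_integral[of "\<lambda>z. (F z)\<^sup>2"] c h by (auto intro!: continuous_intros holomorphic_intros)
  then have a: "((\<lambda>t. Re ((F (cis t))\<^sup>2)) has_integral Re (2 * pi * (F 0)\<^sup>2)) {0..2*pi}"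
    by (rule has_integral_Re)
  have "((\<lambda>t. (norm (F (cis t)))\<^sup>2) has_integral 2 * integral {0..2*pi} (\<lambda>t. (Re (F (cis t)))\<^sup>2) - Re (2 * pi * (F 0)\<^sup>2)) {0..2*pi}"
  proof -
    have "((\<lambda>t. (Re (F (cis t)))\<^sup>2) has_integral integral {0..2*pi} (\<lambda>t. (Re (F (cis t)))\<^sup>2)) {0..2*pi}"
      by (rule integrable_integral integrable_continuous_interval continuous_intros cc)+
    note has_integral_diff[OF has_integral_mult_right[OF this, of 2] a]
    moreover have "2 * (Re z)\<^sup>2 - Re (z\<^sup>2) = (norm z)\<^sup>2" for z
      by (simp add: cmod_power2) (simp add: power2_eq_square)
    ultimately show ?thesis by (simp only:)
  qed
  then have "integral {0..2*pi} (\<lambda>t. (norm (F (cis t)))\<^sup>2) = 2 * integral {0..2*pi} (\<lambda>t. (Re (F (cis t)))\<^sup>2) - Re (2 * pi * (F 0)\<^sup>2)"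
    by (rule integral_unique)
  moreover have "Re (2 * pi * (F 0)\<^sup>2) \<ge> 0" using assms(3) by (simp add: power2_eq_square)
  ultimately show ?thesis by linarith
qed

section \<open>Analytic majorants and growth\<close>

lemma norm_powr_of_real:
  fixes z :: complex
  assumes "z \<noteq> 0"
  shows "norm (z powr of_real a) = norm z powr a"
  using assms by (simp add: powr_def)

text \<open>F imitates the square of an outer function: on the circle its real part lies slightly
  above \<open>norm (h z) powr (p / 2)\<close>, and inside h / F powr (2 / p) is analytic wherever
  the zeros of h are. The factor 2 is the one of \<open>integral_norm_sq_le_Re\<close>, and d
  absorbs the error of approximation.\<close>

lemma Hardy_majorant:
  fixes h :: "complex \<Rightarrow> complex"
  assumes c: "continuous_on (cball 0 1) h" and hol: "h holomorphic_on ball 0 1"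
    and p: "p > 0" and d: "d > 0"
  obtains F where "F holomorphic_on UNIV" "\<And>z. norm z \<le> 1 \<Longrightarrow> Re (F z) > 0"
    "\<And>z. norm z \<le> 1 \<Longrightarrow> norm (h z) \<le> norm (F z) powr (2 / p)"
    "integral {0..2*pi} (\<lambda>t. (norm (F (cis t)))\<^sup>2) \<le> 2 * integral {0..2*pi} (\<lambda>t. norm (h (cis t)) powr p) + d"
proof -
  define v where "v z = norm (h z) powr (p / 2)" for z
  have cs: "continuous_on (sphere 0 1) h" by (rule continuous_on_subset[OF c]) auto
  have cv: "continuous_on (sphere 0 1) v"
    unfolding v_def by (intro continuous_on_powr' cs continuous_intros) (use p in auto)
  have v0: "v z \<ge> 0" for z by (simp add: v_def)
  have "compact (v ` sphere 0 1)" using cv by (intro compact_continuous_image) auto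
  then obtain V where V: "\<And>z. norm z = 1 \<Longrightarrow> v z \<le> V"
    by (metis (no_types) bounded_real compact_imp_bounded image_eqI mem_sphere_0 abs_ge_self order_trans)
  have V0: "V \<ge> 0" using V[of 1] v0[of 1] by simp
  \<comment> \<open>With v <= V and e <= 1 one has (v + 3 e)^2 <= v^2 + e (6 V + 9). Integrated over
    a period and doubled, the excess is 4 pi e (6 V + 9), which must not exceed d.\<close>
  define e where "e = min 1 (d / (4 * pi * (6 * V + 9)))"
  have e: "e > 0" "e \<le> 1" using V0 d by (auto simp: e_def)
  have "e \<le> d / (4 * pi * (6 * V + 9))" by (simp add: e_def)
  then have e2: "4 * pi * (e * (6 * V + 9)) \<le> d" using V0 by (simp add: pos_le_divide_eq mult_ac)
  \<comment> \<open>The shift by 2 e with tolerance e puts Re F between v + e and v + 3 e on the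
    circle. The margin e keeps F off the branch cut even where h vanishes.\<close>
  have "continuous_on (sphere 0 1) (\<lambda>z. v z + 2 * e)" by (intro continuous_intros cv)
  from circle_approx_Re_poly[OF this e(1)]
  obtain P :: "complex poly" where P: "Im (poly P 0) = 0" "\<And>z. norm z = 1 \<Longrightarrow> \<bar>v z + 2 * e - Re (poly P z)\<bar> < e"
    by (metis mem_sphere_0)
  define F where "F = poly P"
  have lo: "Re (F z) \<ge> v z + e" and up: "Re (F z) \<le> v z + 3 * e" if "norm z = 1" for z
    using P(2)[OF that] by (auto simp: F_def)
  have holF: "F holomorphic_on S" for S unfolding F_def by (intro holomorphic_intros)
  have contF: "continuous_on S F" for S using holF holomorphic_on_imp_continuous_on by blast
  have ReF: "Re (F z) \<ge> e" if "norm z \<le> 1" for z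
    by (rule Re_ge_on_disc[OF contF holF _ that]) (use lo v0 in \<open>smt (verit)\<close>)
  have F0: "F z \<noteq> 0" "F z \<notin> \<real>\<^sub>\<le>\<^sub>0" if "norm z \<le> 1" for z
    using ReF[OF that] e by (auto simp: complex_nonpos_Reals_iff)
  have F1: "0 \<le> Re (F z)" if "norm z \<le> 1" for z
    using ReF[OF that] e by linarith
  have bnd: "norm (h z) \<le> norm (F z) powr (2 / p)" if z: "norm z \<le> 1" for z
  proof -
    have "norm (h z / F z powr of_real (2 / p)) \<le> 1"
    proof (rule norm_le_on_disc[OF _ _ _ z])
      show "continuous_on (cball 0 1) (\<lambda>z. h z / F z powr of_real (2 / p))"
        using F0 by (intro continuous_intros c contF) (auto simp: F1)
      show "(\<lambda>z. h z / F z powr of_real (2 / p)) holomorphic_on ball 0 1"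
        using F0 by (intro holomorphic_intros hol holF) (auto simp: less_imp_le)
      show "norm (h z / F z powr of_real (2 / p)) \<le> 1" if z: "norm z = 1" for z
      proof -
        have "v z powr (2 / p) = norm (h z)" using p by (simp add: v_def powr_powr)
        moreover have "v z \<le> norm (F z)"
          using lo[OF z] e complex_Re_le_cmod[of "F z"] by linarith
        ultimately have "norm (h z) \<le> norm (F z) powr (2 / p)"
          using powr_mono2[of "2 / p" "v z" "norm (F z)"] v0 p by simp
        then show ?thesis
          using F0(1)[of z] z by (simp add: norm_divide norm_powr_of_real divide_le_eq_1 del: of_real_divide)
      qed
    qed
    then show ?thesis
      using F0(1)[OF z] by (simp add: norm_divide norm_powr_of_real divide_le_eq_1 del: of_real_divide)
  qed
  have ch: "continuous_on {0..2*pi} (\<lambda>t. h (cis t))"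
    by (rule continuous_on_compose2[OF cs]) (auto intro!: continuous_intros)
  have cF: "continuous_on {0..2*pi} (\<lambda>t. F (cis t))"
    by (rule continuous_on_compose2[OF contF[of UNIV]]) (auto intro!: continuous_intros)
  have "integral {0..2*pi} (\<lambda>t. (Re (F (cis t)))\<^sup>2) \<le> integral {0..2*pi} (\<lambda>t. norm (h (cis t)) powr p + e * (6 * V + 9))"
  proof (rule integral_le)
    show "(\<lambda>t. (Re (F (cis t)))\<^sup>2) integrable_on {0..2*pi}"
      by (intro integrable_continuous_interval continuous_intros cF)
    show "(\<lambda>t. norm (h (cis t)) powr p + e * (6 * V + 9)) integrable_on {0..2*pi}"
      by (intro integrable_continuous_interval continuous_intros continuous_on_powr' ch) (use p in auto)
    fix t
    let ?v = "v (cis t)"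
    have "(Re (F (cis t)))\<^sup>2 \<le> (?v + 3 * e)\<^sup>2"
      using ReF[of "cis t"] up[of "cis t"] e by (intro power_mono) auto
    also have "\<dots> = ?v\<^sup>2 + e * (6 * ?v) + 9 * (e * e)" by (simp add: power2_eq_square algebra_simps)
    also have "\<dots> \<le> ?v\<^sup>2 + e * (6 * V) + 9 * (e * 1)"
      using V[of "cis t"] e by (intro add_mono mult_left_mono) auto
    also have "?v\<^sup>2 = norm (h (cis t)) powr p"
      by (simp add: v_def power2_eq_square flip: powr_add)
    finally show "(Re (F (cis t)))\<^sup>2 \<le> norm (h (cis t)) powr p + e * (6 * V + 9)"
      by (simp add: algebra_simps)
  qed
  also have "\<dots> = integral {0..2*pi} (\<lambda>t. norm (h (cis t)) powr p) + 2 * pi * (e * (6 * V + 9))"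
    by (subst Henstock_Kurzweil_Integration.integral_add)
      (auto intro!: integrable_continuous_interval continuous_intros continuous_on_powr' ch simp: p)
  finally have *: "integral {0..2*pi} (\<lambda>t. (Re (F (cis t)))\<^sup>2) \<le> \<dots>" .
  have "integral {0..2*pi} (\<lambda>t. (norm (F (cis t)))\<^sup>2) \<le> 2 * integral {0..2*pi} (\<lambda>t. norm (h (cis t)) powr p) + d"
    using integral_norm_sq_le_Re[OF contF holF, of] P(1) * e2 by (simp add: F_def)
  then show ?thesis
    using that[OF holF _ bnd] ReF e by (metis less_le_trans)
qed

text \<open>The Poisson formula is applied to the analytic function F^2, so subharmonicity of |F|^2
  is not invoked; the kernel is at most 1 / (1 - |w|)^2, and (1 - |w|^2) / (1 - |w|)^2 <= 2 / (1 -
  |w|).\<close>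

lemma norm_sq_le_circle_integral:
  fixes F :: "complex \<Rightarrow> complex"
  assumes c: "continuous_on (cball 0 1) F" and hol: "F holomorphic_on ball 0 1" and w: "norm w < 1"
  shows "(norm (F w))\<^sup>2 \<le> integral {0..2*pi} (\<lambda>t. (norm (F (cis t)))\<^sup>2) / (pi * (1 - norm w))"
proof -
  let ?I = "integral {0..2*pi} (\<lambda>t. (norm (F (cis t)))\<^sup>2)"
  have cF: "continuous_on {0..2*pi} (\<lambda>t. F (cis t))"
    by (rule continuous_on_compose2[OF c]) (auto intro!: continuous_intros)
  have iF: "(\<lambda>t. (norm (F (cis t)))\<^sup>2) integrable_on {0..2*pi}"
    by (intro integrable_continuous_interval continuous_intros cF)
  have hi: "((\<lambda>t. (F (cis t))\<^sup>2 / of_real ((norm (1 - cnj w * cis t))\<^sup>2)) has_integral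
           (2 * pi * (F w)\<^sup>2 / of_real (1 - (norm w)\<^sup>2))) {0..2*pi}"
    using poisson_has_integral[of "\<lambda>z. (F z)\<^sup>2" w] c hol w by (auto intro!: continuous_intros holomorphic_intros)
  have w2: "1 - (norm w)\<^sup>2 = (1 - norm w) * (1 + norm w)" by (simp add: power2_eq_square algebra_simps)
  have pos: "1 - (norm w)\<^sup>2 > 0" unfolding w2 using w by (intro mult_pos_pos add_pos_nonneg) auto
  have "norm (integral {0..2*pi} (\<lambda>t. (F (cis t))\<^sup>2 / of_real ((norm (1 - cnj w * cis t))\<^sup>2)))
      \<le> integral {0..2*pi} (\<lambda>t. (norm (F (cis t)))\<^sup>2 * (1 / (1 - norm w)\<^sup>2))"
  proof (rule integral_norm_bound_integral)
    show "(\<lambda>t. (norm (F (cis t)))\<^sup>2 * (1 / (1 - norm w)\<^sup>2)) integrable_on {0..2*pi}"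
      using iF by (rule integrable_on_mult_left)
    fix t
    have "1 - norm w \<le> norm (1 - cnj w * cis t)" by (rule one_minus_cnj_mult_norm_ge) simp
    then have "(1 - norm w)\<^sup>2 \<le> (norm (1 - cnj w * cis t))\<^sup>2" using w by (intro power_mono) auto
    then show "norm ((F (cis t))\<^sup>2 / of_real ((norm (1 - cnj w * cis t))\<^sup>2)) \<le> (norm (F (cis t)))\<^sup>2 * (1 / (1 - norm w)\<^sup>2)"
      using w \<open>1 - norm w \<le> norm (1 - cnj w * cis t)\<close>
      by (auto simp: norm_divide norm_power intro!: divide_left_mono mult_pos_pos zero_less_power)
  qed (use hi in blast)
  also have "\<dots> = ?I / (1 - norm w)\<^sup>2" by simp
  also have "integral {0..2*pi} (\<lambda>t. (F (cis t))\<^sup>2 / of_real ((norm (1 - cnj w * cis t))\<^sup>2))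
     = 2 * pi * (F w)\<^sup>2 / of_real (1 - (norm w)\<^sup>2)" using hi by (rule integral_unique)
  also have "norm \<dots> = 2 * pi * (norm (F w))\<^sup>2 / (1 - (norm w)\<^sup>2)"
    unfolding norm_divide norm_mult norm_power norm_of_real using pos by simp
  finally have "(norm (F w))\<^sup>2 * (2 * pi) \<le> ?I / (1 - norm w)\<^sup>2 * (1 - (norm w)\<^sup>2)"
    using pos by (simp add: pos_divide_le_eq mult_ac)
  also have "\<dots> = ?I * (1 + norm w) / (1 - norm w)"
    unfolding w2 using w by (simp add: power2_eq_square)
  also have "\<dots> \<le> ?I * 2 / (1 - norm w)"
    using w iF by (intro divide_right_mono mult_left_mono integral_nonneg) auto
  finally show ?thesis using w by (simp add: field_simps)
qed

text \<open>The majorant replaces |h|^p by |F|^2, so the H^2 estimate serves every p > 0. The error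
  allowed in the majorant is e times the denominator \<open>?d\<close>, hence exactly e after
  division, and e is arbitrary.\<close>

lemma Hardy_growth_closed_disc:
  fixes h :: "complex \<Rightarrow> complex"
  assumes c: "continuous_on (cball 0 1) h" and hol: "h holomorphic_on ball 0 1" and w: "norm w < 1"
    and p: "p > 0"
  shows "norm (h w) powr p \<le> 2 * integral {0..2*pi} (\<lambda>t. norm (h (cis t)) powr p) / (pi * (1 - norm w))"
proof (rule field_le_epsilon)
  fix e :: real assume "e > 0"
  let ?I = "integral {0..2*pi} (\<lambda>t. norm (h (cis t)) powr p)"
  let ?d = "pi * (1 - norm w)"
  have d: "?d > 0" using w by simp
  then have "e * ?d > 0" using \<open>e > 0\<close> by simp
  obtain F where F: "F holomorphic_on UNIV"
    "\<And>z. norm z \<le> 1 \<Longrightarrow> norm (h z) \<le> norm (F z) powr (2 / p)"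
    "integral {0..2*pi} (\<lambda>t. (norm (F (cis t)))\<^sup>2) \<le> 2 * ?I + e * ?d"
    using Hardy_majorant[OF c hol p \<open>e * ?d > 0\<close>] by metis
  have "norm (h w) powr p \<le> (norm (F w) powr (2 / p)) powr p"
    using F(2)[of w] w p by (intro powr_mono2) auto
  also have "\<dots> = (norm (F w))\<^sup>2" using p by (simp add: powr_powr powr_numeral)
  also have "\<dots> \<le> integral {0..2*pi} (\<lambda>t. (norm (F (cis t)))\<^sup>2) / ?d"
    by (rule norm_sq_le_circle_integral)
      (use F(1) w holomorphic_on_imp_continuous_on holomorphic_on_subset continuous_on_subset in blast)+
  also have "\<dots> \<le> (2 * ?I + e * ?d) / ?d" using F(3) d by (intro divide_right_mono) auto
  also have "\<dots> = 2 * ?I / ?d + e" using w by (simp add: add_divide_distrib)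
  finally show "norm (h w) powr p \<le> 2 * ?I / ?d + e" .
qed

section \<open>The circle measure\<close>

lemma sets_circle_measure [simp, measurable_cong]: "sets circle_measure = sets borel"
  by (simp add: circle_measure_def)

lemma space_circle_measure [simp]: "space circle_measure = UNIV"
  by (simp add: circle_measure_def)

lemma nn_integral_circle_measure:
  assumes "f \<in> borel_measurable borel"
  shows "(\<integral>\<^sup>+ \<xi>. f \<xi> \<partial>circle_measure) = ennreal (1 / (2 * pi)) * (\<integral>\<^sup>+ t. f (cis t) * indicator {0..<2*pi} t \<partial>lborel)"
proof -
  have [measurable]: "cis \<in> borel_measurable borel"
    by (intro borel_measurable_continuous_onI continuous_intros)
  have [measurable]: "cis \<in> borel_measurable (restrict_space lborel A)" for A
    by (rule measurable_restrict_space1) measurable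
  note [measurable] = assms
  have "(\<integral>\<^sup>+ \<xi>. f \<xi> \<partial>circle_measure) = (\<integral>\<^sup>+ t. ennreal (1 / (2 * pi)) * f (cis t) \<partial>restrict_space lborel {0..<2*pi})"
    unfolding circle_measure_def by (subst nn_integral_distr, measurable, subst nn_integral_density) (auto)
  also have "\<dots> = (\<integral>\<^sup>+ t. ennreal (1 / (2 * pi)) * f (cis t) * indicator {0..<2*pi} t \<partial>lborel)"
    by (subst nn_integral_restrict_space) auto
  also have "\<dots> = ennreal (1 / (2 * pi)) * (\<integral>\<^sup>+ t. f (cis t) * indicator {0..<2*pi} t \<partial>lborel)"
    by (subst nn_integral_cmult[symmetric]) (auto simp: mult_ac)
  finally show ?thesis .
qed

lemma emeasure_circle_measure:
  assumes "A \<in> sets borel"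
  shows "emeasure circle_measure A = ennreal (1 / (2 * pi)) * emeasure lborel ({0..<2*pi} \<inter> cis -` A)"
proof -
  have [measurable]: "cis \<in> borel_measurable borel"
    by (intro borel_measurable_continuous_onI continuous_intros)
  note [measurable] = assms
  have "emeasure circle_measure A = (\<integral>\<^sup>+ \<xi>. indicator A \<xi> \<partial>circle_measure)"
    using assms by simp
  also have "\<dots> = ennreal (1 / (2 * pi)) * (\<integral>\<^sup>+ t. indicator A (cis t) * indicator {0..<2*pi} t \<partial>lborel)"
    using assms by (intro nn_integral_circle_measure) auto
  also have "(\<integral>\<^sup>+ t. indicator A (cis t) * indicator {0..<2*pi} t \<partial>lborel)
      = (\<integral>\<^sup>+ t. indicator ({0..<2*pi} \<inter> cis -` A) t \<partial>lborel)"
    by (intro nn_integral_cong) (auto split: split_indicator)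
  also have "\<dots> = emeasure lborel ({0..<2*pi} \<inter> cis -` A)"
    by (intro nn_integral_indicator) measurable
  finally show ?thesis .
qed

lemma AE_circle_measure_sphere: "AE \<xi> in circle_measure. \<xi> \<in> sphere 0 1"
proof (rule AE_I[where N = "- sphere 0 1"])
  show "emeasure circle_measure (- sphere 0 1) = 0"
    by (subst emeasure_circle_measure) (auto simp: vimage_def)
qed auto

lemma nn_integral_circle_measure_continuous:
  assumes c: "continuous_on (sphere 0 1) u" and nn: "\<And>z. norm z = 1 \<Longrightarrow> u z \<ge> 0"
  shows "(\<integral>\<^sup>+ \<xi>. ennreal (u \<xi>) \<partial>circle_measure) = ennreal (integral {0..2*pi} (\<lambda>t. u (cis t)) / (2 * pi))"
proof -
  \<comment> \<open>\<open>u\<close> is controlled on the circle only; its extension by zero is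
    Borel on the whole plane and equals it almost everywhere.\<close>
  define v where "v \<xi> = (if \<xi> \<in> sphere 0 1 then u \<xi> else 0)" for \<xi>
  have v: "v \<in> borel_measurable borel"
    unfolding v_def by (intro borel_measurable_continuous_on_if c continuous_intros) auto
  have cu: "continuous_on {0..2*pi} (\<lambda>t. u (cis t))"
    by (rule continuous_on_compose2[OF c]) (auto intro!: continuous_intros)
  have "(\<integral>\<^sup>+ \<xi>. ennreal (u \<xi>) \<partial>circle_measure) = (\<integral>\<^sup>+ \<xi>. ennreal (v \<xi>) \<partial>circle_measure)"
    by (rule nn_integral_cong_AE, rule AE_mp[OF AE_circle_measure_sphere]) (auto simp: v_def)
  also have "\<dots> = ennreal (1 / (2 * pi)) * (\<integral>\<^sup>+ t. ennreal (v (cis t)) * indicator {0..<2*pi} t \<partial>lborel)"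
    using v by (intro nn_integral_circle_measure) auto
  also have "(\<integral>\<^sup>+ t. ennreal (v (cis t)) * indicator {0..<2*pi} t \<partial>lborel)
     = (\<integral>\<^sup>+ t. ennreal (u (cis t)) * indicator {0..2*pi} t \<partial>lborel)"
    by (rule nn_integral_cong_AE, rule AE_mp[OF AE_lborel_singleton[of "2*pi"]])
      (auto simp: v_def split: split_indicator)
  also have "\<dots> = integral {0..2*pi} (\<lambda>t. u (cis t))"
    by (rule nn_integral_has_integral_lebesgue')
       (use nn cu in \<open>auto intro!: integrable_integral integrable_continuous_interval\<close>)
  finally show ?thesis
    by (simp add: ennreal_mult[symmetric] integral_nonneg integrable_continuous_interval cu nn)
qed

text \<open>Passage from extended integrals to ordinary ones: for analytic f the integrand on each
  circle is continuous, and 2 pi undoes the normalization of the measure.\<close>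

lemma hardy_pow_le_iff:
  assumes "f holomorphic_on ball 0 1" "p > 0" "M \<ge> 0"
  shows "hardy_pow p f \<le> ennreal M \<longleftrightarrow>
    (\<forall>r\<in>{0..<1}. integral {0..2*pi} (\<lambda>t. norm (f (complex_of_real r * cis t)) powr p) \<le> 2 * pi * M)"
proof -
  have "(\<integral>\<^sup>+ \<xi>. ennreal (norm (f (complex_of_real r * \<xi>)) powr p) \<partial>circle_measure) \<le> ennreal M \<longleftrightarrow>
     integral {0..2*pi} (\<lambda>t. norm (f (complex_of_real r * cis t)) powr p) \<le> 2 * pi * M" if r: "r \<in> {0..<1}" for r
  proof -
    have "continuous_on (sphere 0 1) (\<lambda>\<xi>. f (complex_of_real r * \<xi>))"
      by (rule continuous_on_compose2[OF holomorphic_on_imp_continuous_on[OF assms(1)]])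
        (use r in \<open>auto intro!: continuous_intros simp: norm_mult\<close>)
    then have "continuous_on (sphere 0 1) (\<lambda>\<xi>. norm (f (complex_of_real r * \<xi>)) powr p)"
      by (intro continuous_on_powr' continuous_intros) (use assms in auto)
    then show ?thesis
      using assms(3) by (subst nn_integral_circle_measure_continuous)
        (auto simp: ennreal_le_iff field_simps)
  qed
  then show ?thesis by (simp add: hardy_pow_def SUP_le_iff)
qed

section \<open>A maximal inequality for radial limits\<close>

lemma integral_fold:
  fixes g :: "real \<Rightarrow> real"
  assumes g: "continuous_on {c - s..c + s} g" and "s \<ge> 0"
  shows "integral {c - s..c + s} g = integral {0..s} (\<lambda>t. g (c + t) + g (c - t))"
proof -
  have g1: "g integrable_on {c..c + s}" and g2: "g integrable_on {c - s..c}"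
    using assms by (auto intro!: integrable_continuous_interval intro: continuous_on_subset[OF g])
  have i1: "((\<lambda>t. g (c + t)) has_integral integral {c..c + s} g) {0..s}"
    using has_integral_shift_Icc_real[of g c "integral {c..c + s} g" 0 s] integrable_integral[OF g1]
    by (simp add: o_def add.commute)
  have "((\<lambda>t. g (c + t)) has_integral integral {c - s..c} g) {-s..-0}"
    using has_integral_shift_Icc_real[of g c "integral {c - s..c} g" "-s" 0] integrable_integral[OF g2]
    by (simp add: o_def add.commute)
  then have "((\<lambda>t. g (c + - t)) has_integral integral {c - s..c} g) {0..s}"
    using has_integral_reflect_real[of "\<lambda>t. g (c + - t)" "integral {c - s..c} g" s 0] by simp
  then have i2: "((\<lambda>t. g (c - t)) has_integral integral {c - s..c} g) {0..s}" by simp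
  have "integral {c - s..c + s} g = integral {c - s..c} g + integral {c..c + s} g"
    using assms by (intro Henstock_Kurzweil_Integration.integral_combine[symmetric] integrable_continuous_interval) auto
  then show ?thesis using integral_unique[OF has_integral_add[OF i1 i2]] by simp
qed

lemma cmod_one_minus_cis_sq: "(norm (1 - complex_of_real r * cis t))\<^sup>2 = 1 - 2 * r * cos t + r\<^sup>2"
proof -
  have "(r * sin t)\<^sup>2 = r\<^sup>2 - (r * cos t)\<^sup>2"
    by (simp add: power_mult_distrib sin_squared_eq algebra_simps)
  then show ?thesis
    by (simp add: cmod_power2) (simp add: power2_eq_square algebra_simps)
qed

text \<open>Folding the Poisson kernel at the opposite point \<open>-r\<close> makes it a decreasing function on
  \<open>{0..pi}\<close>; integration by parts then writes the Poisson integral as an average of the centred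
  means of \<open>norm \<circ> H\<close>.\<close>

lemma radial_le_of_centred_means_le:
  fixes H :: "complex \<Rightarrow> complex"
  assumes c: "continuous_on (cball 0 1) H" and hol: "H holomorphic_on ball 0 1"
    and r: "0 \<le> r" "r < 1"
    and means: "\<And>s. 0 < s \<Longrightarrow> s \<le> pi \<Longrightarrow> integral {\<theta> - s..\<theta> + s} (\<lambda>t. norm (H (cis t))) \<le> 2 * s * \<kappa>"
  shows "norm (H (complex_of_real r * cis \<theta>)) \<le> \<kappa>"
proof -
  define u where "u t = norm (H (cis t))" for t
  have cH: "continuous_on S (\<lambda>t. H (cis t))" for S
    by (rule continuous_on_compose2[OF c]) (auto intro!: continuous_intros)
  have cu: "continuous_on S u" for S unfolding u_def by (intro continuous_intros cH)
  define v where "v t = u (\<theta> + t) + u (\<theta> - t)" for t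
  have cv: "continuous_on S v" for S
    unfolding v_def by (intro continuous_intros continuous_on_compose2[OF cu[of UNIV]]) auto
  define D where "D t = 1 - 2 * r * cos t + r\<^sup>2" for t
  have D: "D t > 0" for t
  proof -
    have "r * cos t \<le> r * 1" using r by (intro mult_left_mono) auto
    then have "(1 - r)\<^sup>2 \<le> D t" by (simp add: D_def power2_eq_square algebra_simps)
    then show ?thesis using r by (smt (verit) zero_less_power2)
  qed
  define k where "k t = 1 / D t" for t
  define k' where "k' t = - (2 * r * sin t) / (D t)\<^sup>2" for t
  have dk: "(k has_real_derivative k' t) (at t within S)" for t S
  proof -
    have "(D has_real_derivative 2 * r * sin t) (at t within S)"
      unfolding D_def by (auto intro!: derivative_eq_intros)
    from DERIV_inverse_fun[OF this] D[of t] show ?thesis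
      unfolding k_def k'_def by (simp add: divide_inverse power2_eq_square mult_ac)
  qed
  have ck: "continuous_on S k" for S
    by (rule DERIV_continuous_on) (rule dk)
  have k0: "k t > 0" for t using D by (simp add: k_def)
  define \<Phi> where "\<Phi> s = integral {0..s} v" for s
  \<comment> \<open>After folding, the hypothesis on the centred means says exactly W <= 0 on
    \<open>{0..pi}\<close>.\<close>
  define W where "W s = \<Phi> s - 2 * \<kappa> * s" for s
  have d\<Phi>: "(\<Phi> has_real_derivative v t) (at t within {0..pi})" if "t \<in> {0..pi}" for t
    unfolding \<Phi>_def by (rule integral_has_real_derivative[OF cv that])
  have dW: "(W has_real_derivative (v t - 2 * \<kappa>)) (at t within {0..pi})" if "t \<in> {0..pi}" for t
    unfolding W_def by (auto intro!: derivative_eq_intros d\<Phi> that)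
  have W0: "W 0 = 0" by (simp add: W_def \<Phi>_def)
  have Wle: "W s \<le> 0" if "s \<in> {0..pi}" for s
  proof (cases "s = 0")
    case False
    have "integral {\<theta> - s..\<theta> + s} u \<le> 2 * s * \<kappa>"
      using means[of s] that False unfolding u_def by auto
    moreover have "integral {\<theta> - s..\<theta> + s} u = integral {0..s} v"
      using integral_fold[OF cu, of s \<theta>] that unfolding v_def by simp
    ultimately show ?thesis by (simp add: W_def \<Phi>_def mult_ac)
  qed (simp add: W0)
  have FT: "((\<lambda>t. k t * (v t - 2 * \<kappa>) + k' t * W t) has_integral (k pi * W pi - k 0 * W 0)) {0..pi}"
    by (rule fundamental_theorem_of_calculus)
      (auto simp: has_real_derivative_iff_has_vector_derivative[symmetric]
         intro!: derivative_eq_intros dk dW)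
  have ik: "(\<lambda>t. k t * (v t - 2 * \<kappa>)) integrable_on {0..pi}"
    by (intro integrable_continuous_interval continuous_intros ck cv)
  have "integral {0..pi} (\<lambda>t. k t * (v t - 2 * \<kappa>)) \<le> k pi * W pi - k 0 * W 0"
  proof (rule has_integral_le[OF integrable_integral[OF ik] FT])
    fix t assume t: "t \<in> {0..pi}"
    then have "k' t \<le> 0" using r sin_ge_zero[of t] by (simp add: k'_def divide_nonpos_nonneg)
    then show "k t * (v t - 2 * \<kappa>) \<le> k t * (v t - 2 * \<kappa>) + k' t * W t"
      using Wle[OF t] by (simp add: mult_nonpos_nonpos)
  qed
  also have "\<dots> \<le> 0" using k0[of pi] Wle[of pi] W0 by (simp add: mult_nonneg_nonpos)
  also have "integral {0..pi} (\<lambda>t. k t * (v t - 2 * \<kappa>)) = integral {0..pi} (\<lambda>t. k t * v t) - \<kappa> * integral {0..pi} (\<lambda>t. 2 * k t)"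
  proof -
    have "integral {0..pi} (\<lambda>t. k t * v t - \<kappa> * (2 * k t)) = integral {0..pi} (\<lambda>t. k t * v t) - integral {0..pi} (\<lambda>t. \<kappa> * (2 * k t))"
      by (intro Henstock_Kurzweil_Integration.integral_diff integrable_continuous_interval continuous_intros ck cv)
    then show ?thesis by (simp add: algebra_simps)
  qed
  finally have kv: "integral {0..pi} (\<lambda>t. k t * v t) \<le> \<kappa> * integral {0..pi} (\<lambda>t. 2 * k t)" by simp
  have kk: "1 / (norm (1 - cnj (- complex_of_real r) * cis t))\<^sup>2 = k (t - pi)" for t
  proof -
    have "1 - cnj (- complex_of_real r) * cis t = 1 - complex_of_real r * cis (t - pi)"
      by (simp add: cis_divide[symmetric])
    then show ?thesis by (simp add: cmod_one_minus_cis_sq k_def D_def)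
  qed
  have keven: "k (- t) = k t" for t by (simp add: k_def D_def)
  have nr: "norm (- complex_of_real r) < 1" "1 - (norm (- complex_of_real r))\<^sup>2 = 1 - r\<^sup>2"
    using r by auto
  have r2: "1 - r\<^sup>2 > 0" using r by (simp add: power_less_one_iff)
  have ckp: "continuous_on S (\<lambda>t. k (t - pi))" for S
    by (intro continuous_on_compose2[OF ck[of UNIV]] continuous_intros) auto
  have fold: "integral {0..2 * pi} g = integral {0..pi} (\<lambda>t. g (pi + t) + g (pi - t))"
    if "continuous_on UNIV g" for g :: "real \<Rightarrow> real"
    using integral_fold[of pi pi g] continuous_on_subset[OF that] by simp
  have "integral {0..2*pi} (\<lambda>t. k (t - pi)) = 2 * pi / (1 - r\<^sup>2)"
    using poisson_kernel_has_integral[OF nr(1)] unfolding kk nr(2) by (rule integral_unique)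
  then have k_int: "integral {0..pi} (\<lambda>t. 2 * k t) = 2 * pi / (1 - r\<^sup>2)"
    using fold[OF ckp] by (simp add: keven)
  \<comment> \<open>This rotation carries the point under study to -r. The kernel of -r peaks at t =
    pi, the midpoint of \<open>{0..2*pi}\<close>, where the fold takes place.\<close>
  define G where "G z = H (- cis \<theta> * z)" for z
  have cG: "continuous_on (cball 0 1) G" unfolding G_def
    by (rule continuous_on_compose2[OF c]) (auto intro!: continuous_intros simp: norm_mult)
  have hG: "G holomorphic_on ball 0 1" unfolding G_def
    by (rule holomorphic_on_compose_gen[OF _ hol, unfolded o_def]) (auto intro!: holomorphic_intros simp: norm_mult)
  have PI: "((\<lambda>t. G (cis t) * of_real (k (t - pi))) has_integral
           (2 * pi * G (- of_real r) / of_real (1 - r\<^sup>2))) {0..2*pi}"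
    using poisson_has_integral[OF cG hG nr(1)] unfolding nr(2) kk[symmetric] by (simp add: divide_inverse)
  have cGc: "continuous_on S (\<lambda>t. G (cis t))" for S
    by (rule continuous_on_compose2[OF cG]) (auto intro!: continuous_intros)
  have "norm (integral {0..2*pi} (\<lambda>t. G (cis t) * of_real (k (t - pi)))) \<le> integral {0..2*pi} (\<lambda>t. norm (G (cis t)) * k (t - pi))"
    by (rule integral_norm_bound_integral)
      (auto intro!: integrable_continuous_interval continuous_intros cGc ckp simp: norm_mult less_imp_le[OF k0])
  also have "\<dots> = integral {0..pi} (\<lambda>t. k t * v t)"
  proof -
    have g1: "norm (G (cis (pi + t))) = u (\<theta> + t)" for t
      by (simp add: G_def u_def flip: cis_mult)
    have g2: "norm (G (cis (pi - t))) = u (\<theta> - t)" for t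
      by (simp add: G_def u_def flip: cis_mult cis_divide)
    have "norm (G (cis (pi + t))) * k (pi + t - pi) + norm (G (cis (pi - t))) * k (pi - t - pi) = k t * v t" for t
      unfolding g1 g2 by (simp add: keven v_def algebra_simps)
    then show ?thesis
      by (subst fold) (auto intro!: continuous_intros cGc ckp)
  qed
  also note kv
  also have "integral {0..2*pi} (\<lambda>t. G (cis t) * of_real (k (t - pi))) = 2 * pi * G (- of_real r) / of_real (1 - r\<^sup>2)"
    using PI by (rule integral_unique)
  also have "norm \<dots> = norm (G (- of_real r)) * (2 * pi / (1 - r\<^sup>2))"
    unfolding norm_divide norm_mult norm_of_real using r2 by simp
  finally have "norm (G (- of_real r)) * (2 * pi / (1 - r\<^sup>2)) \<le> \<kappa> * (2 * pi / (1 - r\<^sup>2))"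
    unfolding k_int .
  then have "norm (G (- of_real r)) \<le> \<kappa>"
    by (rule mult_right_le_imp_le) (use r2 in simp)
  then show ?thesis by (simp add: G_def mult.commute)
qed

lemma integral_three_periods:
  fixes u :: "real \<Rightarrow> real"
  assumes "continuous_on UNIV u" and per: "\<And>t. u (t + 2 * pi) = u t"
  shows "integral {-2*pi..4*pi} u = 3 * integral {0..2*pi} u"
proof -
  have i: "u integrable_on {a..b}" for a b
    using continuous_on_subset[OF assms(1)] by (intro integrable_continuous_interval) auto
  have o: "u \<circ> (+) (2 * pi) = u" by (auto simp: add.commute[of "2 * pi"] per)
  have "integral {-2*pi..0} u = integral {0..2*pi} u"
    using has_integral_shift_Icc_real[of u "2*pi" _ "-2*pi" 0] integrable_integral[OF i, of 0 "2*pi"]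
    unfolding o by (intro integral_unique) simp
  moreover have "integral {0..2*pi} u = integral {2*pi..4*pi} u"
    using has_integral_shift_Icc_real[of u "2*pi" _ 0 "2*pi"] integrable_integral[OF i, of "2*pi" "4*pi"]
    unfolding o by (intro integral_unique) simp
  moreover have "integral {-2*pi..0} u + integral {0..2*pi} u = integral {-2*pi..2*pi} u"
    by (rule Henstock_Kurzweil_Integration.integral_combine) (auto intro: i)
  moreover have "integral {-2*pi..2*pi} u + integral {2*pi..4*pi} u = integral {-2*pi..4*pi} u"
    by (rule Henstock_Kurzweil_Integration.integral_combine) (auto intro: i)
  ultimately show ?thesis by simp
qed

text \<open>Each radius contributes a relatively open subset of the circle, so the union over
  uncountably many radii is still Borel.\<close>

lemma borel_radial_exceedance:
  fixes H :: "complex \<Rightarrow> complex"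
  assumes "continuous_on (ball 0 1) H"
  shows "{\<xi> \<in> sphere 0 1. \<exists>r\<in>{0..<1}. norm (H (complex_of_real r * \<xi>)) > \<kappa>} \<in> sets borel"
proof -
  have o: "openin (top_of_set (sphere 0 1)) {\<xi> \<in> sphere 0 1. norm (H (complex_of_real r * \<xi>)) \<in> {\<kappa><..}}"
    if "r \<in> {0..<1}" for r
  proof -
    have "continuous_on (sphere 0 1) (\<lambda>\<xi>. norm (H (complex_of_real r * \<xi>)))"
      by (intro continuous_intros continuous_on_compose2[OF assms]) (use that in \<open>auto simp: norm_mult\<close>)
    from continuous_openin_preimage_gen[OF this open_greaterThan, of \<kappa>] show ?thesis
      by (simp add: vimage_def Int_def)
  qed
  have "openin (top_of_set (sphere 0 1)) (\<Union>r\<in>{0..<1}. {\<xi> \<in> sphere 0 1. norm (H (complex_of_real r * \<xi>)) \<in> {\<kappa><..}})"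
    using o by (intro openin_Union) auto
  then obtain T where "open T" and T: "(\<Union>r\<in>{0..<1}. {\<xi> \<in> sphere 0 1. norm (H (complex_of_real r * \<xi>)) \<in> {\<kappa><..}}) = sphere 0 1 \<inter> T"
    by (auto simp: openin_open)
  have "{\<xi> \<in> sphere 0 1. \<exists>r\<in>{0..<1}. norm (H (complex_of_real r * \<xi>)) > \<kappa>} = sphere 0 1 \<inter> T"
    unfolding T[symmetric] by auto
  then show ?thesis using \<open>open T\<close> by (simp add: borel_closed borel_open sets.Int)
qed

text \<open>By contraposition of \<open>radial_le_of_centred_means_le\<close>, a bad angle is the
  centre of an interval of half-length at most pi on which |H| has mean above \<kappa>. Vitali's
  lemma selects disjoint intervals whose fivefold enlargements cover all bad angles; the selected
  ones lie within three periods. Hence the constant 15 = 5 * 3.\<close>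

lemma radial_weak_type_closed_disc:
  fixes H :: "complex \<Rightarrow> complex"
  assumes c: "continuous_on (cball 0 1) H" and hol: "H holomorphic_on ball 0 1" and l: "\<kappa> > 0"
  shows "emeasure circle_measure {\<xi> \<in> sphere 0 1. \<exists>r\<in>{0..<1}. norm (H (complex_of_real r * \<xi>)) > \<kappa>}
    \<le> ennreal (15 / \<kappa> * (integral {0..2*pi} (\<lambda>t. norm (H (cis t))) / (2 * pi)))"
proof -
  define A where "A = {\<xi> \<in> sphere 0 1. \<exists>r\<in>{0..<1}. norm (H (complex_of_real r * \<xi>)) > \<kappa>}"
  have A_borel: "A \<in> sets borel"
    unfolding A_def by (intro borel_radial_exceedance holomorphic_on_imp_continuous_on hol)
  define u where "u t = norm (H (cis t))" for t
  have cu: "continuous_on S u" for S unfolding u_def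
    by (intro continuous_intros continuous_on_compose2[OF c]) auto
  have iu: "u integrable_on {a..b}" for a b by (intro integrable_continuous_interval cu)
  define E where "E = {0..<2*pi} \<inter> cis -` A"
  have "\<exists>s. 0 < s \<and> s \<le> pi \<and> integral {\<theta> - s..\<theta> + s} u > 2 * s * \<kappa>" if "\<theta> \<in> E" for \<theta>
    using that radial_le_of_centred_means_le[OF c hol, of _ \<theta> \<kappa>] unfolding E_def A_def u_def
    by (force simp: not_le[symmetric])
  then obtain s where s: "\<And>\<theta>. \<theta> \<in> E \<Longrightarrow> 0 < s \<theta> \<and> s \<theta> \<le> pi"
    and big: "\<And>\<theta>. \<theta> \<in> E \<Longrightarrow> integral {\<theta> - s \<theta>..\<theta> + s \<theta>} u > 2 * s \<theta> * \<kappa>"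
    by metis
  have cov: "E \<subseteq> (\<Union>\<theta>\<in>E. cball \<theta> (s \<theta>))" 
  proof
    fix \<theta> assume "\<theta> \<in> E"
    then show "\<theta> \<in> (\<Union>\<theta>\<in>E. cball \<theta> (s \<theta>))"
      using s by (intro UN_I[of \<theta>]) (auto simp: less_imp_le)
  qed
  obtain C where C: "countable C" "C \<subseteq> E"
    "pairwise (\<lambda>i j. disjnt (cball i (s i)) (cball j (s j))) C" "E \<subseteq> (\<Union>i\<in>C. cball i (5 * s i))"
    by (rule Vitali_covering_lemma_cballs[OF cov s], assumption, rule that)
  define f where "f = from_nat_into C"
  define N where "N = to_nat_on C ` C"
  have fN: "f n \<in> C" "to_nat_on C (f n) = n" if "n \<in> N" for n
    using that C(1) by (auto simp: f_def N_def)
  have fC: "\<exists>n\<in>N. f n = i" if "i \<in> C" for i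
    using that C(1) by (auto simp: f_def N_def)
  define X where "X n = (if n \<in> N then cball (f n) (s (f n)) else {})" for n
  define Y where "Y n = (if n \<in> N then cball (f n) (5 * s (f n)) else {})" for n
  have disj: "disjoint_family X"
    unfolding disjoint_family_on_def X_def using C(3) fN unfolding pairwise_def disjnt_def
    by (metis (full_types) Int_empty_left Int_empty_right)
  define \<nu> where "\<nu> = density lborel (\<lambda>t. ennreal (u t))"
  have um: "(\<lambda>t. ennreal (u t)) \<in> borel_measurable lborel"
    using borel_measurable_continuous_onI[OF cu] by auto
  have \<nu>: "emeasure \<nu> {a..b} = ennreal (integral {a..b} u)" for a b
  proof -
    have "emeasure \<nu> {a..b} = (\<integral>\<^sup>+ t. ennreal (u t) * indicator {a..b} t \<partial>lborel)"
      unfolding \<nu>_def by (subst emeasure_density[OF um]) auto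
    then show ?thesis
      using nn_integral_has_integral_lebesgue'[of "{a..b}" u, OF _ integrable_integral[OF iu]] by (simp add: u_def)
  qed
  have YX: "emeasure lborel (Y n) \<le> ennreal (5 / \<kappa>) * emeasure \<nu> (X n)" for n
  proof (cases "n \<in> N")
    case True
    let ?s = "s (f n)"
    have fE: "f n \<in> E" using fN(1)[OF True] C(2) by auto
    have sp: "?s > 0" using s[OF fE] by simp
    have "emeasure lborel (Y n) = ennreal (10 * ?s)"
      using True sp by (simp add: Y_def cball_eq_atLeastAtMost)
    also have "\<dots> \<le> ennreal (5 / \<kappa> * integral {f n - ?s..f n + ?s} u)"
      using big[OF fE] l by (intro ennreal_leI) (simp add: field_simps)
    also have "\<dots> = ennreal (5 / \<kappa>) * emeasure \<nu> (X n)"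
      using True l unfolding X_def
      by (subst ennreal_mult) (auto simp: cball_eq_atLeastAtMost \<nu> integral_nonneg[OF iu] u_def)
    finally show ?thesis .
  qed (simp add: Y_def)
  have "emeasure lborel E \<le> emeasure lborel (\<Union>n. Y n)"
  proof (rule emeasure_mono)
    show "E \<subseteq> (\<Union>n. Y n)" using C(4) fC unfolding Y_def by fastforce
  qed (auto simp: Y_def)
  also have "\<dots> \<le> (\<Sum>n. emeasure lborel (Y n))"
    by (rule emeasure_subadditive_countably) (auto simp: Y_def)
  also have "\<dots> \<le> (\<Sum>n. ennreal (5 / \<kappa>) * emeasure \<nu> (X n))"
    by (intro suminf_le YX summableI)
  also have "\<dots> = ennreal (5 / \<kappa>) * (\<Sum>n. emeasure \<nu> (X n))" by (rule ennreal_suminf_cmult)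
  also have "(\<Sum>n. emeasure \<nu> (X n)) = emeasure \<nu> (\<Union>n. X n)"
    by (rule suminf_emeasure[OF _ disj]) (auto simp: X_def \<nu>_def)
  also have "\<dots> \<le> emeasure \<nu> {-2*pi..4*pi}"
  proof (rule emeasure_mono)
    show "(\<Union>n. X n) \<subseteq> {-2*pi..4*pi}"
    proof
      fix t assume "t \<in> (\<Union>n. X n)"
      then obtain n where n: "n \<in> N" "t \<in> cball (f n) (s (f n))" by (auto simp: X_def split: if_splits)
      then have "f n \<in> E" using fN C(2) by auto
      with n s[of "f n"] show "t \<in> {-2*pi..4*pi}"
        using pi_gt_zero unfolding cball_eq_atLeastAtMost E_def by auto
    qed
  qed (auto simp: \<nu>_def)
  also have "\<dots> = ennreal (3 * integral {0..2*pi} u)"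
    unfolding \<nu> by (subst integral_three_periods[OF cu]) (auto simp: u_def simp flip: cis_mult)
  finally have "emeasure lborel E \<le> ennreal (5 / \<kappa>) * ennreal (3 * integral {0..2*pi} u)"
    by (auto simp: mult_left_mono)
  then have "emeasure circle_measure A \<le> ennreal (1 / (2 * pi)) * (ennreal (5 / \<kappa>) * ennreal (3 * integral {0..2*pi} u))"
    unfolding emeasure_circle_measure[OF A_borel] E_def by (rule mult_left_mono) simp
  also have "\<dots> = ennreal (15 / \<kappa> * (integral {0..2*pi} u / (2 * pi)))"
    using l by (simp add: ennreal_mult[symmetric] integral_nonneg[OF iu] u_def)
  finally show ?thesis by (simp only: A_def u_def[abs_def])
qed

section \<open>Radial limits of functions in Hardy spaces\<close>

lemma holomorphic_dilate:
  fixes F :: "complex \<Rightarrow> complex"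
  assumes hol: "F holomorphic_on ball 0 1" and r: "0 \<le> r" "r < 1"
  shows "continuous_on (cball 0 1) (\<lambda>z. F (complex_of_real r * z))"
    and "(\<lambda>z. F (complex_of_real r * z)) holomorphic_on ball 0 1"
proof -
  have less: "norm (complex_of_real r * z) < 1" if "norm z \<le> 1" for z
  proof -
    have "r * norm z \<le> r * 1" using that r by (intro mult_left_mono) auto
    then show ?thesis using r by (simp add: norm_mult)
  qed
  show "continuous_on (cball 0 1) (\<lambda>z. F (complex_of_real r * z))"
    by (rule continuous_on_compose2[OF holomorphic_on_imp_continuous_on[OF hol]])
      (use less in \<open>auto intro!: continuous_intros\<close>)
  show "(\<lambda>z. F (complex_of_real r * z)) holomorphic_on ball 0 1"
    by (rule holomorphic_on_compose_gen[OF _ hol, unfolded o_def])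
      (use less in \<open>auto intro!: holomorphic_intros\<close>)
qed

text \<open>The estimate on the closed disc is applied to the dilations by \<rho> n = n / (n + 1).
  Their exceptional sets increase to the one of F, and the bound is the same for all n by the
  hypothesis on the means.\<close>

lemma radial_weak_type:
  fixes F :: "complex \<Rightarrow> complex"
  assumes hol: "F holomorphic_on ball 0 1" and k: "\<kappa> > 0"
    and M: "\<And>s. 0 \<le> s \<Longrightarrow> s < 1 \<Longrightarrow> integral {0..2*pi} (\<lambda>t. norm (F (complex_of_real s * cis t))) \<le> 2 * pi * M"
  shows "emeasure circle_measure {\<xi> \<in> sphere 0 1. \<exists>r\<in>{0..<1}. norm (F (complex_of_real r * \<xi>)) > \<kappa>} \<le> ennreal (15 * M / \<kappa>)"
proof -
  define \<rho> where "\<rho> n = real n / (real n + 1)" for n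
  have \<rho>: "0 \<le> \<rho> n" "\<rho> n < 1" for n by (auto simp: \<rho>_def)
  have \<rho>_mono: "\<rho> n \<le> \<rho> (Suc n)" for n by (simp add: \<rho>_def field_simps)
  have \<rho>_pos: "\<rho> (Suc n) > 0" for n by (simp add: \<rho>_def)
  have \<rho>_lim: "\<rho> \<longlonglongrightarrow> 1" unfolding \<rho>_def by real_asymp
  define H where "H n z = F (complex_of_real (\<rho> n) * z)" for n z
  have cH: "continuous_on (cball 0 1) (H n)" and hH: "H n holomorphic_on ball 0 1" for n
    unfolding H_def using holomorphic_dilate[OF hol \<rho>] by auto
  define A where "A n = {\<xi> \<in> sphere 0 1. \<exists>r\<in>{0..<1}. norm (H n (complex_of_real r * \<xi>)) > \<kappa>}" for n
  have A_meas: "A n \<in> sets circle_measure" for n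
    unfolding A_def by (simp only: sets_circle_measure)
      (intro borel_radial_exceedance holomorphic_on_imp_continuous_on hH)
  have "incseq A"
  proof (rule incseq_SucI, rule subsetI)
    fix n \<xi> assume "\<xi> \<in> A n"
    then obtain r where \<xi>: "\<xi> \<in> sphere 0 1" and r: "r \<in> {0..<1}" "norm (H n (complex_of_real r * \<xi>)) > \<kappa>"
      by (auto simp: A_def)
    \<comment> \<open>The radius with \<rho> (n + 1) r' = \<rho> n r: both dilations then look at
      the same point of the disc.\<close>
    define r' where "r' = r * (\<rho> n / \<rho> (Suc n))"
    have "\<rho> n / \<rho> (Suc n) \<le> 1" using \<rho>_mono[of n] \<rho>_pos[of n] by (simp add: divide_le_eq_1)
    then have "r' \<le> r * 1" unfolding r'_def using r by (intro mult_left_mono) auto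
    moreover have "r' \<ge> 0" using r \<rho>[of n] \<rho>[of "Suc n"] by (simp add: r'_def)
    moreover have "\<rho> (Suc n) * r' = \<rho> n * r" using \<rho>_pos[of n] by (simp add: r'_def)
    then have "H (Suc n) (complex_of_real r' * \<xi>) = H n (complex_of_real r * \<xi>)"
      unfolding H_def mult.assoc[symmetric] of_real_mult[symmetric] by simp
    ultimately show "\<xi> \<in> A (Suc n)" using r \<xi> unfolding A_def by (auto intro!: bexI[of _ r'])
  qed
  have "{\<xi> \<in> sphere 0 1. \<exists>r\<in>{0..<1}. norm (F (complex_of_real r * \<xi>)) > \<kappa>} = (\<Union>n. A n)"
  proof (intro equalityI subsetI)
    fix \<xi> assume "\<xi> \<in> {\<xi> \<in> sphere 0 1. \<exists>r\<in>{0..<1}. norm (F (complex_of_real r * \<xi>)) > \<kappa>}"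
    then obtain r where \<xi>: "\<xi> \<in> sphere 0 1" and r: "r \<in> {0..<1}" "norm (F (complex_of_real r * \<xi>)) > \<kappa>"
      by auto
    have "eventually (\<lambda>n. \<rho> n > r) sequentially" using order_tendstoD(1)[OF \<rho>_lim] r by auto
    then obtain n where n: "\<rho> n > r" by (auto simp: eventually_sequentially)
    then have "\<rho> n > 0" using r by auto
    then have "complex_of_real (\<rho> n) * (complex_of_real (r / \<rho> n) * \<xi>) = complex_of_real r * \<xi>"
      by simp
    moreover have "r / \<rho> n \<in> {0..<1}" using r n \<open>\<rho> n > 0\<close> by auto
    ultimately show "\<xi> \<in> (\<Union>n. A n)" using r \<xi> unfolding A_def H_def by (auto intro!: bexI[of _ "r / \<rho> n"] exI[of _ n])
  next
    fix \<xi> assume "\<xi> \<in> (\<Union>n. A n)"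
    then obtain n r where \<xi>: "\<xi> \<in> sphere 0 1" and r: "r \<in> {0..<1}" "norm (H n (complex_of_real r * \<xi>)) > \<kappa>"
      by (auto simp: A_def)
    have "\<rho> n * r \<le> \<rho> n * 1" using r \<rho>[of n] by (intro mult_left_mono) auto
    then have "\<rho> n * r \<in> {0..<1}" using r \<rho>[of n] by auto
    then show "\<xi> \<in> {\<xi> \<in> sphere 0 1. \<exists>r\<in>{0..<1}. norm (F (complex_of_real r * \<xi>)) > \<kappa>}"
      using r \<xi> by (auto simp: H_def mult.assoc intro!: bexI[of _ "\<rho> n * r"])
  qed
  moreover have "emeasure circle_measure (\<Union>n. A n) = (SUP n. emeasure circle_measure (A n))"
    by (rule SUP_emeasure_incseq[symmetric]) (use A_meas \<open>incseq A\<close> in auto)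
  moreover have "emeasure circle_measure (A n) \<le> ennreal (15 * M / \<kappa>)" for n
  proof -
    have "integral {0..2*pi} (\<lambda>t. norm (H n (cis t))) / (2 * pi) \<le> M"
      using M[OF \<rho>(1,2), of n] unfolding H_def by (simp add: divide_le_eq mult_ac)
    then have "15 / \<kappa> * (integral {0..2*pi} (\<lambda>t. norm (H n (cis t))) / (2 * pi)) \<le> 15 / \<kappa> * M"
      using k by (intro mult_left_mono) auto
    then show ?thesis
      using radial_weak_type_closed_disc[OF cH hH k, of n] unfolding A_def
      by (elim order_trans) (auto intro: ennreal_leI)
  qed
  ultimately show ?thesis by (simp add: SUP_le_iff)
qed

section \<open>Parseval's identity and radial limits in H^2\<close>

lemma has_integral_norm_sq_poly:
  "((\<lambda>t. (norm (\<Sum>n<N. a n * cis t ^ n))\<^sup>2) has_integral (2 * pi * (\<Sum>n<N. (norm (a n))\<^sup>2))) {0..2*pi}"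
proof (induction N)
  case (Suc N)
  define P where "P t = (\<Sum>n<N. a n * cis t ^ n)" for t
  \<comment> \<open>On the circle q is z^N times the conjugate of P, which carries the cross term of
    the new square. All its exponents N - n are positive, so its mean q 0 vanishes.\<close>
  define q where "q z = (\<Sum>n<N. cnj (a n) * z ^ (N - n))" for z
  have "((\<lambda>t. q (cis t)) has_integral (2 * pi * q 0)) {0..2*pi}"
    by (rule mean_value_has_integral) (auto simp: q_def[abs_def] intro!: continuous_intros holomorphic_intros)
  moreover have "q 0 = 0" by (auto simp: q_def intro!: sum.neutral)
  ultimately have "((\<lambda>t. 2 * Re (a N * q (cis t))) has_integral 2 * Re (a N * 0)) {0..2*pi}"
    by (intro has_integral_mult_right has_integral_Re) auto
  from has_integral_add[OF has_integral_add[OF Suc this] has_integral_const_real[of "(norm (a N))\<^sup>2" 0 "2*pi"]]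
  have "((\<lambda>t. (norm (P t))\<^sup>2 + 2 * Re (a N * q (cis t)) + (norm (a N))\<^sup>2) has_integral
    2 * pi * (\<Sum>n<Suc N. (norm (a n))\<^sup>2)) {0..2*pi}"
    by (simp add: P_def algebra_simps)
  moreover have "(norm (P t))\<^sup>2 + 2 * Re (a N * q (cis t)) + (norm (a N))\<^sup>2 = (norm (P t + a N * cis t ^ N))\<^sup>2" for t
  proof -
    have "cis t ^ (N - n) = cis t ^ N * cnj (cis t ^ n)" if "n < N" for n
    proof -
      have "cis t ^ n * cnj (cis t ^ n) = 1" by (simp add: power_mult_distrib[symmetric] cis_cnj cis_mult)
      moreover have "cis t ^ N = cis t ^ (N - n) * cis t ^ n" using that by (simp flip: power_add)
      ultimately show ?thesis by (simp add: mult.assoc)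
    qed
    then have "q (cis t) = cis t ^ N * cnj (P t)"
      by (simp add: q_def P_def sum_distrib_left mult_ac)
    moreover have "(norm (x + y))\<^sup>2 = (norm x)\<^sup>2 + 2 * Re (y * cnj x) + (norm y)\<^sup>2" for x y :: complex
      unfolding cmod_power2 by (simp add: power2_eq_square algebra_simps)
    ultimately show ?thesis by (simp add: norm_mult norm_power algebra_simps)
  qed
  ultimately show ?case by (simp add: P_def)
qed simp

text \<open>Partial sums converge uniformly on a circle of radius s < 1, and so do their squared
  moduli. The limit form suits the comparisons of nonnegative partial sums made later.\<close>

lemma parseval_limit:
  fixes F :: "complex \<Rightarrow> complex"
  assumes F: "\<And>z. norm z < 1 \<Longrightarrow> (\<lambda>n. a n * z ^ n) sums F z" and s: "0 \<le> s" "s < 1"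
  shows "(\<lambda>N. 2 * pi * (\<Sum>n<N. (norm (a n) * s ^ n)\<^sup>2)) \<longlonglongrightarrow> integral {0..2*pi} (\<lambda>t. (norm (F (complex_of_real s * cis t)))\<^sup>2)"
proof -
  define P where "P N t = (\<Sum>n<N. (a n * complex_of_real s ^ n) * cis t ^ n)" for N t
  have sumF: "(\<lambda>n. (a n * complex_of_real s ^ n) * cis t ^ n) sums F (complex_of_real s * cis t)" for t
    using F[of "complex_of_real s * cis t"] s by (simp add: norm_mult power_mult_distrib mult_ac)
  obtain x where x: "s < x" "x < 1" using s dense by blast
  have "summable (\<lambda>n. a n * complex_of_real x ^ n)" using F[of "complex_of_real x"] x s by (auto simp: sums_iff)
  from powser_insidea[OF this, of "complex_of_real s"]
  have sm: "summable (\<lambda>n. norm (a n * complex_of_real s ^ n))" using x s by simp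
  have u0: "uniform_limit {0..2*pi} P (\<lambda>t. F (complex_of_real s * cis t)) sequentially"
  proof -
    have "uniform_limit {0..2*pi} (\<lambda>N t. \<Sum>n<N. (a n * complex_of_real s ^ n) * cis t ^ n) (\<lambda>t. suminf (\<lambda>n. (a n * complex_of_real s ^ n) * cis t ^ n)) sequentially"
      by (rule Weierstrass_m_test[OF _ sm]) (simp add: norm_mult norm_power)
    then show ?thesis unfolding P_def sums_unique[OF sumF, symmetric] .
  qed
  have cP: "continuous_on S (P N)" for S N unfolding P_def by (intro continuous_intros)
  have cF: "continuous_on {0..2*pi} (\<lambda>t. F (complex_of_real s * cis t))"
    by (rule uniform_limit_theorem[OF always_eventually u0]) (auto simp: cP)
  have b: "bounded ((\<lambda>t. norm (F (complex_of_real s * cis t))) ` {0..2*pi})"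
    by (intro compact_imp_bounded compact_continuous_image continuous_intros cF) auto
  have u1: "uniform_limit {0..2*pi} (\<lambda>N t. norm (P N t)) (\<lambda>t. norm (F (complex_of_real s * cis t))) sequentially"
    by (intro uniform_limit_intros u0)
  have u2: "uniform_limit {0..2*pi} (\<lambda>N t. (norm (P N t))\<^sup>2) (\<lambda>t. (norm (F (complex_of_real s * cis t)))\<^sup>2) sequentially"
    unfolding power2_eq_square by (rule uniform_lim_mult[OF u1 u1 b b])
  obtain I J where I: "\<And>N. ((\<lambda>t. (norm (P N t))\<^sup>2) has_integral I N) {0..2*pi}"
    and J: "((\<lambda>t. (norm (F (complex_of_real s * cis t)))\<^sup>2) has_integral J) {0..2*pi}" and IJ: "I \<longlonglongrightarrow> J"
    by (rule uniform_limit_integral[OF u2]) (auto intro!: continuous_intros cP)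
  have "I N = 2 * pi * (\<Sum>n<N. (norm (a n) * s ^ n)\<^sup>2)" for N
    using has_integral_unique[OF I[of N] has_integral_norm_sq_poly[of "\<lambda>n. a n * complex_of_real s ^ n" N, folded P_def]] s
    by (simp add: norm_mult norm_power)
  then have "I = (\<lambda>N. 2 * pi * (\<Sum>n<N. (norm (a n) * s ^ n)\<^sup>2))" by blast
  with IJ integral_unique[OF J] show ?thesis by simp
qed

text \<open>The values \<open>g k 1\<close> form a Cauchy sequence, and uniform convergence lets the
  two limits be exchanged. It is used with Taylor polynomials along a radius, and with functions
  frozen near the end of a radius.\<close>

lemma tendsto_at_left_of_uniform_approx:
  fixes f :: "real \<Rightarrow> complex"
  assumes "\<And>k::nat. \<exists>g. isCont g 1 \<and> (\<forall>r\<in>{0..<1}. norm (f r - g r) \<le> 1 / (real k + 1))"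
  shows "\<exists>L. (f \<longlongrightarrow> L) (at_left 1)"
proof -
  obtain g where g: "\<And>k::nat. isCont (g k) 1" and fg: "\<And>k r. r \<in> {0..<1} \<Longrightarrow> norm (f r - g k r) \<le> 1 / (real k + 1)"
    using assms by metis
  have ev: "eventually (\<lambda>r. r \<in> {0..<1}) (at_left (1::real))"
    by (rule eventually_at_leftI[of 0]) auto
  have gl: "(g k \<longlongrightarrow> g k 1) (at_left 1)" for k
    using g[of k] by (auto simp: isCont_def filterlim_at_split)
  have d: "norm (g k 1 - g j 1) \<le> 1 / (real k + 1) + 1 / (real j + 1)" for j k :: nat
  proof (rule tendsto_upperbound)
    show "((\<lambda>r. norm (g k r - g j r)) \<longlongrightarrow> norm (g k 1 - g j 1)) (at_left 1)"
      by (intro tendsto_intros gl)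
    show "\<forall>\<^sub>F r in at_left 1. norm (g k r - g j r) \<le> 1 / (real k + 1) + 1 / (real j + 1)"
      using ev
    proof eventually_elim
      case (elim r)
      have "norm (g k r - g j r) \<le> norm (f r - g k r) + norm (f r - g j r)"
        using norm_triangle_ineq4[of "f r - g j r" "f r - g k r"] by (simp add: add.commute)
      then show ?case using fg[OF elim, of k] fg[OF elim, of j] by linarith
    qed
  qed auto
  have "Cauchy (\<lambda>k. g k 1)"
  proof (rule metric_CauchyI)
    fix e :: real assume "e > 0"
    then obtain K where K: "1 / (real K + 1) < e / 2"
      by (metis half_gt_zero_iff nat_approx_posE of_nat_Suc add.commute)
    have "dist (g m 1) (g n 1) < e" if "m \<ge> K" "n \<ge> K" for m n
    proof -
      have "1 / (real m + 1) \<le> 1 / (real K + 1)" "1 / (real n + 1) \<le> 1 / (real K + 1)"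
        using that by (auto intro!: divide_left_mono)
      then show ?thesis using d[of m n] K unfolding dist_norm by linarith
    qed
    then show "\<exists>M. \<forall>m\<ge>M. \<forall>n\<ge>M. dist (g m 1) (g n 1) < e" by blast
  qed
  then obtain c where c: "(\<lambda>k. g k 1) \<longlonglongrightarrow> c" using Cauchy_convergent convergent_def by blast
  have "uniform_limit {0..<1} g f sequentially"
  proof (rule uniform_limitI)
    fix e :: real assume "e > 0"
    have "(\<lambda>k. 1 / (real k + 1)) \<longlonglongrightarrow> 0" by real_asymp
    from order_tendstoD(2)[OF this \<open>e > 0\<close>]
    show "\<forall>\<^sub>F k in sequentially. \<forall>r\<in>{0..<1}. dist (g k r) (f r) < e"
    proof eventually_elim
      case (elim k)
      show ?case
      proof
        fix r :: real assume "r \<in> {0..<1}"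
        from fg[OF this, of k] elim show "dist (g k r) (f r) < e"
          by (simp add: dist_norm norm_minus_commute)
      qed
    qed
  qed
  from swap_uniform_limit'[OF _ c this ev] gl show ?thesis by auto
qed

text \<open>For fixed k, the set where the N-th Taylor remainder exceeds 1 / (k + 1) somewhere on
  the radius has measure at most a multiple of the coefficient tail \<open>T N\<close>. Almost every
  point therefore escapes for some N, which gives uniform polynomial approximation along its
  radius.\<close>

theorem H2_radial_limit:
  fixes F :: "complex \<Rightarrow> complex"
  assumes hol: "F holomorphic_on ball 0 1"
    and M: "\<And>s. 0 \<le> s \<Longrightarrow> s < 1 \<Longrightarrow> integral {0..2*pi} (\<lambda>t. (norm (F (complex_of_real s * cis t)))\<^sup>2) \<le> 2 * pi * M"
  shows "AE \<xi> in circle_measure. \<exists>L. has_radial_lim F \<xi> L"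
proof -
  define a where "a n = (deriv ^^ n) F 0 / fact n" for n
  have F: "(\<lambda>n. a n * z ^ n) sums F z" if "norm z < 1" for z
    using holomorphic_power_series[OF hol, of z] that by (simp add: a_def)
  define b where "b n = (norm (a n))\<^sup>2" for n
  have b_le: "(\<Sum>n<N. b n) \<le> M" for N
  proof (rule tendsto_upperbound)
    show "((\<lambda>s. (\<Sum>n<N. (norm (a n) * s ^ n)\<^sup>2)) \<longlongrightarrow> (\<Sum>n<N. b n)) (at_left (1::real))"
      unfolding b_def by (auto intro!: tendsto_eq_intros)
    have "(\<Sum>n<N. (norm (a n) * s ^ n)\<^sup>2) \<le> M" if s: "0 < s" "s < 1" for s
    proof -
      have "2 * pi * (\<Sum>n<N. (norm (a n) * s ^ n)\<^sup>2) \<le> integral {0..2*pi} (\<lambda>t. (norm (F (complex_of_real s * cis t)))\<^sup>2)"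
        by (rule incseq_le[OF _ parseval_limit[OF F]])
          (use s in \<open>auto intro!: incseq_SucI\<close>)
      also have "\<dots> \<le> 2 * pi * M" using M s by simp
      finally show ?thesis by simp
    qed
    then show "\<forall>\<^sub>F s in at_left (1::real). (\<Sum>n<N. (norm (a n) * s ^ n)\<^sup>2) \<le> M"
      by (intro eventually_at_leftI[of 0]) auto
  qed auto
  have sb: "summable b" by (rule summableI_nonneg_bounded[of _ M]) (use b_le in \<open>auto simp: b_def\<close>)
  define T where "T N = suminf b - (\<Sum>n<N. b n)" for N
  have T_lim: "T \<longlonglongrightarrow> 0"
    using tendsto_diff[OF tendsto_const summable_LIMSEQ[OF sb], of "suminf b"] unfolding T_def by simp
  define p where "p N z = (\<Sum>n<N. a n * z ^ n)" for N z
  define D where "D N z = F z - p N z" for N z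
  have D: "(\<lambda>n. (if n < N then 0 else a n) * z ^ n) sums D N z" if "norm z < 1" for N z
  proof -
    have "(\<lambda>n. a n * z ^ n - (if n \<in> {..<N} then a n * z ^ n else 0)) sums D N z"
      unfolding D_def p_def by (intro sums_diff F that sums_If_finite_set) auto
    moreover have "a n * z ^ n - (if n \<in> {..<N} then a n * z ^ n else 0) = (if n < N then 0 else a n) * z ^ n" for n
      by simp
    ultimately show ?thesis by simp
  qed
  have tail: "(\<lambda>n. if n < N then 0 else b n) sums T N" for N
  proof -
    have "(\<lambda>n. b n - (if n \<in> {..<N} then b n else 0)) sums T N"
      unfolding T_def by (intro sums_diff summable_sums sb sums_If_finite_set) auto
    moreover have "b n - (if n \<in> {..<N} then b n else 0) = (if n < N then 0 else b n)" for n by simp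
    ultimately show ?thesis by simp
  qed
  have D_int: "integral {0..2*pi} (\<lambda>t. (norm (D N (complex_of_real s * cis t)))\<^sup>2) \<le> 2 * pi * T N"
    if s: "0 \<le> s" "s < 1" for s N
  proof (rule LIMSEQ_le_const2[OF parseval_limit[OF D s]], safe intro!: exI[of _ 0] mult_left_mono)
    fix K
    have "(\<Sum>n<K. (norm (if n < N then 0 else a n) * s ^ n)\<^sup>2) \<le> (\<Sum>n<K. if n < N then 0 else b n)"
    proof (rule sum_mono)
      fix n
      have "(norm (a n) * s ^ n)\<^sup>2 \<le> (norm (a n) * 1)\<^sup>2"
        using s by (intro power_mono mult_left_mono power_le_one) auto
      then show "(norm (if n < N then 0 else a n) * s ^ n)\<^sup>2 \<le> (if n < N then 0 else b n)" by (simp add: b_def)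
    qed
    also have "\<dots> \<le> T N"
      using sum_le_suminf[OF sums_summable[OF tail[of N]], of "{..<K}"] sums_unique[OF tail[of N]]
      by (auto simp: b_def)
    finally show "(\<Sum>n<K. (norm (if n < N then 0 else a n) * s ^ n)\<^sup>2) \<le> T N" .
  qed auto
  have holD: "(\<lambda>z. (D N z)\<^sup>2) holomorphic_on ball 0 1" for N
    unfolding D_def p_def by (intro holomorphic_intros hol)
  \<comment> \<open>The remainder is squared because the square is analytic and its L^1 means are
    the squared L^2 means of the remainder, as the L^1 weak-type inequality needs; the threshold is
    squared as well.\<close>
  define A where "A k N = {\<xi> \<in> sphere 0 1. \<exists>r\<in>{0..<1}. norm ((D N (complex_of_real r * \<xi>))\<^sup>2) > (1 / (real k + 1))\<^sup>2}" for k N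
  have A_meas: "A k N \<in> sets circle_measure" for k N
    unfolding A_def sets_circle_measure by (rule borel_radial_exceedance[OF holomorphic_on_imp_continuous_on[OF holD]])
  have A_le: "emeasure circle_measure (A k N) \<le> ennreal (15 * T N / (1 / (real k + 1))\<^sup>2)" for k N
    unfolding A_def by (rule radial_weak_type[OF holD]) (use D_int in \<open>auto simp: norm_power\<close>)
  \<comment> \<open>The sets need not be nested in N: their intersection lies in each of them, and
    their measures tend to 0.\<close>
  have "AE \<xi> in circle_measure. \<exists>N. \<xi> \<notin> A k N" for k
  proof (rule AE_I[where N = "\<Inter>N. A k N"])
    have "emeasure circle_measure (\<Inter>N. A k N) \<le> ennreal (15 * T N / (1 / (real k + 1))\<^sup>2)" for N
      by (rule order_trans[OF emeasure_mono A_le]) (use A_meas in auto)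
    moreover have "(\<lambda>N. ennreal (15 * T N / (1 / (real k + 1))\<^sup>2)) \<longlonglongrightarrow> ennreal (15 * 0 / (1 / (real k + 1))\<^sup>2)"
      by (intro tendsto_intros tendsto_ennrealI T_lim) auto
    ultimately have "emeasure circle_measure (\<Inter>N. A k N) \<le> ennreal (15 * 0 / (1 / (real k + 1))\<^sup>2)"
      by (intro LIMSEQ_le_const) auto
    then show "emeasure circle_measure (\<Inter>N. A k N) = 0" by simp
  qed (use A_meas in auto)
  then have "AE \<xi> in circle_measure. \<forall>k. \<exists>N. \<xi> \<notin> A k N" by (simp add: AE_all_countable)
  then show ?thesis using AE_circle_measure_sphere
  proof eventually_elim
    case (elim \<xi>)
    show ?case unfolding has_radial_lim_def
    proof (rule tendsto_at_left_of_uniform_approx)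
      fix k :: nat
      obtain N where N: "\<xi> \<notin> A k N" using elim by blast
      have "norm (F (complex_of_real r * \<xi>) - p N (complex_of_real r * \<xi>)) \<le> 1 / (real k + 1)" if "r \<in> {0..<1}" for r
      proof (rule power2_le_imp_le)
        show "(norm (F (complex_of_real r * \<xi>) - p N (complex_of_real r * \<xi>)))\<^sup>2 \<le> (1 / (real k + 1))\<^sup>2"
          using N elim that unfolding A_def D_def norm_power by (auto simp: not_less)
      qed auto
      moreover have "isCont (\<lambda>r. p N (complex_of_real r * \<xi>)) 1" unfolding p_def by (intro continuous_intros)
      ultimately show "\<exists>g. isCont g 1 \<and> (\<forall>r\<in>{0..<1}. norm (F (complex_of_real r * \<xi>) - g r) \<le> 1 / (real k + 1))"
        by blast
    qed
  qed
qed

section \<open>Analytic majorants on the open disc and radial limits in H^q\<close>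

lemma circle_integral_norm_sq_mono:
  fixes F :: "complex \<Rightarrow> complex"
  assumes hol: "F holomorphic_on ball 0 1" and s: "0 \<le> s" "s \<le> s'" "s' < 1"
  shows "integral {0..2*pi} (\<lambda>t. (norm (F (complex_of_real s * cis t)))\<^sup>2) \<le> integral {0..2*pi} (\<lambda>t. (norm (F (complex_of_real s' * cis t)))\<^sup>2)"
proof -
  define a where "a n = (deriv ^^ n) F 0 / fact n" for n
  have F: "(\<lambda>n. a n * z ^ n) sums F z" if "norm z < 1" for z
    using holomorphic_power_series[OF hol, of z] that by (simp add: a_def)
  show ?thesis
    by (rule LIMSEQ_le[OF parseval_limit[OF F] parseval_limit[OF F]])
      (use s in \<open>auto intro!: exI[of _ 0] mult_left_mono sum_mono power_mono\<close>)
qed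

lemma circle_integral_norm_sq_le_boundary:
  fixes F :: "complex \<Rightarrow> complex"
  assumes hol: "F holomorphic_on UNIV" and s: "0 \<le> s" "s < 1"
  shows "integral {0..2*pi} (\<lambda>t. (norm (F (complex_of_real s * cis t)))\<^sup>2) \<le> integral {0..2*pi} (\<lambda>t. (norm (F (cis t)))\<^sup>2)"
proof -
  \<comment> \<open>F is entire; after this dilation the unit circle becomes the circle of radius
    1/2, inside the disc, where monotonicity in the radius is available.\<close>
  have "(\<lambda>z. F (2 * z)) holomorphic_on ball 0 1"
    by (rule holomorphic_on_compose_gen[OF _ hol, unfolded o_def]) (auto intro!: holomorphic_intros)
  from circle_integral_norm_sq_mono[OF this, of "s / 2" "1 / 2"] s show ?thesis by simp
qed

lemma compact_subset_unit_ball: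
  fixes K :: "complex set"
  assumes "compact K" "K \<subseteq> ball 0 1"
  obtains \<rho> where "\<rho> < 1" "\<And>z. z \<in> K \<Longrightarrow> norm z \<le> \<rho>"
proof (cases "K = {}")
  case True
  then show ?thesis using that[of 0] by auto
next
  case False
  obtain z0 where "z0 \<in> K" "\<And>z. z \<in> K \<Longrightarrow> norm z \<le> norm z0"
    using continuous_attains_sup[OF assms(1) False, of norm] by (auto intro: continuous_intros)
  with that[of "norm z0"] assms(2) show ?thesis by auto
qed

text \<open>Majorants of the dilations of h have a common L^2 bound on the unit circle, hence are
  uniformly bounded on compact subsets by \<open>norm_sq_le_circle_integral\<close>. A locally
  uniform limit inherits the inequality with h, the lower bound on the real part and the L^2 bound
  on inner circles.\<close>

lemma Hardy_factor:
  fixes h :: "complex \<Rightarrow> complex"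
  assumes hol: "h holomorphic_on ball 0 1" and q: "q > 0"
    and M: "\<And>r. 0 \<le> r \<Longrightarrow> r < 1 \<Longrightarrow> integral {0..2*pi} (\<lambda>t. norm (h (complex_of_real r * cis t)) powr q) \<le> M"
  obtains g K where "g holomorphic_on ball 0 1" "\<And>z. norm z < 1 \<Longrightarrow> Re (g z) \<ge> 1"
    "\<And>z. norm z < 1 \<Longrightarrow> norm (h z) \<le> norm (g z) powr (2 / q)"
    "\<And>s. 0 \<le> s \<Longrightarrow> s < 1 \<Longrightarrow> integral {0..2*pi} (\<lambda>t. (norm (g (complex_of_real s * cis t)))\<^sup>2) \<le> 2 * pi * K"
proof -
  define \<rho> where "\<rho> n = real n / (real n + 1)" for n
  have \<rho>: "0 \<le> \<rho> n" "\<rho> n < 1" for n by (auto simp: \<rho>_def)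
  have \<rho>_lim: "\<rho> \<longlonglongrightarrow> 1" unfolding \<rho>_def by real_asymp
  \<comment> \<open>The majorant is taken with error d = 1, which gives 2 M + 1; passing to G = F +
    1 uses |F + 1|^2 <= 2 |F|^2 + 2, and the constant 2 integrates to 4 pi.\<close>
  define K where "K = 2 * (2 * M + 1) + 4 * pi"
  have "\<exists>G. G holomorphic_on UNIV \<and> (\<forall>z. norm z \<le> 1 \<longrightarrow> Re (G z) \<ge> 1) \<and>
    (\<forall>z. norm z \<le> 1 \<longrightarrow> norm (h (complex_of_real (\<rho> n) * z)) \<le> norm (G z) powr (2 / q)) \<and>
    integral {0..2*pi} (\<lambda>t. (norm (G (cis t)))\<^sup>2) \<le> K" for n
  proof -
    obtain F where F: "F holomorphic_on UNIV" "\<And>z. norm z \<le> 1 \<Longrightarrow> Re (F z) > 0"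
      "\<And>z. norm z \<le> 1 \<Longrightarrow> norm (h (complex_of_real (\<rho> n) * z)) \<le> norm (F z) powr (2 / q)"
      "integral {0..2*pi} (\<lambda>t. (norm (F (cis t)))\<^sup>2) \<le> 2 * integral {0..2*pi} (\<lambda>t. norm (h (complex_of_real (\<rho> n) * cis t)) powr q) + 1"
      using Hardy_majorant[OF holomorphic_dilate[OF hol \<rho>] q, of 1] by (metis zero_less_one)
    \<comment> \<open>Strict positivity of Re F could degenerate to Re >= 0 in the limit. Adding 1
      keeps the limit in Re >= 1, off the branch cut, and does not decrease the modulus since Re F >
      0.\<close>
    define G where "G z = F z + 1" for z
    have cF: "continuous_on {0..2*pi} (\<lambda>t. F (cis t))"
      by (rule continuous_on_compose2[OF holomorphic_on_imp_continuous_on[OF F(1)]]) (auto intro!: continuous_intros)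
    have "norm (F z) \<le> norm (G z)" if "norm z \<le> 1" for z
      unfolding G_def cmod_def using F(2)[OF that] by (intro real_sqrt_le_mono add_mono) (auto intro!: power_mono)
    then have "norm (h (complex_of_real (\<rho> n) * z)) \<le> norm (G z) powr (2 / q)" if "norm z \<le> 1" for z
      using F(3)[OF that] that q by (elim order_trans) (auto intro: powr_mono2)
    moreover have "integral {0..2*pi} (\<lambda>t. (norm (G (cis t)))\<^sup>2) \<le> K"
    proof -
      have "integral {0..2*pi} (\<lambda>t. (norm (G (cis t)))\<^sup>2) \<le> integral {0..2*pi} (\<lambda>t. 2 * (norm (F (cis t)))\<^sup>2 + 2)"
      proof (rule integral_le)
        show "(\<lambda>t. (norm (G (cis t)))\<^sup>2) integrable_on {0..2*pi}" unfolding G_def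
          by (intro integrable_continuous_interval continuous_intros cF)
        show "(\<lambda>t. 2 * (norm (F (cis t)))\<^sup>2 + 2) integrable_on {0..2*pi}"
          by (intro integrable_continuous_interval continuous_intros cF)
        fix t
        have "(norm (G (cis t)))\<^sup>2 \<le> (norm (F (cis t)) + 1)\<^sup>2"
          using norm_triangle_ineq[of "F (cis t)" 1] by (intro power_mono) (auto simp: G_def)
        also have "\<dots> \<le> 2 * (norm (F (cis t)))\<^sup>2 + 2"
          using sum_squares_ge_zero[of "norm (F (cis t)) - 1" 0] by (simp add: power2_eq_square algebra_simps)
        finally show "(norm (G (cis t)))\<^sup>2 \<le> 2 * (norm (F (cis t)))\<^sup>2 + 2" .
      qed
      also have "\<dots> = 2 * integral {0..2*pi} (\<lambda>t. (norm (F (cis t)))\<^sup>2) + 4 * pi"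
        by (subst Henstock_Kurzweil_Integration.integral_add)
          (auto intro!: integrable_continuous_interval continuous_intros cF)
      finally show ?thesis using F(4) M[OF \<rho>, of n] by (simp add: K_def)
    qed
    moreover have "G holomorphic_on UNIV" unfolding G_def by (intro holomorphic_intros F(1))
    moreover have "Re (G z) \<ge> 1" if "norm z \<le> 1" for z using F(2)[OF that] by (simp add: G_def)
    ultimately show ?thesis by blast
  qed
  then obtain G where G: "\<And>n. G n holomorphic_on UNIV" "\<And>n z. norm z \<le> 1 \<Longrightarrow> Re (G n z) \<ge> 1"
    "\<And>n z. norm z \<le> 1 \<Longrightarrow> norm (h (complex_of_real (\<rho> n) * z)) \<le> norm (G n z) powr (2 / q)"
    "\<And>n. integral {0..2*pi} (\<lambda>t. (norm (G n (cis t)))\<^sup>2) \<le> K"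
    by metis
  have holG: "G n holomorphic_on S" for n S using G(1) holomorphic_on_subset by blast
  have contG: "continuous_on S (G n)" for n S using holG holomorphic_on_imp_continuous_on by blast
  obtain g r where g: "g holomorphic_on ball 0 1" "strict_mono (r :: nat \<Rightarrow> nat)"
    "\<And>z. z \<in> ball 0 1 \<Longrightarrow> (\<lambda>n. G (r n) z) \<longlonglongrightarrow> g z"
    "\<And>S. compact S \<Longrightarrow> S \<subseteq> ball 0 1 \<Longrightarrow> uniform_limit S (G \<circ> r) g sequentially"
  proof (rule Montel[of "ball 0 1" "range G" G])
    fix S :: "complex set" assume S: "compact S" "S \<subseteq> ball 0 1"
    obtain \<delta> where \<delta>: "\<delta> < 1" "\<And>z. z \<in> S \<Longrightarrow> norm z \<le> \<delta>" by (rule compact_subset_unit_ball[OF S]) auto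
    have "norm (G n z) \<le> sqrt (K / (pi * (1 - \<delta>)))" if z: "z \<in> S" for n z
    proof (rule real_le_rsqrt)
      have "(norm (G n z))\<^sup>2 \<le> integral {0..2*pi} (\<lambda>t. (norm (G n (cis t)))\<^sup>2) / (pi * (1 - norm z))"
        by (rule norm_sq_le_circle_integral[OF contG holG]) (use \<delta> z in force)
      also have "\<dots> \<le> K / (pi * (1 - \<delta>))"
        using \<delta> z G(4)[of n] by (intro frac_le) (auto intro!: integral_nonneg integrable_continuous_interval continuous_intros
           continuous_on_compose2[OF contG[of UNIV]] elim: order_trans[rotated])
      finally show "(norm (G n z))\<^sup>2 \<le> K / (pi * (1 - \<delta>))" .
    qed
    then show "\<exists>B. \<forall>h\<in>range G. \<forall>z\<in>S. norm (h z) \<le> B" by blast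
  qed (use holG in auto)
  show ?thesis
  proof (rule that[OF g(1)])
    fix z :: complex assume z: "norm z < 1"
    show "Re (g z) \<ge> 1"
      by (rule tendsto_lowerbound[OF tendsto_Re[OF g(3)]]) (use z G(2) in auto)
    have lr: "(\<lambda>n. \<rho> (r n)) \<longlonglongrightarrow> 1"
      using LIMSEQ_subseq_LIMSEQ[OF \<rho>_lim g(2)] by (simp add: o_def)
    have lz: "norm (complex_of_real (\<rho> n) * z) < 1" for n
      using mult_right_mono[of "\<rho> n" 1 "norm z"] \<rho>[of n] z by (simp add: norm_mult)
    have "(\<lambda>n. complex_of_real (\<rho> (r n)) * z) \<longlonglongrightarrow> complex_of_real 1 * z"
      by (intro tendsto_mult tendsto_of_real lr tendsto_const)
    then have "(\<lambda>n. h (complex_of_real (\<rho> (r n)) * z)) \<longlonglongrightarrow> h (complex_of_real 1 * z)"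
      by (rule continuous_on_tendsto_compose[OF holomorphic_on_imp_continuous_on[OF hol]])
        (use z lz in auto)
    then have l1: "(\<lambda>n. norm (h (complex_of_real (\<rho> (r n)) * z))) \<longlonglongrightarrow> norm (h z)"
      by (intro tendsto_norm) simp
    have l2: "(\<lambda>n. norm (G (r n) z) powr (2 / q)) \<longlonglongrightarrow> norm (g z) powr (2 / q)"
      using z q by (intro tendsto_powr' tendsto_intros g(3)) auto
    show "norm (h z) \<le> norm (g z) powr (2 / q)"
      by (rule LIMSEQ_le[OF l1 l2]) (use z G(3) in auto)
  next
    fix s :: real assume s: "0 \<le> s" "s < 1"
    have u: "uniform_limit {0..2*pi} (\<lambda>n t. G (r n) (complex_of_real s * cis t)) (\<lambda>t. g (complex_of_real s * cis t)) sequentially"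
    proof (rule uniform_limitI)
      fix e :: real assume "e > 0"
      have "uniform_limit (cball 0 s) (G \<circ> r) g sequentially" by (rule g(4)) (use s in auto)
      from uniform_limitD[OF this \<open>e > 0\<close>]
      show "\<forall>\<^sub>F n in sequentially. \<forall>t\<in>{0..2*pi}. dist (G (r n) (complex_of_real s * cis t)) (g (complex_of_real s * cis t)) < e"
        by eventually_elim (use s in \<open>auto simp: norm_mult\<close>)
    qed
    have cg: "continuous_on {0..2*pi} (\<lambda>t. g (complex_of_real s * cis t))"
      by (rule continuous_on_compose2[OF holomorphic_on_imp_continuous_on[OF g(1)]])
        (use s in \<open>auto intro!: continuous_intros simp: norm_mult\<close>)
    have b: "bounded ((\<lambda>t. norm (g (complex_of_real s * cis t))) ` {0..2*pi})"
      by (intro compact_imp_bounded compact_continuous_image continuous_intros cg) auto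
    have u1: "uniform_limit {0..2*pi} (\<lambda>n t. norm (G (r n) (complex_of_real s * cis t))) (\<lambda>t. norm (g (complex_of_real s * cis t))) sequentially"
      by (intro uniform_limit_intros u)
    have u2: "uniform_limit {0..2*pi} (\<lambda>n t. (norm (G (r n) (complex_of_real s * cis t)))\<^sup>2) (\<lambda>t. (norm (g (complex_of_real s * cis t)))\<^sup>2) sequentially"
      unfolding power2_eq_square by (rule uniform_lim_mult[OF u1 u1 b b])
    obtain I J where I: "\<And>n. ((\<lambda>t. (norm (G (r n) (complex_of_real s * cis t)))\<^sup>2) has_integral I n) {0..2*pi}"
      and J: "((\<lambda>t. (norm (g (complex_of_real s * cis t)))\<^sup>2) has_integral J) {0..2*pi}" and IJ: "I \<longlonglongrightarrow> J"
      by (rule uniform_limit_integral[OF u2])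
        (auto intro!: continuous_intros continuous_on_compose2[OF contG[of UNIV]])
    have "I n \<le> K" for n
      using circle_integral_norm_sq_le_boundary[OF G(1) s, of "r n"] G(4)[of "r n"] integral_unique[OF I[of n]] by simp
    then have "J \<le> K" using IJ by (intro LIMSEQ_le_const2[OF IJ]) auto
    then show "integral {0..2*pi} (\<lambda>t. (norm (g (complex_of_real s * cis t)))\<^sup>2) \<le> 2 * pi * (K / (2 * pi))"
      using integral_unique[OF J] by simp
  qed
qed

theorem Hardy_radial_limit:
  fixes h :: "complex \<Rightarrow> complex"
  assumes hol: "h holomorphic_on ball 0 1" and q: "q > 0" and fin: "hardy_pow q h < \<infinity>"
  shows "AE \<xi> in circle_measure. \<exists>L. has_radial_lim h \<xi> L"
proof -
  have "hardy_pow q h \<le> ennreal (enn2real (hardy_pow q h))" using fin by (simp add: ennreal_enn2real_if)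
  then have "integral {0..2*pi} (\<lambda>t. norm (h (complex_of_real r * cis t)) powr q) \<le> 2 * pi * enn2real (hardy_pow q h)"
    if "0 \<le> r" "r < 1" for r
    using that hardy_pow_le_iff[OF hol q, of "enn2real (hardy_pow q h)"] by simp
  from Hardy_factor[OF hol q this]
  obtain g K where g: "g holomorphic_on ball 0 1" "\<And>z. norm z < 1 \<Longrightarrow> Re (g z) \<ge> 1"
    "\<And>z. norm z < 1 \<Longrightarrow> norm (h z) \<le> norm (g z) powr (2 / q)"
    "\<And>s. 0 \<le> s \<Longrightarrow> s < 1 \<Longrightarrow> integral {0..2*pi} (\<lambda>t. (norm (g (complex_of_real s * cis t)))\<^sup>2) \<le> 2 * pi * K"
    by metis
  have g0: "g z \<noteq> 0" "g z \<notin> \<real>\<^sub>\<le>\<^sub>0" if "norm z < 1" for z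
    using g(2)[OF that] by (auto simp: complex_nonpos_Reals_iff)
  define b where "b z = h z / g z powr of_real (2 / q)" for z
  have holb: "b holomorphic_on ball 0 1"
    unfolding b_def using g0 by (intro holomorphic_intros hol g(1)) auto
  have nb: "norm (b z) \<le> 1" if "norm z < 1" for z
    using g(3)[OF that] g0[OF that]
    by (simp add: b_def norm_divide norm_powr_of_real divide_le_eq_1 del: of_real_divide)
  have "integral {0..2*pi} (\<lambda>t. (norm (b (complex_of_real s * cis t)))\<^sup>2) \<le> 2 * pi * 1" if s: "0 \<le> s" "s < 1" for s
  proof -
    have "integral {0..2*pi} (\<lambda>t. (norm (b (complex_of_real s * cis t)))\<^sup>2) \<le> integral {0..2*pi} (\<lambda>t. 1)"
    proof (rule integral_le)
      show "(\<lambda>t. (norm (b (complex_of_real s * cis t)))\<^sup>2) integrable_on {0..2*pi}"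
        by (intro integrable_continuous_interval continuous_intros continuous_on_compose2[OF holomorphic_on_imp_continuous_on[OF holb]])
          (use s in \<open>auto simp: norm_mult\<close>)
      show "(norm (b (complex_of_real s * cis t)))\<^sup>2 \<le> 1" for t
        using nb[of "complex_of_real s * cis t"] s by (intro power_le_one) (auto simp: norm_mult)
    qed auto
    then show ?thesis by simp
  qed
  then have "AE \<xi> in circle_measure. \<exists>L. has_radial_lim b \<xi> L"
    by (rule H2_radial_limit[OF holb])
  moreover have "AE \<xi> in circle_measure. \<exists>L. has_radial_lim g \<xi> L"
    by (rule H2_radial_limit[OF g(1)]) (rule g(4))
  ultimately show ?thesis using AE_circle_measure_sphere
  proof eventually_elim
    case (elim \<xi>)
    then obtain Lg Lb where L: "has_radial_lim g \<xi> Lg" "has_radial_lim b \<xi> Lb" by blast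
    have ev: "eventually (\<lambda>r. norm (complex_of_real r * \<xi>) < 1) (at_left 1)"
      by (rule eventually_at_leftI[of 0]) (use elim in \<open>auto simp: norm_mult\<close>)
    \<comment> \<open>The boundary value of g stays off the branch cut, so the power is continuous
      there and the limits of b and g can be recombined.\<close>
    have "Re Lg \<ge> 1"
      by (rule tendsto_lowerbound[OF tendsto_Re[OF L(1)[unfolded has_radial_lim_def]]])
        (use eventually_mono[OF ev g(2)] in auto)
    then have "Lg \<notin> \<real>\<^sub>\<le>\<^sub>0" by (auto simp: complex_nonpos_Reals_iff)
    then have "((\<lambda>r. b (complex_of_real r * \<xi>) * g (complex_of_real r * \<xi>) powr of_real (2 / q)) \<longlongrightarrow> Lb * Lg powr of_real (2 / q)) (at_left 1)"
      using L unfolding has_radial_lim_def by (intro tendsto_intros) auto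
    then have "has_radial_lim h \<xi> (Lb * Lg powr of_real (2 / q))"
      unfolding has_radial_lim_def
      by (rule Lim_transform_eventually) (use eventually_mono[OF ev] g0 in \<open>auto simp: b_def elim!: eventually_mono\<close>)
    then show ?case by blast
  qed
qed

section \<open>Growth in the derivative Hardy spaces and test functions\<close>

text \<open>A convergent derivative is bounded near the end of the radius, so f is Lipschitz there
  and freezing it beyond a radius \<open>r0\<close> changes it by at most B (1 - r0).\<close>

lemma has_radial_lim_of_deriv:
  fixes f :: "complex \<Rightarrow> complex"
  assumes hol: "f holomorphic_on ball 0 1" and \<xi>: "norm \<xi> = 1" and L: "has_radial_lim (deriv f) \<xi> L"
  shows "\<exists>L'. has_radial_lim f \<xi> L'"
  unfolding has_radial_lim_def
proof (rule tendsto_at_left_of_uniform_approx)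
  fix k :: nat
  define B where "B = norm L + 1"
  have B: "B > 0" by (simp add: B_def add_nonneg_pos)
  have "eventually (\<lambda>r. norm (deriv f (complex_of_real r * \<xi>)) < B) (at_left 1)"
    by (rule order_tendstoD(2)[OF tendsto_norm[OF L[unfolded has_radial_lim_def]]]) (simp add: B_def)
  then obtain \<delta> where \<delta>: "\<delta> < 1" "\<And>r. \<delta> < r \<Longrightarrow> r < 1 \<Longrightarrow> norm (deriv f (complex_of_real r * \<xi>)) < B"
    unfolding eventually_at_left_field by blast
  \<comment> \<open>The maximum secures three things: \<open>r0\<close> is nonnegative, lies beyond
    \<delta>, where the derivative is bounded by B, and satisfies B (1 - r0) <= 1 / (k + 1).\<close>
  define r0 where "r0 = max (max 0 ((1 + \<delta>) / 2)) (1 - 1 / (B * (real k + 1)))"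
  have r0: "0 \<le> r0" "r0 < 1" "\<delta> < r0" using \<delta>(1) B by (auto simp: r0_def less_max_iff_disj)
  have "1 - r0 \<le> 1 / (B * (real k + 1))" by (simp add: r0_def)
  then have "B * (1 - r0) \<le> B * (1 / (B * (real k + 1)))" using B by (intro mult_left_mono) auto
  then have Br: "B * (1 - r0) \<le> 1 / (real k + 1)" using B by simp
  have inb: "complex_of_real r * \<xi> \<in> ball 0 1" if "0 \<le> r" "r < 1" for r
    using that \<xi> by (simp add: norm_mult)
  define g where "g r = f (complex_of_real (min r r0) * \<xi>)" for r
  have "norm (f (complex_of_real r * \<xi>) - g r) \<le> 1 / (real k + 1)" if r: "r \<in> {0..<1}" for r
  proof (cases "r \<le> r0")
    case False
    have "norm (f (complex_of_real r * \<xi>) - f (complex_of_real r0 * \<xi>)) \<le> B * norm (complex_of_real r * \<xi> - complex_of_real r0 * \<xi>)"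
    proof (rule field_differentiable_bound[where S = "(\<lambda>t. complex_of_real t * \<xi>) ` {r0..r}" and f' = "deriv f"])
      show "convex ((\<lambda>t. complex_of_real t * \<xi>) ` {r0..r})"
        by (intro convex_linear_image) (auto intro!: linearI simp: algebra_simps scaleR_conv_of_real)
      fix z assume "z \<in> (\<lambda>t. complex_of_real t * \<xi>) ` {r0..r}"
      then obtain t where t: "r0 \<le> t" "t \<le> r" "z = complex_of_real t * \<xi>" by auto
      show "(f has_field_derivative deriv f z) (at z within (\<lambda>t. complex_of_real t * \<xi>) ` {r0..r})"
        by (rule DERIV_subset[OF holomorphic_derivI[OF hol]]) (use inb t r r0 in auto)
      show "norm (deriv f z) \<le> B" using \<delta>(2)[of t] t r r0 by auto
    qed (use False in auto)
    also have "norm (complex_of_real r * \<xi> - complex_of_real r0 * \<xi>) = r - r0"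
      using False \<xi> by (simp flip: left_diff_distrib of_real_diff add: norm_mult)
    also have "B * (r - r0) \<le> B * (1 - r0)" using r B by (intro mult_left_mono) auto
    finally show ?thesis using False Br by (simp add: g_def min_def)
  qed (simp add: g_def)
  moreover have "isCont g 1"
  proof -
    have "isCont f (complex_of_real r0 * \<xi>)"
      using holomorphic_on_imp_continuous_on[OF hol] inb[OF r0(1,2)] by (simp add: continuous_on_eq_continuous_at)
    then have "isCont f (complex_of_real (min 1 r0) * \<xi>)" using r0 by (simp add: min_def)
    moreover have "isCont (\<lambda>r. complex_of_real (min r r0) * \<xi>) 1" by (intro continuous_intros)
    ultimately show ?thesis
      unfolding g_def using isCont_o2[of 1 "\<lambda>r. complex_of_real (min r r0) * \<xi>" f] by blast
  qed
  ultimately show "\<exists>g. isCont g 1 \<and> (\<forall>r\<in>{0..<1}. norm (f (complex_of_real r * \<xi>) - g r) \<le> 1 / (real k + 1))"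
    by blast
qed

text \<open>The closed-disc estimate is used on the circle of radius \<rho> midway between |w| and
  1. This halves the distance to the boundary at worst, and 2 * (2 pi M) divided by pi (1 - |w|) / 2
  gives the constant 8.\<close>

lemma Hardy_growth:
  fixes h :: "complex \<Rightarrow> complex"
  assumes hol: "h holomorphic_on ball 0 1" and p: "p > 0" and M: "hardy_pow p h \<le> ennreal M" "M \<ge> 0"
    and w: "norm w < 1"
  shows "norm (h w) \<le> (8 * M) powr (1 / p) * (1 - norm w) powr (- (1 / p))"
proof -
  define \<rho> where "\<rho> = (1 + norm w) / 2"
  have \<rho>: "0 < \<rho>" "\<rho> < 1" "norm w < \<rho>" using w by (auto simp: \<rho>_def add_pos_nonneg)
  have I: "integral {0..2*pi} (\<lambda>t. norm (h (complex_of_real \<rho> * cis t)) powr p) \<le> 2 * pi * M"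
    using hardy_pow_le_iff[OF hol p M(2)] M(1) \<rho> by simp
  have n: "norm (w / complex_of_real \<rho>) < 1" using \<rho> by (simp add: norm_divide)
  have eq: "complex_of_real \<rho> * (w / complex_of_real \<rho>) = w" using \<rho> by simp
  have g: "norm (h w) powr p \<le> 2 * integral {0..2*pi} (\<lambda>t. norm (h (complex_of_real \<rho> * cis t)) powr p) / (pi * (1 - norm (w / complex_of_real \<rho>)))"
    using Hardy_growth_closed_disc[OF holomorphic_dilate[OF hol, of \<rho>] n p] \<rho> unfolding eq by simp
  have "(1 - norm w) / 2 \<le> 1 - norm (w / complex_of_real \<rho>)"
  proof -
    \<comment> \<open>Equivalent to (1 - |w|)^2 >= 0.\<close>
    have "norm w \<le> \<rho> * \<rho>"
      unfolding \<rho>_def using sum_squares_ge_zero[of "1 - norm w" 0] by (simp add: field_simps)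
    also have "\<dots> = \<rho> * (1 - (1 - norm w) / 2)" by (simp add: \<rho>_def field_simps)
    finally have "norm w \<le> \<rho> * (1 - (1 - norm w) / 2)" .
    then have "norm w / \<rho> \<le> 1 - (1 - norm w) / 2" using \<rho> by (simp add: divide_le_eq mult.commute)
    moreover have "norm (w / complex_of_real \<rho>) = norm w / \<rho>" using \<rho> by (simp add: norm_divide)
    ultimately show ?thesis by linarith
  qed
  then have "2 * integral {0..2*pi} (\<lambda>t. norm (h (complex_of_real \<rho> * cis t)) powr p) / (pi * (1 - norm (w / complex_of_real \<rho>)))
      \<le> 2 * (2 * pi * M) / (pi * ((1 - norm w) / 2))"
    using I w M(2) by (intro frac_le mult_left_mono) auto
  also have "\<dots> = 8 * M / (1 - norm w)" using w by (simp add: field_simps)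
  finally have "norm (h w) powr p \<le> 8 * M / (1 - norm w)" using g by linarith
  then have "(norm (h w) powr p) powr (1 / p) \<le> (8 * M / (1 - norm w)) powr (1 / p)"
    using p by (intro powr_mono2) auto
  then show ?thesis
    using p w M(2) by (simp add: powr_powr powr_divide powr_minus_divide)
qed

lemma Sp_growth_lt_1:
  fixes f :: "complex \<Rightarrow> complex"
  assumes hol: "f holomorphic_on ball 0 1" and p: "0 < p" "p < 1" and le: "hardy_pow p (deriv f) \<le> 1"
    and f0: "norm (f 0) \<le> 1" and w: "norm w < 1"
  shows "norm (f w) \<le> (1 + 8 powr (1 / p) / (1 / p - 1)) * (1 - norm w) powr (1 - 1 / p)"
proof -
  define e where "e = 1 / p - 1"
  have e: "e > 0" using p by (simp add: e_def field_simps)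
  define A where "A = 8 powr (1 / p)"
  have tw: "norm (complex_of_real t * w) < 1" if "0 \<le> t" "t \<le> 1" for t
    using that w mult_right_mono[of t 1 "norm w"] by (simp add: norm_mult)
  have pos: "1 - t * norm w > 0" if "0 \<le> t" "t \<le> 1" for t
    using tw[OF that] that by (simp add: norm_mult)
  have "norm (f (complex_of_real 1 * w) - f (complex_of_real 0 * w)) \<le> A / e * (1 - 1 * norm w) powr (- e) - A / e * (1 - 0 * norm w) powr (- e)"
  \<comment> \<open>The comparison function is the primitive in t of A |w| (1 - t |w|)^(-e-1), the
    growth bound for the speed along the radius; e > 0 is what p < 1 provides.\<close>
  proof (rule differentiable_bound_general[where f = "\<lambda>t. f (complex_of_real t * w)" and \<phi> = "\<lambda>t. A / e * (1 - t * norm w) powr (- e)"])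
    show "continuous_on {0..1} (\<lambda>t. f (complex_of_real t * w))"
      by (rule continuous_on_compose2[OF holomorphic_on_imp_continuous_on[OF hol]])
        (use tw in \<open>auto intro!: continuous_intros\<close>)
    show "continuous_on {0..1} (\<lambda>t. A / e * (1 - t * norm w) powr (- e))"
      by (intro continuous_intros) (use pos in force)
    fix t :: real assume t: "0 < t" "t < 1"
    have "(f has_field_derivative deriv f (complex_of_real t * w)) (at (complex_of_real t * w))"
      by (rule holomorphic_derivI[OF hol]) (use tw t in auto)
    moreover have "((\<lambda>t. complex_of_real t * w) has_vector_derivative w) (at t)"
      by (auto intro!: derivative_eq_intros has_vector_derivative_of_real[THEN has_vector_derivative_eq_rhs])
    ultimately show "((\<lambda>t. f (complex_of_real t * w)) has_vector_derivative w * deriv f (complex_of_real t * w)) (at t)"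
      using field_vector_diff_chain_at[of "\<lambda>t. complex_of_real t * w" w t f] by (simp add: o_def)
    have "((\<lambda>t. A / e * (1 - t * norm w) powr (- e)) has_real_derivative A / e * ((- e) * (1 - t * norm w) powr (- e - 1) * (- norm w))) (at t)"
      using pos[of t] t by (auto intro!: derivative_eq_intros simp: powr_diff)
    then show "((\<lambda>t. A / e * (1 - t * norm w) powr (- e)) has_vector_derivative A * (1 - t * norm w) powr (- e - 1) * norm w) (at t)"
      using e by (simp add: has_real_derivative_iff_has_vector_derivative mult.assoc)
    have "norm (deriv f (complex_of_real t * w)) \<le> (8 * 1) powr (1 / p) * (1 - norm (complex_of_real t * w)) powr (- (1 / p))"
      by (rule Hardy_growth) (use hol p le tw t in \<open>auto intro!: holomorphic_deriv\<close>)
    then have "norm (deriv f (complex_of_real t * w)) \<le> A * (1 - t * norm w) powr (- e - 1)"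
      using t by (simp add: A_def e_def norm_mult)
    then have "norm w * norm (deriv f (complex_of_real t * w)) \<le> norm w * (A * (1 - t * norm w) powr (- e - 1))"
      by (intro mult_left_mono) auto
    then show "norm (w * deriv f (complex_of_real t * w)) \<le> A * (1 - t * norm w) powr (- e - 1) * norm w"
      by (simp add: norm_mult mult_ac)
  qed auto
  then have "norm (f w - f 0) \<le> A / e * (1 - norm w) powr (- e)" using e by (simp add: A_def)
      (smt (verit) divide_nonneg_nonneg powr_ge_zero)
  \<comment> \<open>The contribution of f 0 is absorbed into the singular factor.\<close>
  moreover have "1 \<le> (1 - norm w) powr (- e)"
    using powr_mono2'[of "- e" "1 - norm w" 1] w e by simp
  moreover have "norm (f w) \<le> norm (f 0) + norm (f w - f 0)" by (metis norm_triangle_sub)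
  ultimately have "norm (f w) \<le> (1 - norm w) powr (- e) + A / e * (1 - norm w) powr (- e)"
    using f0 by linarith
  then show ?thesis by (simp add: A_def e_def algebra_simps)
qed

text \<open>On the circle through w, two values of f differ by at most the integral of |f'|, which
  is at most 4 pi because u <= 1 + u^p for p >= 1. Since f 0 is the mean of f over this circle, f w
  is as close to f 0.\<close>

lemma Sp_bounded_ge_1:
  fixes f :: "complex \<Rightarrow> complex"
  assumes hol: "f holomorphic_on ball 0 1" and p: "1 \<le> p" and le: "hardy_pow p (deriv f) \<le> 1"
    and f0: "norm (f 0) \<le> 1" and w: "norm w < 1"
  shows "norm (f w) \<le> 1 + 4 * pi"
proof -
  define r where "r = norm w"
  have r: "0 \<le> r" "r < 1" using w by (auto simp: r_def)
  define \<theta> where "\<theta> = Arg2pi w"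
  have \<theta>: "\<theta> \<in> {0..2*pi}" "w = complex_of_real r * cis \<theta>"
    using Arg2pi[of w] by (auto simp: \<theta>_def r_def cis_conv_exp is_Arg_def)
  have inb: "complex_of_real r * cis t \<in> ball 0 1" for t using r by (simp add: norm_mult)
  have hold: "deriv f holomorphic_on ball 0 1" by (intro holomorphic_deriv hol) auto
  define u where "u t = norm (deriv f (complex_of_real r * cis t))" for t
  have cd: "continuous_on S (\<lambda>t. deriv f (complex_of_real r * cis t))" for S
    by (rule continuous_on_compose2[OF holomorphic_on_imp_continuous_on[OF hold]])
      (use inb in \<open>auto intro!: continuous_intros\<close>)
  have cu: "continuous_on S u" for S unfolding u_def by (intro continuous_intros cd)
  have cup: "continuous_on S (\<lambda>t. u t powr p)" for S
    by (intro continuous_on_powr' cu continuous_intros) (use p in \<open>auto simp: u_def\<close>)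
  have "integral {0..2*pi} u \<le> integral {0..2*pi} (\<lambda>t. 1 + u t powr p)"
  proof (rule integral_le)
    show "u integrable_on {0..2*pi}" by (intro integrable_continuous_interval cu)
    show "(\<lambda>t. 1 + u t powr p) integrable_on {0..2*pi}"
      by (intro integrable_continuous_interval continuous_intros cup)
    show "u t \<le> 1 + u t powr p" for t
    proof (cases "u t \<le> 1")
      case False
      then have "u t powr 1 \<le> u t powr p" using p by (intro powr_mono) auto
      then show ?thesis using False by simp
    qed (simp add: add_increasing2)
  qed
  also have "\<dots> = 2 * pi + integral {0..2*pi} (\<lambda>t. u t powr p)"
    by (subst Henstock_Kurzweil_Integration.integral_add)
      (auto intro!: integrable_continuous_interval cup)
  also have "integral {0..2*pi} (\<lambda>t. u t powr p) \<le> 2 * pi * 1"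
    using hardy_pow_le_iff[OF hold, of p 1] p le r unfolding u_def by simp
  finally have U: "integral {0..2*pi} u \<le> 4 * pi" by simp
  have arc: "norm (f (complex_of_real r * cis t) - f (complex_of_real r * cis s)) \<le> 4 * pi" if "0 \<le> s" "s \<le> t" "t \<le> 2 * pi" for s t
  proof -
    have "((\<lambda>x. (complex_of_real r * (\<i> * cis x)) * deriv f (complex_of_real r * cis x)) has_integral
       f (complex_of_real r * cis t) - f (complex_of_real r * cis s)) {s..t}"
    proof (rule fundamental_theorem_of_calculus[OF that(2)])
      fix x
      have "(f has_field_derivative deriv f (complex_of_real r * cis x)) (at (complex_of_real r * cis x))"
        by (rule holomorphic_derivI[OF hol]) (use inb in auto)
      moreover have "((\<lambda>x. complex_of_real r * cis x) has_vector_derivative complex_of_real r * (\<i> * cis x)) (at x)"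
        unfolding has_vector_derivative_def
        by (auto intro!: derivative_eq_intros simp: scaleR_conv_of_real mult_ac)
      ultimately have "((\<lambda>x. f (complex_of_real r * cis x)) has_vector_derivative (complex_of_real r * (\<i> * cis x)) * deriv f (complex_of_real r * cis x)) (at x)"
        using field_vector_diff_chain_at[of "\<lambda>x. complex_of_real r * cis x" _ x f] by (simp add: o_def)
      then show "((\<lambda>x. f (complex_of_real r * cis x)) has_vector_derivative (complex_of_real r * (\<i> * cis x)) * deriv f (complex_of_real r * cis x)) (at x within {s..t})"
        by (rule has_vector_derivative_at_within)
    qed
    then have "norm (f (complex_of_real r * cis t) - f (complex_of_real r * cis s))
       = norm (integral {s..t} (\<lambda>x. (complex_of_real r * (\<i> * cis x)) * deriv f (complex_of_real r * cis x)))"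
      by (simp add: integral_unique)
    also have "\<dots> \<le> integral {s..t} u"
    proof (rule integral_norm_bound_integral)
      show "u integrable_on {s..t}" by (intro integrable_continuous_interval cu)
      show "norm (complex_of_real r * (\<i> * cis x) * deriv f (complex_of_real r * cis x)) \<le> u x" for x
        using r by (simp add: norm_mult u_def mult_left_le_one_le)
    qed (intro integrable_continuous_interval continuous_intros cd)
    also have "\<dots> \<le> integral {0..2*pi} u"
      by (rule integral_subset_le) (use that in \<open>auto intro!: integrable_continuous_interval cu simp: u_def\<close>)
    finally show ?thesis using U by linarith
  qed
  have arc': "norm (f w - f (complex_of_real r * cis t)) \<le> 4 * pi" if "t \<in> {0..2*pi}" for t
    using arc[of t \<theta>] arc[of \<theta> t] \<theta> that by (cases "t \<le> \<theta>") (auto simp: norm_minus_commute)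
  have mv: "((\<lambda>t. f (complex_of_real r * cis t)) has_integral 2 * pi * f 0) {0..2*pi}"
    using mean_value_has_integral[OF holomorphic_dilate[OF hol r]] by simp
  have "((\<lambda>t. f w - f (complex_of_real r * cis t)) has_integral (2 * pi * f w - 2 * pi * f 0)) {0..2*pi}"
    using has_integral_diff[OF has_integral_const_real[of "f w" 0 "2 * pi"] mv] by (simp add: scaleR_conv_of_real)
  from has_integral_bound_real[of "4 * pi" "{}", OF _ _ this] arc'
  have "norm (2 * pi * f w - 2 * pi * f 0) \<le> 4 * pi * (2 * pi)" by simp
  moreover have "2 * pi * f w - 2 * pi * f 0 = complex_of_real (2 * pi) * (f w - f 0)" by (simp add: algebra_simps)
  ultimately have "norm (f w - f 0) * (2 * pi) \<le> 4 * pi * (2 * pi)" by (simp only: norm_mult norm_of_real) simp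
  then have "norm (f w - f 0) \<le> 4 * pi" by simp
  moreover have "norm (f w) \<le> norm (f 0) + norm (f w - f 0)" by (metis norm_triangle_sub)
  ultimately show ?thesis using f0 by linarith
qed

section \<open>Normalization and test functions\<close>

lemma Sp_normalize:
  assumes "p > 0" "B \<ge> 0"
  obtains \<kappa> where "\<kappa> > 0"
    "\<And>f. f holomorphic_on ball 0 1 \<Longrightarrow> norm (f 0) \<le> 1 \<Longrightarrow> hardy_pow p (deriv f) \<le> ennreal B
      \<Longrightarrow> in_Sp p (\<lambda>z. complex_of_real \<kappa> * f z) \<and> Sp_norm p (\<lambda>z. complex_of_real \<kappa> * f z) \<le> 1"
proof
  \<comment> \<open>The factor 1/2 splits the unit budget between f 0 and the derivative; 1 + B in
    place of B gives both \<kappa> <= 1/2 and \<kappa>^p B <= (1/2)^p. Only p and B enter, so one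
    constant serves a whole family of functions.\<close>
  define \<kappa> where "\<kappa> = 1 / (2 * (1 + B) powr (1 / p))"
  show k: "\<kappa> > 0" using assms by (simp add: \<kappa>_def)
  have "1 \<le> (1 + B) powr (1 / p)" using assms by (intro ge_one_powr_ge_zero) auto
  then have k2: "\<kappa> \<le> 1 / 2" by (simp add: \<kappa>_def divide_le_eq)
  have "\<kappa> powr p = (1 / 2) powr p * (1 / (1 + B))"
    using assms by (simp add: \<kappa>_def powr_divide powr_mult powr_powr)
  then have kB: "\<kappa> powr p * B \<le> (1 / 2) powr p"
    using assms by (simp add: divide_le_eq mult_left_mono)
  fix f :: "complex \<Rightarrow> complex"
  assume f: "f holomorphic_on ball 0 1" "norm (f 0) \<le> 1" "hardy_pow p (deriv f) \<le> ennreal B"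
  let ?g = "\<lambda>z. complex_of_real \<kappa> * f z"
  have g: "?g holomorphic_on ball 0 1" by (intro holomorphic_intros f)
  have holf: "deriv f holomorphic_on ball 0 1" and holg: "deriv ?g holomorphic_on ball 0 1"
    using f g by (auto intro: holomorphic_deriv)
  have dg: "deriv ?g z = complex_of_real \<kappa> * deriv f z" if "norm z < 1" for z
    using that f(1) by (intro deriv_cmult) (auto intro: holomorphic_on_imp_differentiable_at)
  have "hardy_pow p (deriv ?g) \<le> ennreal ((1 / 2) powr p)"
    unfolding hardy_pow_le_iff[OF holg assms(1) powr_ge_zero]
  proof
    fix r :: real assume r: "r \<in> {0..<1}"
    have "norm (complex_of_real r * cis t) < 1" for t using r by (simp add: norm_mult)
    from dg[OF this] have "integral {0..2*pi} (\<lambda>t. norm (deriv ?g (complex_of_real r * cis t)) powr p)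
       = integral {0..2*pi} (\<lambda>t. \<kappa> powr p * norm (deriv f (complex_of_real r * cis t)) powr p)"
      using k by (simp add: norm_mult powr_mult)
    also have "\<dots> \<le> \<kappa> powr p * (2 * pi * B)"
      using hardy_pow_le_iff[OF holf assms] f(3) r by (auto intro!: mult_left_mono)
    also have "\<dots> \<le> 2 * pi * (1 / 2) powr p" using kB by (simp add: mult.left_commute)
    finally show "integral {0..2*pi} (\<lambda>t. norm (deriv ?g (complex_of_real r * cis t)) powr p) \<le> 2 * pi * (1 / 2) powr p" .
  qed
  note le = this
  then have "hardy_norm p (deriv ?g) \<le> ((1 / 2) powr p) powr (1 / p)"
    unfolding hardy_norm_def using assms by (intro powr_mono2 enn2real_leI) auto
  also have "\<dots> = 1 / 2" using assms by (simp add: powr_powr)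
  finally have "Sp_norm p ?g \<le> 1"
    using mult_mono[OF k2 f(2)] k by (simp add: Sp_norm_def norm_mult)
  moreover have "in_Sp p ?g" using g le_less_trans[OF le ennreal_less_top] by (simp add: in_Sp_def)
  ultimately show "in_Sp p ?g \<and> Sp_norm p ?g \<le> 1" by simp
qed

text \<open>The exponent of the numerator comes from scaling: the circle means of |1 - cnj w *
  z|^(-(k+1)p) are of order (1 - |w|^2)^(1-(k+1)p) once (k+1)p > 1, so the derivatives stay bounded
  in H^p independently of w. The parameter k is explicit because two values are compared
  later.\<close>

definition Sp_test :: "real \<Rightarrow> nat \<Rightarrow> complex \<Rightarrow> complex \<Rightarrow> complex" where
  "Sp_test p k w z = complex_of_real ((1 - (norm w)\<^sup>2) powr (real k + 1 - 1 / p)) / (1 - cnj w * z) ^ k"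

lemma Sp_test_has_deriv:
  assumes "norm w < 1" "norm z < 1"
  shows "(Sp_test p k w has_field_derivative
    complex_of_real ((1 - (norm w)\<^sup>2) powr (real k + 1 - 1 / p)) * of_nat k * cnj w / (1 - cnj w * z) ^ Suc k) (at z)"
proof -
  have nz: "1 - cnj w * z \<noteq> 0" using assms by (intro one_minus_cnj_mult_nonzero) auto
  show ?thesis
  proof (cases k)
    case 0
    then show ?thesis by (simp add: Sp_test_def[abs_def])
  next
    case (Suc m)
    have "((\<lambda>z. 1 - cnj w * z) has_field_derivative - cnj w) (at z)"
      by (auto intro!: derivative_eq_intros)
    from DERIV_inverse_fun[OF DERIV_power[OF this, of k]] nz
    have "((\<lambda>z. inverse ((1 - cnj w * z) ^ k)) has_field_derivative
       - (inverse ((1 - cnj w * z) ^ k) * (of_nat k * (- cnj w * (1 - cnj w * z) ^ (k - Suc 0))) * inverse ((1 - cnj w * z) ^ k))) (at z)"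
      by (simp add: mult_ac)
    from DERIV_cmult[OF this, of "complex_of_real ((1 - (norm w)\<^sup>2) powr (real k + 1 - 1 / p))"]
    moreover have "c * - (inverse (d ^ k) * (n * (- v * d ^ (k - Suc 0))) * inverse (d ^ k)) = c * n * v * inverse (d ^ Suc k)"
      if "d \<noteq> 0" for c n v d :: complex
      using that by (simp add: Suc field_simps)
    ultimately show ?thesis unfolding Sp_test_def[abs_def] divide_inverse
      by (metis (no_types, lifting) nz)
  qed
qed

lemma Sp_test_holomorphic: "norm w < 1 \<Longrightarrow> Sp_test p k w holomorphic_on ball 0 1"
  unfolding holomorphic_on_def field_differentiable_def
  using Sp_test_has_deriv by (metis has_field_derivative_at_within mem_ball_0)

lemma norm_Sp_test_0_le: "norm w < 1 \<Longrightarrow> p > 0 \<Longrightarrow> 1 \<le> (real k + 1) * p \<Longrightarrow> norm (Sp_test p k w 0) \<le> 1"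
proof -
  assume "norm w < 1" "p > 0" "1 \<le> (real k + 1) * p"
  then have "0 \<le> real k + 1 - 1 / p" "0 \<le> 1 - (norm w)\<^sup>2"
    by (auto simp: divide_le_eq add.commute power_le_one)
  then have "(1 - (norm w)\<^sup>2) powr (real k + 1 - 1 / p) \<le> 1" by (intro powr_le1) auto
  then show ?thesis by (simp add: Sp_test_def)
qed

text \<open>Put x = |1 - cnj w * z| and a = (k + 1) p. As x >= 1 - |w| and a >= 2, the power x^(-a)
  is at most (1 - |w|)^(2-a) x^(-2), and x^(-2) is a Poisson kernel up to its constant factor, with
  known integral.\<close>

lemma hardy_pow_deriv_Sp_test_le:
  assumes w: "norm w < 1" and p: "p > 0" and kp: "2 \<le> (real k + 1) * p"
  shows "hardy_pow p (deriv (Sp_test p k w)) \<le> ennreal (real k powr p * 2 powr ((real k + 1) * p - 2))"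
proof -
  let ?a = "(real k + 1) * p"
  let ?s = "1 - (norm w)\<^sup>2"
  let ?B = "real k powr p * 2 powr (?a - 2)"
  have s_eq: "?s = (1 - norm w) * (1 + norm w)" by (simp add: power2_eq_square algebra_simps)
  have s: "?s > 0" unfolding s_eq using w by (intro mult_pos_pos add_pos_nonneg) auto
  have hol: "deriv (Sp_test p k w) holomorphic_on ball 0 1"
    using Sp_test_holomorphic[OF w] by (intro holomorphic_deriv) auto
  show ?thesis
    unfolding hardy_pow_le_iff[OF hol p mult_nonneg_nonneg[OF powr_ge_zero powr_ge_zero]]
  proof
    fix r :: real assume r: "r \<in> {0..<1}"
    \<comment> \<open>On the circle of radius r the denominator is that of the parameter r w on the
      unit circle.\<close>
    let ?w = "complex_of_real r * w"
    have nw: "norm ?w \<le> norm w" using r by (simp add: norm_mult mult_left_le_one_le)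
    have K: "((\<lambda>t. 1 / (norm (1 - cnj ?w * cis t))\<^sup>2) has_integral (2 * pi / (1 - (norm ?w)\<^sup>2))) {0..2*pi}"
      by (rule poisson_kernel_has_integral) (use nw w in auto)
    define A where "A = real k powr p * (?s powr (?a - 1) * (1 - norm w) powr (2 - ?a))"
    have inb: "norm (complex_of_real r * cis t) < 1" for t using r by (simp add: norm_mult)
    have "integral {0..2*pi} (\<lambda>t. norm (deriv (Sp_test p k w) (complex_of_real r * cis t)) powr p) \<le> integral {0..2*pi} (\<lambda>t. A * (1 / (norm (1 - cnj ?w * cis t))\<^sup>2))"
    proof (rule integral_le)
      have "continuous_on {0..2*pi} (\<lambda>t. deriv (Sp_test p k w) (complex_of_real r * cis t))"
        by (rule continuous_on_compose2[OF holomorphic_on_imp_continuous_on[OF hol]])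
          (use inb in \<open>auto intro!: continuous_intros\<close>)
      then show "(\<lambda>t. norm (deriv (Sp_test p k w) (complex_of_real r * cis t)) powr p) integrable_on {0..2*pi}"
        using p by (intro integrable_continuous_interval continuous_on_powr' continuous_intros) auto
      show "(\<lambda>t. A * (1 / (norm (1 - cnj ?w * cis t))\<^sup>2)) integrable_on {0..2*pi}"
        using has_integral_mult_right[OF K, of A] by blast
      fix t
      define x where "x = norm (1 - cnj ?w * cis t)"
      have x_ge: "1 - norm w \<le> x"
        using one_minus_cnj_mult_norm_ge[of "complex_of_real r * cis t" w] inb[of t] by (simp add: x_def mult_ac)
      have x: "x > 0" using x_ge w by linarith
      have "norm (deriv (Sp_test p k w) (complex_of_real r * cis t))
          = ?s powr (real k + 1 - 1 / p) * real k * norm w / x ^ Suc k"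
        unfolding DERIV_imp_deriv[OF Sp_test_has_deriv[OF w inb]] norm_mult norm_divide norm_power x_def
        by (simp add: mult_ac del: power_Suc)
      also have "x ^ Suc k = x powr (real k + 1)" using x by (subst powr_realpow[symmetric]) (auto simp: add.commute)
      also have "?s powr (real k + 1 - 1 / p) * real k * norm w / x powr (real k + 1)
          \<le> ?s powr (real k + 1 - 1 / p) * real k * 1 / x powr (real k + 1)"
        using w by (intro divide_right_mono mult_left_mono) auto
      finally have "norm (deriv (Sp_test p k w) (complex_of_real r * cis t)) powr p \<le>
         (?s powr (real k + 1 - 1 / p) * real k / x powr (real k + 1)) powr p"
        using p by (intro powr_mono2) auto
      also have "\<dots> = real k powr p * (?s powr (?a - 1) * (1 / x powr ?a))"
        using s x p by (simp add: powr_mult powr_divide powr_powr algebra_simps)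
      also have "1 / x powr ?a = x powr (2 - ?a) * (1 / x\<^sup>2)"
        using x by (simp add: powr_diff powr_numeral)
      also have "x powr (2 - ?a) * (1 / x\<^sup>2) \<le> (1 - norm w) powr (2 - ?a) * (1 / x\<^sup>2)"
        using x_ge kp w by (intro mult_right_mono powr_mono2') auto
      finally show "norm (deriv (Sp_test p k w) (complex_of_real r * cis t)) powr p \<le> A * (1 / (norm (1 - cnj ?w * cis t))\<^sup>2)"
        unfolding A_def x_def[symmetric] by (simp add: mult_left_mono mult.assoc)
    qed
    also have "\<dots> = A * (2 * pi / (1 - (norm ?w)\<^sup>2))"
      by (rule integral_unique[OF has_integral_mult_right[OF K]])
    also have "\<dots> \<le> A * (2 * pi / ?s)"
    proof (intro mult_left_mono divide_left_mono)
      have "(norm ?w)\<^sup>2 \<le> (norm w)\<^sup>2" by (rule power_mono[OF nw]) simp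
      then show *: "?s \<le> 1 - (norm ?w)\<^sup>2" by simp
      show "0 < (1 - (norm ?w)\<^sup>2) * ?s" using s less_le_trans[OF s *] by (rule mult_pos_pos[rotated])
    qed (auto simp: A_def)
    also have "\<dots> = 2 * pi * (real k powr p * ((1 + norm w) powr (?a - 2)))"
    proof -
      \<comment> \<open>Splitting \<open>?s\<close> as (1 - |w|)(1 + |w|) makes the powers of 1 -
        |w| cancel; what remains is at most 2^(a-2).\<close>
      have "?s powr (?a - 1) / ?s = ?s powr (?a - 2)" using s by (simp add: powr_diff powr_numeral power2_eq_square)
      also have "\<dots> = (1 - norm w) powr (?a - 2) * (1 + norm w) powr (?a - 2)"
        unfolding s_eq using w by (simp add: powr_mult)
      finally have *: "?s powr (?a - 1) / ?s * (1 - norm w) powr (2 - ?a) = (1 + norm w) powr (?a - 2)"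
        using w powr_add[of "1 - norm w" "?a - 2" "2 - ?a"] by (simp add: mult_ac)
      have "A * (2 * pi / ?s) = 2 * pi * (real k powr p * (?s powr (?a - 1) / ?s * (1 - norm w) powr (2 - ?a)))"
        unfolding A_def by (simp add: mult_ac)
      then show ?thesis unfolding * .
    qed
    also have "\<dots> \<le> 2 * pi * ?B"
      using w kp by (intro mult_left_mono powr_mono2) auto
    finally show "integral {0..2*pi} (\<lambda>t. norm (deriv (Sp_test p k w) (complex_of_real r * cis t)) powr p) \<le> 2 * pi * ?B" .
  qed
qed

section \<open>Order boundedness in terms of boundary values\<close>

lemma radial_lim_eq: "has_radial_lim f \<xi> L \<Longrightarrow> radial_lim f \<xi> = L"
  unfolding has_radial_lim_def radial_lim_def by (intro tendsto_Lim) simp_all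

text \<open>Taking the limit along the radii n / (n + 1) gives a function that is Borel by
  construction and agrees almost everywhere with the radial limit; Fatou's lemma along the same
  radii bounds its L^q size.\<close>

lemma radial_lim_borel_version:
  assumes hol: "f holomorphic_on ball 0 1" and ex: "AE \<xi> in circle_measure. \<exists>L. has_radial_lim f \<xi> L"
    and q: "q > 0"
  obtains b :: "complex \<Rightarrow> complex" where "b \<in> borel_measurable borel" "AE \<xi> in circle_measure. has_radial_lim f \<xi> (b \<xi>)"
    "(\<integral>\<^sup>+ \<xi>. ennreal (norm (b \<xi>) powr q) \<partial>circle_measure) \<le> hardy_pow q f"
proof -
  define \<rho> where "\<rho> n = real n / (real n + 1)" for n
  have \<rho>: "0 \<le> \<rho> n" "\<rho> n < 1" for n by (auto simp: \<rho>_def)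
  have \<rho>_lim: "filterlim \<rho> (at_left 1) sequentially"
  proof -
    have "\<rho> \<longlonglongrightarrow> 1" unfolding \<rho>_def by real_asymp
    then show ?thesis using \<rho>(2) unfolding filterlim_at by (auto simp: less_imp_neq)
  qed
  \<comment> \<open>The cut-off outside the circle keeps the points fed to f in the disc, where f is
    continuous, and makes each \<open>u n\<close> Borel on the plane.\<close>
  define u where "u n \<xi> = (if \<xi> \<in> sphere 0 1 then f (complex_of_real (\<rho> n) * \<xi>) else 0)" for n \<xi>
  have [measurable]: "u n \<in> borel_measurable borel" for n
    unfolding u_def
    by (intro borel_measurable_continuous_on_if continuous_intros
        continuous_on_subset[OF holomorphic_dilate(1)[OF hol \<rho>]]) auto
  define b where "b \<xi> = lim (\<lambda>n. u n \<xi>)" for \<xi>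
  have b_meas: "b \<in> borel_measurable borel"
    unfolding b_def by (intro borel_measurable_lim_metric) measurable
  have conv: "AE \<xi> in circle_measure. has_radial_lim f \<xi> (b \<xi>) \<and> (\<lambda>n. u n \<xi>) \<longlonglongrightarrow> b \<xi>"
    using ex AE_circle_measure_sphere
  proof eventually_elim
    case (elim \<xi>)
    then obtain L where L: "has_radial_lim f \<xi> L" by blast
    have "(\<lambda>n. f (complex_of_real (\<rho> n) * \<xi>)) \<longlonglongrightarrow> L"
      using filterlim_compose[OF L[unfolded has_radial_lim_def] \<rho>_lim] .
    then have "(\<lambda>n. u n \<xi>) \<longlonglongrightarrow> L" using elim by (simp add: u_def)
    then show ?case using L by (simp add: b_def limI)
  qed
  have "(\<integral>\<^sup>+ \<xi>. ennreal (norm (b \<xi>) powr q) \<partial>circle_measure) = (\<integral>\<^sup>+ \<xi>. liminf (\<lambda>n. ennreal (norm (u n \<xi>) powr q)) \<partial>circle_measure)"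
  proof (rule nn_integral_cong_AE, use conv in eventually_elim)
    case (elim \<xi>)
    then have "(\<lambda>n. ennreal (norm (u n \<xi>) powr q)) \<longlonglongrightarrow> ennreal (norm (b \<xi>) powr q)"
      using q by (intro tendsto_ennrealI tendsto_powr' tendsto_intros) auto
    from lim_imp_Liminf[OF _ this] show ?case by simp
  qed
  also have "\<dots> \<le> liminf (\<lambda>n. \<integral>\<^sup>+ \<xi>. ennreal (norm (u n \<xi>) powr q) \<partial>circle_measure)"
    by (rule nn_integral_liminf) measurable
  also have "\<dots> \<le> limsup (\<lambda>n. \<integral>\<^sup>+ \<xi>. ennreal (norm (u n \<xi>) powr q) \<partial>circle_measure)"
    by (rule Liminf_le_Limsup) simp
  also have "\<dots> \<le> hardy_pow q f"
  proof (rule Limsup_bounded, rule always_eventually, rule allI)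
    fix n
    have "(\<integral>\<^sup>+ \<xi>. ennreal (norm (u n \<xi>) powr q) \<partial>circle_measure) = (\<integral>\<^sup>+ \<xi>. ennreal (norm (f (complex_of_real (\<rho> n) * \<xi>)) powr q) \<partial>circle_measure)"
      by (rule nn_integral_cong_AE, use AE_circle_measure_sphere in eventually_elim) (simp add: u_def)
    also have "\<dots> \<le> hardy_pow q f"
      unfolding hardy_pow_def using \<rho> by (intro SUP_upper) auto
    finally show "(\<integral>\<^sup>+ \<xi>. ennreal (norm (u n \<xi>) powr q) \<partial>circle_measure) \<le> hardy_pow q f" .
  qed
  finally show ?thesis using that b_meas conv by auto
qed

text \<open>The boundary value c of \<psi> lies inside the disc, so f and its derivative are
  continuous at c and the product and chain rules pass to the limit; boundary values of f never
  enter.\<close>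

lemma has_radial_lim_deriv_weighted_comp:
  assumes hol: "\<phi> holomorphic_on ball 0 1" "\<psi> holomorphic_on ball 0 1" "f holomorphic_on ball 0 1"
    and self: "\<And>z. norm z < 1 \<Longrightarrow> norm (\<psi> z) < 1" and \<xi>: "norm \<xi> = 1"
    and lim: "has_radial_lim \<phi> \<xi> a" "has_radial_lim (deriv \<phi>) \<xi> b" "has_radial_lim \<psi> \<xi> c" "has_radial_lim (deriv \<psi>) \<xi> d"
    and c: "norm c < 1"
  shows "has_radial_lim (deriv (weighted_comp \<phi> \<psi> f)) \<xi> (b * f c + a * (deriv f c * d))"
proof -
  have ev: "eventually (\<lambda>r. norm (complex_of_real r * \<xi>) < 1) (at_left 1)"
    by (rule eventually_at_leftI[of 0]) (use \<xi> in \<open>auto simp: norm_mult\<close>)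
  have D: "deriv (weighted_comp \<phi> \<psi> f) z = deriv \<phi> z * f (\<psi> z) + \<phi> z * (deriv f (\<psi> z) * deriv \<psi> z)"
    if "norm z < 1" for z
  proof -
    have d\<phi>: "(\<phi> has_field_derivative deriv \<phi> z) (at z)" and d\<psi>: "(\<psi> has_field_derivative deriv \<psi> z) (at z)"
      using that by (auto intro: holomorphic_derivI[OF hol(1)] holomorphic_derivI[OF hol(2)])
    have "(f has_field_derivative deriv f (\<psi> z)) (at (\<psi> z))"
      using that self by (auto intro: holomorphic_derivI[OF hol(3)])
    from DERIV_mult[OF d\<phi> DERIV_chain2[OF this d\<psi>]]
    show ?thesis unfolding weighted_comp_def by (intro DERIV_imp_deriv) (simp add: mult_ac add_ac)
  qed
  have "isCont f c" "isCont (deriv f) c"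
    using c holomorphic_on_imp_continuous_on[OF hol(3)] holomorphic_on_imp_continuous_on[OF holomorphic_deriv[OF hol(3) open_ball]]
    by (auto simp: continuous_on_eq_continuous_at)
  then have "((\<lambda>r. f (\<psi> (complex_of_real r * \<xi>))) \<longlongrightarrow> f c) (at_left 1)"
    "((\<lambda>r. deriv f (\<psi> (complex_of_real r * \<xi>))) \<longlongrightarrow> deriv f c) (at_left 1)"
    using lim(3) by (auto simp: has_radial_lim_def intro: isCont_tendsto_compose)
  then have "((\<lambda>r. deriv \<phi> (complex_of_real r * \<xi>) * f (\<psi> (complex_of_real r * \<xi>))
      + \<phi> (complex_of_real r * \<xi>) * (deriv f (\<psi> (complex_of_real r * \<xi>)) * deriv \<psi> (complex_of_real r * \<xi>)))
      \<longlongrightarrow> b * f c + a * (deriv f c * d)) (at_left 1)"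
    using lim unfolding has_radial_lim_def by (intro tendsto_intros)
  then show ?thesis unfolding has_radial_lim_def
    by (rule Lim_transform_eventually) (use ev in \<open>eventually_elim, simp add: D\<close>)
qed

section \<open>Sufficiency: an explicit dominating function\<close>

lemma Sp_normD:
  assumes "in_Sp p f" "Sp_norm p f \<le> 1" "p > 0"
  shows "f holomorphic_on ball 0 1" "norm (f 0) \<le> 1" "hardy_pow p (deriv f) \<le> 1"
proof -
  show "f holomorphic_on ball 0 1" using assms by (simp add: in_Sp_def)
  have h: "hardy_norm p (deriv f) \<ge> 0" by (simp add: hardy_norm_def)
  show "norm (f 0) \<le> 1" using assms(2) h by (simp add: Sp_norm_def)
  have "hardy_norm p (deriv f) \<le> 1"
    using assms(2) norm_ge_zero[of "f 0"] unfolding Sp_norm_def by linarith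
  then have "(enn2real (hardy_pow p (deriv f)) powr (1 / p)) powr p \<le> 1 powr p"
    unfolding hardy_norm_def using assms(3) by (intro powr_mono2) auto
  then have "enn2real (hardy_pow p (deriv f)) \<le> 1" using assms(3) by (simp add: powr_powr)
  moreover have "hardy_pow p (deriv f) < \<infinity>" using assms(1) by (simp add: in_Sp_def)
  ultimately show "hardy_pow p (deriv f) \<le> 1"
    by (metis ennreal_enn2real ennreal_le_1 infinity_ennreal_def)
qed

lemma powr_one_minus_norm_le:
  fixes w :: complex
  assumes "norm w < 1" "e \<ge> 0"
  shows "(1 - norm w) powr (- e) \<le> 2 powr e * (1 - (norm w)\<^sup>2) powr (- e)"
proof -
  have s: "1 - (norm w)\<^sup>2 = (1 - norm w) * (1 + norm w)" by (simp add: power2_eq_square algebra_simps)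
  have "1 - (norm w)\<^sup>2 \<le> (1 - norm w) * 2"
    unfolding s using assms by (intro mult_left_mono) auto
  moreover have "1 - (norm w)\<^sup>2 > 0" unfolding s using assms by (intro mult_pos_pos add_pos_nonneg) auto
  ultimately have "(1 - norm w) powr (- e) \<le> ((1 - (norm w)\<^sup>2) / 2) powr (- e)"
    using assms by (intro powr_mono2') auto
  also have "\<dots> = 2 powr e * (1 - (norm w)\<^sup>2) powr (- e)"
    using \<open>1 - (norm w)\<^sup>2 > 0\<close> by (simp add: powr_divide powr_minus_divide)
  finally show ?thesis .
qed

lemma powr_add_le:
  fixes x y q :: real
  assumes "x \<ge> 0" "y \<ge> 0" "q > 0"
  shows "(x + y) powr q \<le> 2 powr q * (x powr q + y powr q)"
proof -
  have "(x + y) powr q \<le> (2 * max x y) powr q" using assms by (intro powr_mono2) auto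
  also have "\<dots> = 2 powr q * max x y powr q" using assms by (simp add: powr_mult)
  also have "max x y powr q \<le> x powr q + y powr q" by (simp add: max_def)
  finally show ?thesis by simp
qed

lemma powr_mult_powr_minus:
  fixes x s q e :: real
  assumes "x \<ge> 0" "s > 0"
  shows "(x * s powr (- e)) powr q = x powr q / s powr (q * e)"
  using assms by (simp add: powr_mult powr_divide powr_powr powr_minus_divide mult.commute)

text \<open>Here \<open>a\<close>, \<open>b\<close>, \<open>c\<close>, \<open>d\<close> are Borel
  versions of the boundary values of \<phi>, \<phi>', \<psi>, \<psi>'. Both implications are proved
  for them and transferred to \<open>radial_lim\<close> by almost everywhere equality.\<close>

locale boundary_values =
  fixes p q :: real and \<phi> \<psi> a b c d :: "complex \<Rightarrow> complex"
  assumes p: "p > 0" and q: "q > 0"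
    and hol: "\<phi> holomorphic_on ball 0 1" "\<psi> holomorphic_on ball 0 1"
    and self: "\<And>z. norm z < 1 \<Longrightarrow> norm (\<psi> z) < 1"
    and meas [measurable]: "a \<in> borel_measurable borel" "b \<in> borel_measurable borel"
      "c \<in> borel_measurable borel" "d \<in> borel_measurable borel"
    and lim: "AE \<xi> in circle_measure. norm \<xi> = 1 \<and> has_radial_lim \<phi> \<xi> (a \<xi>) \<and> has_radial_lim (deriv \<phi>) \<xi> (b \<xi>) \<and>
       has_radial_lim \<psi> \<xi> (c \<xi>) \<and> has_radial_lim (deriv \<psi>) \<xi> (d \<xi>) \<and> norm (c \<xi>) < 1"
begin

text \<open>The dominating function is x + y: x bounds \<phi>' f(\<psi>) by the growth of f, and y
  bounds \<phi> f'(\<psi>) \<psi>' by the growth of f'. The growth exponent e is a parameter, to be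
  (1 - p) / p when p < 1 and 0 when p >= 1.\<close>

lemma order_bounded_if_integrals_finite:
  assumes e: "e \<ge> 0" and C: "C \<ge> 0"
    and growth: "\<And>f w. in_Sp p f \<Longrightarrow> Sp_norm p f \<le> 1 \<Longrightarrow> norm w < 1 \<Longrightarrow> norm (f w) \<le> C * (1 - norm w) powr (- e)"
    and I1: "(\<integral>\<^sup>+ \<xi>. ennreal (norm (a \<xi> * d \<xi>) powr q / (1 - (norm (c \<xi>))\<^sup>2) powr (q / p)) \<partial>circle_measure) < \<infinity>"
    and I2: "(\<integral>\<^sup>+ \<xi>. ennreal (norm (b \<xi>) powr q / (1 - (norm (c \<xi>))\<^sup>2) powr (q * e)) \<partial>circle_measure) < \<infinity>"
  shows "order_bounded p q \<phi> \<psi>"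
proof -
  define s where "s \<xi> = 1 - (norm (c \<xi>))\<^sup>2" for \<xi>
  define A where "A = C * 2 powr e"
  \<comment> \<open>The power of 8 is the constant of \<open>Hardy_growth\<close> for M = 1; the
    power of 2 pays for replacing 1 - |c| by 1 - |c|^2.\<close>
  define B where "B = (8::real) powr (1 / p) * 2 powr (1 / p)"
  have AB: "A \<ge> 0" "B \<ge> 0" using C by (auto simp: A_def B_def)
  define x where "x \<xi> = A * (norm (b \<xi>) * s \<xi> powr (- e))" for \<xi>
  define y where "y \<xi> = B * (norm (a \<xi> * d \<xi>) * s \<xi> powr (- (1 / p)))" for \<xi>
  have xy: "x \<xi> \<ge> 0" "y \<xi> \<ge> 0" for \<xi> using AB by (auto simp: x_def y_def)
  have [measurable]: "x \<in> borel_measurable borel" "y \<in> borel_measurable borel"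
    unfolding x_def y_def s_def by measurable
  show ?thesis unfolding order_bounded_def
  proof (intro exI[of _ "\<lambda>\<xi>. x \<xi> + y \<xi>"] conjI allI impI)
    show "(\<lambda>\<xi>. x \<xi> + y \<xi>) \<in> borel_measurable circle_measure" by measurable
    have "(\<integral>\<^sup>+ \<xi>. ennreal (\<bar>x \<xi> + y \<xi>\<bar> powr q) \<partial>circle_measure) \<le>
      (\<integral>\<^sup>+ \<xi>. ennreal (2 powr q * A powr q) * ennreal (norm (b \<xi>) powr q / s \<xi> powr (q * e))
         + ennreal (2 powr q * B powr q) * ennreal (norm (a \<xi> * d \<xi>) powr q / s \<xi> powr (q / p)) \<partial>circle_measure)"
    proof (rule nn_integral_mono_AE, use lim in eventually_elim)
      case (elim \<xi>)
      have s: "s \<xi> > 0" using elim by (simp add: s_def power_less_one_iff)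
      have "\<bar>x \<xi> + y \<xi>\<bar> powr q \<le> 2 powr q * (x \<xi> powr q + y \<xi> powr q)"
        using powr_add_le[OF xy q] xy[of \<xi>] by simp
      also have "x \<xi> powr q = A powr q * (norm (b \<xi>) powr q / s \<xi> powr (q * e))"
        unfolding x_def using AB by (subst powr_mult) (auto simp: powr_mult_powr_minus s)
      also have "y \<xi> powr q = B powr q * (norm (a \<xi> * d \<xi>) powr q / s \<xi> powr (q / p))"
        unfolding y_def using AB by (subst powr_mult) (auto simp: powr_mult_powr_minus s simp del: norm_mult)
      finally have "\<bar>x \<xi> + y \<xi>\<bar> powr q \<le> 2 powr q * A powr q * (norm (b \<xi>) powr q / s \<xi> powr (q * e))
         + 2 powr q * B powr q * (norm (a \<xi> * d \<xi>) powr q / s \<xi> powr (q / p))"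
        by (simp add: distrib_left mult.assoc)
      then show ?case by (simp add: ennreal_leI flip: ennreal_mult ennreal_plus)
    qed
    also have "\<dots> = ennreal (2 powr q * A powr q) * (\<integral>\<^sup>+ \<xi>. ennreal (norm (b \<xi>) powr q / s \<xi> powr (q * e)) \<partial>circle_measure)
         + ennreal (2 powr q * B powr q) * (\<integral>\<^sup>+ \<xi>. ennreal (norm (a \<xi> * d \<xi>) powr q / s \<xi> powr (q / p)) \<partial>circle_measure)"
      unfolding s_def by (subst nn_integral_add) (auto simp: nn_integral_cmult)
    also have "\<dots> < \<infinity>" using I1 I2 unfolding s_def[symmetric] by (simp add: ennreal_mult_less_top)
    finally show "(\<integral>\<^sup>+ \<xi>. ennreal (\<bar>x \<xi> + y \<xi>\<bar> powr q) \<partial>circle_measure) < \<infinity>" .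
    fix f assume f: "in_Sp p f \<and> Sp_norm p f \<le> 1"
    then have hf: "f holomorphic_on ball 0 1" and f1: "hardy_pow p (deriv f) \<le> 1"
      using Sp_normD[of p f] p by auto
    show "AE \<xi> in circle_measure. \<exists>L. has_radial_lim (deriv (weighted_comp \<phi> \<psi> f)) \<xi> L \<and> norm L \<le> x \<xi> + y \<xi>"
      using lim
    proof eventually_elim
      case (elim \<xi>)
      let ?L = "b \<xi> * f (c \<xi>) + a \<xi> * (deriv f (c \<xi>) * d \<xi>)"
      have cl: "norm (c \<xi>) < 1" using elim by simp
      have L: "has_radial_lim (deriv (weighted_comp \<phi> \<psi> f)) \<xi> ?L"
        by (rule has_radial_lim_deriv_weighted_comp[OF hol hf self]) (use elim in auto)
      have "norm (f (c \<xi>)) \<le> C * (2 powr e * s \<xi> powr (- e))"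
        using growth[of f "c \<xi>"] f cl powr_one_minus_norm_le[OF cl e] C
        by (auto simp: s_def elim!: order_trans intro!: mult_left_mono)
      then have "norm (b \<xi>) * norm (f (c \<xi>)) \<le> norm (b \<xi>) * (C * (2 powr e * s \<xi> powr (- e)))"
        by (intro mult_left_mono) auto
      then have 1: "norm (b \<xi> * f (c \<xi>)) \<le> x \<xi>" by (simp add: norm_mult x_def A_def mult_ac)
      have "norm (deriv f (c \<xi>)) \<le> (8 * 1) powr (1 / p) * (1 - norm (c \<xi>)) powr (- (1 / p))"
        by (rule Hardy_growth) (use hf p f1 cl in \<open>auto intro!: holomorphic_deriv\<close>)
      also have "\<dots> \<le> 8 powr (1 / p) * (2 powr (1 / p) * s \<xi> powr (- (1 / p)))"
        using powr_one_minus_norm_le[OF cl, of "1 / p"] p by (auto simp: s_def)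
      finally have "norm (a \<xi> * d \<xi>) * norm (deriv f (c \<xi>)) \<le> norm (a \<xi> * d \<xi>) * (8 powr (1 / p) * (2 powr (1 / p) * s \<xi> powr (- (1 / p))))"
        by (intro mult_left_mono) auto
      then have 2: "norm (a \<xi> * (deriv f (c \<xi>) * d \<xi>)) \<le> y \<xi>" by (simp add: norm_mult y_def B_def mult_ac)
      show ?case using L norm_triangle_le[OF add_mono[OF 1 2]] by blast
    qed
  qed
qed

end

section \<open>Necessity: testing at the boundary values of \<psi>\<close>

lemma le_on_ball_of_dense:
  fixes F :: "complex \<Rightarrow> real"
  assumes c: "continuous_on (ball 0 1) F" and dense: "\<And>X. open X \<Longrightarrow> X \<noteq> {} \<Longrightarrow> \<exists>x\<in>D. x \<in> X"
    and le: "\<And>w. w \<in> D \<Longrightarrow> norm w < 1 \<Longrightarrow> F w \<le> G" and w: "norm w < 1"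
  shows "F w \<le> G"
proof (rule ccontr)
  assume "\<not> F w \<le> G"
  then have "w \<in> ball 0 1 \<inter> F -` {G<..}" using w by auto
  moreover have "open (ball 0 1 \<inter> F -` {G<..})"
    by (rule continuous_open_preimage[OF c]) auto
  ultimately obtain x where "x \<in> D" "x \<in> ball 0 1 \<inter> F -` {G<..}" using dense by (metis empty_iff)
  then show False using le[of x] by auto
qed

text \<open>At z = w the denominator is a power of 1 - |w|^2, and the two weights of the theorem
  appear. Only the derivative depends on k, through a linear factor, which is what lets two values
  of k separate the terms.\<close>

lemma Sp_test_diagonal:
  assumes "norm w < 1"
  shows "Sp_test p k w w = complex_of_real ((1 - (norm w)\<^sup>2) powr (1 - 1 / p))"
    and "deriv (Sp_test p k w) w = of_nat k * cnj w * complex_of_real ((1 - (norm w)\<^sup>2) powr (- (1 / p)))"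
proof -
  define s where "s = 1 - (norm w)\<^sup>2"
  have s: "s > 0" using assms by (simp add: s_def power_less_one_iff)
  have e: "1 - cnj w * w = complex_of_real s"
    by (simp add: s_def complex_norm_square mult.commute del: of_real_power)
  have "s powr (real k + 1 - 1 / p) / s ^ k = s powr (1 - 1 / p)"
    using s powr_diff[of s "real k + 1 - 1 / p" "real k"] by (simp add: powr_realpow)
  then show "Sp_test p k w w = complex_of_real ((1 - (norm w)\<^sup>2) powr (1 - 1 / p))"
    unfolding Sp_test_def e s_def[symmetric] by (simp flip: of_real_power of_real_divide)
  have "s powr (real k + 1 - 1 / p) / s ^ Suc k = s powr (- (1 / p))"
    using s powr_diff[of s "real k + 1 - 1 / p" "real (Suc k)"] powr_realpow[of s "Suc k"]
    by (simp add: add.commute del: power_Suc of_nat_Suc) (simp add: add.commute)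
  then have "complex_of_real (s powr (real k + 1 - 1 / p)) / complex_of_real s ^ Suc k = complex_of_real (s powr (- (1 / p)))"
    by (simp flip: of_real_power of_real_divide del: power_Suc)
  then show "deriv (Sp_test p k w) w = of_nat k * cnj w * complex_of_real ((1 - (norm w)\<^sup>2) powr (- (1 / p)))"
    unfolding DERIV_imp_deriv[OF Sp_test_has_deriv[OF assms assms]] e s_def[symmetric]
    by (metis (no_types, lifting) mult.assoc mult.commute times_divide_eq_right)
qed

text \<open>Two consecutive exponents \<open>K\<close> and \<open>K + 1\<close> separate the two terms of the derivative of the
  weighted composition; the factor \<open>cnj c\<close> is lost near \<open>c = 0\<close>, where \<open>f z = z\<close> takes over.\<close>

lemma separate_terms:
  fixes a b c d :: complex and K :: nat
  assumes c: "norm c < 1" and p: "p > 0" and g: "g \<ge> 0"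
    and test: "\<And>k. k \<in> {K, Suc K} \<Longrightarrow>
      norm (b * complex_of_real ((1 - (norm c)\<^sup>2) powr (1 - 1 / p)) + a * ((of_nat k * cnj c * complex_of_real ((1 - (norm c)\<^sup>2) powr (- (1 / p)))) * d)) \<le> G"
    and one: "norm b \<le> g" and ident: "norm (b * c + a * d) \<le> g"
  shows "norm b * (1 - (norm c)\<^sup>2) powr (- ((1 - p) / p)) \<le> (2 * real K + 1) * G"
    and "norm (a * d) * (1 - (norm c)\<^sup>2) powr (- (1 / p)) \<le> 4 * G + 2 * 2 powr (1 / p) * g"
proof -
  define s where "s = 1 - (norm c)\<^sup>2"
  have s: "s > 0" using c by (simp add: s_def power_less_one_iff)
  define X where "X = b * complex_of_real (s powr (1 - 1 / p))"
  define Y where "Y = a * (cnj c * complex_of_real (s powr (- (1 / p))) * d)"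
  have XY: "norm (X + of_nat k * Y) \<le> G" if "k \<in> {K, Suc K}" for k
    using test[OF that] unfolding X_def Y_def s_def[symmetric] by (simp add: mult_ac)
  \<comment> \<open>Consecutive exponents have difference 1, so subtraction isolates Y
    exactly.\<close>
  have "Y = (X + of_nat (Suc K) * Y) - (X + of_nat K * Y)" by (simp add: algebra_simps)
  then have Y: "norm Y \<le> 2 * G"
    using norm_triangle_ineq4[of "X + of_nat (Suc K) * Y" "X + of_nat K * Y"] XY[of K] XY[of "Suc K"] by simp
  have "norm X \<le> norm (X + of_nat K * Y) + norm (of_nat K * Y)"
    using norm_triangle_ineq4[of "X + of_nat K * Y" "of_nat K * Y"] by simp
  also have "\<dots> \<le> G + real K * (2 * G)"
    using XY[of K] Y by (intro add_mono) (auto simp: norm_mult intro!: mult_left_mono)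
  finally have "norm X \<le> (2 * real K + 1) * G" by (simp add: algebra_simps)
  moreover have "- ((1 - p) / p) = 1 - 1 / p" using p by (simp add: field_simps)
  ultimately show "norm b * (1 - (norm c)\<^sup>2) powr (- ((1 - p) / p)) \<le> (2 * real K + 1) * G"
    by (simp add: X_def norm_mult s_def)
  have "norm (a * d) \<le> norm (b * c + a * d) + norm (b * c)"
    using norm_triangle_ineq4[of "b * c + a * d" "b * c"] by simp
  moreover have "norm (b * c) \<le> g * 1"
    unfolding norm_mult using one c g by (intro mult_mono) auto
  ultimately have ad: "norm (a * d) \<le> 2 * g" using ident by simp
  have G: "G \<ge> 0" using norm_ge_zero order_trans XY by blast
  have "norm (a * d) * s powr (- (1 / p)) \<le> 4 * G + 2 * 2 powr (1 / p) * g"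
  proof (cases "norm c \<ge> 1 / 2")
    case True
    have "norm (a * d) * s powr (- (1 / p)) * (1 / 2) \<le> norm (a * d) * s powr (- (1 / p)) * norm c"
      using True by (intro mult_left_mono) auto
    also have "\<dots> = norm Y" by (simp add: Y_def norm_mult)
    finally have "norm (a * d) * s powr (- (1 / p)) \<le> 4 * G" using Y by simp
    moreover have "0 \<le> 2 * 2 powr (1 / p) * g" using g by simp
    ultimately show ?thesis by linarith
  next
    case False
    \<comment> \<open>Here s stays away from 0, so the weight is bounded and the unweighted bound |a
      d| <= 2 g suffices.\<close>
    have "(norm c)\<^sup>2 \<le> (1 / 2)\<^sup>2" using False by (intro power_mono) auto
    then have "1 / 2 \<le> s" by (simp add: s_def power2_eq_square)
    then have "s powr (- (1 / p)) \<le> (1 / 2) powr (- (1 / p))" using p by (intro powr_mono2') auto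
    also have "\<dots> = 2 powr (1 / p)" by (simp add: powr_divide powr_minus_divide)
    finally have "norm (a * d) * s powr (- (1 / p)) \<le> 2 * g * 2 powr (1 / p)"
      using ad g by (intro mult_mono) auto
    then show ?thesis using G by (simp add: mult_ac)
  qed
  then show "norm (a * d) * (1 - (norm c)\<^sup>2) powr (- (1 / p)) \<le> 4 * G + 2 * 2 powr (1 / p) * g"
    by (simp add: s_def)
qed

lemma deriv_const_mult_Sp_test:
  assumes "norm w < 1" "norm z < 1"
  shows "deriv (\<lambda>z. complex_of_real \<kappa> * Sp_test p k w z) z = complex_of_real \<kappa> * deriv (Sp_test p k w) z"
  using Sp_test_has_deriv[OF assms] by (intro deriv_cmult) (auto simp: field_differentiable_def)

lemma hardy_pow_const_1: "hardy_pow p (\<lambda>z. 1) = 1" if "p > 0"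
proof -
  have "hardy_pow p (\<lambda>z. 1) \<le> ennreal 1"
    using that by (subst hardy_pow_le_iff) auto
  moreover have "(\<integral>\<^sup>+ \<xi>. ennreal (norm (1::complex) powr p) \<partial>circle_measure) = 1"
    by (subst nn_integral_circle_measure_continuous) auto
  then have "1 \<le> hardy_pow p (\<lambda>z. 1)"
    unfolding hardy_pow_def by (intro SUP_upper2[of 0]) auto
  ultimately show ?thesis by (simp add: antisym)
qed

context boundary_values
begin

text \<open>Uniqueness of radial limits identifies the limit provided by order boundedness with the
  expression in the boundary values.\<close>

lemma order_boundedD:
  assumes f: "in_Sp p f" "Sp_norm p f \<le> 1"
    and g: "\<forall>f. in_Sp p f \<and> Sp_norm p f \<le> 1 \<longrightarrow>
      (AE \<xi> in circle_measure. \<exists>L. has_radial_lim (deriv (weighted_comp \<phi> \<psi> f)) \<xi> L \<and> norm L \<le> g \<xi>)"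
  shows "AE \<xi> in circle_measure. norm (b \<xi> * f (c \<xi>) + a \<xi> * (deriv f (c \<xi>) * d \<xi>)) \<le> g \<xi>"
  using g[rule_format, OF conjI[OF f]] lim
proof eventually_elim
  case (elim \<xi>)
  then obtain L where L: "has_radial_lim (deriv (weighted_comp \<phi> \<psi> f)) \<xi> L" "norm L \<le> g \<xi>" by blast
  have "has_radial_lim (deriv (weighted_comp \<phi> \<psi> f)) \<xi> (b \<xi> * f (c \<xi>) + a \<xi> * (deriv f (c \<xi>) * d \<xi>))"
    by (rule has_radial_lim_deriv_weighted_comp[OF hol Sp_normD(1)[OF f p] self]) (use elim in auto)
  then have "L = b \<xi> * f (c \<xi>) + a \<xi> * (deriv f (c \<xi>) * d \<xi>)"
    using L(1) radial_lim_eq by metis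
  then show ?case using L(2) by simp
qed

text \<open>Each weighted term is shown to be at most a constant times g almost everywhere; raising
  this to the power q and integrating gives both bounds.\<close>

lemma integrals_finite_if_order_bounded:
  assumes "order_bounded p q \<phi> \<psi>"
  shows "(\<integral>\<^sup>+ \<xi>. ennreal (norm (a \<xi> * d \<xi>) powr q / (1 - (norm (c \<xi>))\<^sup>2) powr (q / p)) \<partial>circle_measure) < \<infinity>" (is ?I1)
    and "(\<integral>\<^sup>+ \<xi>. ennreal (norm (b \<xi>) powr q / (1 - (norm (c \<xi>))\<^sup>2) powr (q * ((1 - p) / p))) \<partial>circle_measure) < \<infinity>" (is ?I2)
proof -
  obtain g :: "complex \<Rightarrow> real" where g_meas: "g \<in> borel_measurable circle_measure"
    and g_int: "(\<integral>\<^sup>+ \<xi>. ennreal (\<bar>g \<xi>\<bar> powr q) \<partial>circle_measure) < \<infinity>"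
    and g: "\<forall>f. in_Sp p f \<and> Sp_norm p f \<le> 1 \<longrightarrow>
      (AE \<xi> in circle_measure. \<exists>L. has_radial_lim (deriv (weighted_comp \<phi> \<psi> f)) \<xi> L \<and> norm L \<le> g \<xi>)"
    using assms unfolding order_bounded_def by (elim exE conjE) (rule that)
  note [measurable] = g_meas
  \<comment> \<open>Large enough for 2 <= (k + 1) p at both k = K and k = K + 1.\<close>
  define K where "K = nat \<lceil>2 / p\<rceil>"
  have K: "2 \<le> (real k + 1) * p" if "k \<in> {K, Suc K}" for k
  proof -
    have "2 / p \<le> real K" unfolding K_def by linarith
    then have "2 \<le> real K * p" using p by (simp add: divide_le_eq)
    also have "\<dots> \<le> (real k + 1) * p" using that p by (intro mult_right_mono) auto
    finally show ?thesis .
  qed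
  define Bk where "Bk k = real k powr p * 2 powr ((real k + 1) * p - 2)" for k
  \<comment> \<open>The sum dominates both constants, so a single \<kappa> normalizes the test
    functions of both exponents.\<close>
  define B where "B = Bk K + Bk (Suc K)"
  have B: "B \<ge> 0" "\<And>k. k \<in> {K, Suc K} \<Longrightarrow> Bk k \<le> B" by (auto simp: B_def Bk_def)
  obtain \<kappa> where \<kappa>: "\<kappa> > 0"
    "\<And>f. f holomorphic_on ball 0 1 \<Longrightarrow> norm (f 0) \<le> 1 \<Longrightarrow> hardy_pow p (deriv f) \<le> ennreal B
      \<Longrightarrow> in_Sp p (\<lambda>z. complex_of_real \<kappa> * f z) \<and> Sp_norm p (\<lambda>z. complex_of_real \<kappa> * f z) \<le> 1"
    using Sp_normalize[OF p B(1)] by metis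
  obtain D :: "complex set" where D: "countable D" "\<And>X. open X \<Longrightarrow> X \<noteq> {} \<Longrightarrow> \<exists>x\<in>D. x \<in> X"
    using countable_dense_exists[where 'a = complex] by blast
  define E where "E k w \<xi> = norm (b \<xi> * Sp_test p k w (c \<xi>) + a \<xi> * (deriv (Sp_test p k w) (c \<xi>) * d \<xi>))" for k w \<xi>
  have E1: "AE \<xi> in circle_measure. E k w \<xi> \<le> g \<xi> / \<kappa>" if k: "k \<in> {K, Suc K}" and w: "norm w < 1" for k w
  proof -
    let ?f = "\<lambda>z. complex_of_real \<kappa> * Sp_test p k w z"
    have "hardy_pow p (deriv (Sp_test p k w)) \<le> ennreal B"
      by (rule order_trans[OF hardy_pow_deriv_Sp_test_le[OF w p K[OF k]] ennreal_leI]) (use B(2)[OF k] in \<open>simp add: Bk_def\<close>)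
    then have f: "in_Sp p ?f" "Sp_norm p ?f \<le> 1"
      using \<kappa>(2)[OF Sp_test_holomorphic[OF w] norm_Sp_test_0_le[OF w p]] K[OF k] by auto
    show ?thesis using order_boundedD[OF f g] lim
    proof eventually_elim
      case (elim \<xi>)
      then have "deriv ?f (c \<xi>) = complex_of_real \<kappa> * deriv (Sp_test p k w) (c \<xi>)"
        using deriv_const_mult_Sp_test[OF w] by blast
      then have "b \<xi> * ?f (c \<xi>) + a \<xi> * (deriv ?f (c \<xi>) * d \<xi>)
        = complex_of_real \<kappa> * (b \<xi> * Sp_test p k w (c \<xi>) + a \<xi> * (deriv (Sp_test p k w) (c \<xi>) * d \<xi>))"
        by (simp add: algebra_simps)
      then have "norm (b \<xi> * ?f (c \<xi>) + a \<xi> * (deriv ?f (c \<xi>) * d \<xi>)) = \<kappa> * E k w \<xi>"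
        unfolding E_def norm_mult using \<kappa>(1) by (simp only: norm_mult) simp
      then show ?case using elim \<kappa>(1) by (simp add: pos_le_divide_eq mult.commute)
    qed
  qed
  \<comment> \<open>Each test function has its own null set, whereas the parameter wanted in the
    end, c \<xi>, varies with \<xi>; countability yields one null set for all parameters in
    D.\<close>
  have "AE \<xi> in circle_measure. \<forall>w\<in>D \<inter> ball 0 1. \<forall>k\<in>{K, Suc K}. E k w \<xi> \<le> g \<xi> / \<kappa>"
    by (rule AE_ball_countable'[OF AE_finite_allI]) (use D(1) E1 in auto)
  moreover have "AE \<xi> in circle_measure. norm (b \<xi>) \<le> g \<xi>"
  proof -
    have "in_Sp p (\<lambda>z. 1)" "Sp_norm p (\<lambda>z. 1) \<le> 1"
      using p by (auto simp: in_Sp_def Sp_norm_def hardy_norm_def hardy_pow_def)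
    from order_boundedD[OF this g] show ?thesis by simp
  qed
  moreover have "AE \<xi> in circle_measure. norm (b \<xi> * c \<xi> + a \<xi> * d \<xi>) \<le> g \<xi>"
  proof -
    have "deriv (\<lambda>z::complex. z) = (\<lambda>z. 1)" by auto
    then have "in_Sp p (\<lambda>z. z)" "Sp_norm p (\<lambda>z. z) \<le> 1"
      using p by (auto simp: in_Sp_def Sp_norm_def hardy_norm_def hardy_pow_const_1)
    from order_boundedD[OF this g] show ?thesis by simp
  qed
  ultimately have bounds: "AE \<xi> in circle_measure. norm (c \<xi>) < 1 \<and> g \<xi> \<ge> 0 \<and>
     norm (b \<xi>) * (1 - (norm (c \<xi>))\<^sup>2) powr (- ((1 - p) / p)) \<le> (2 * real K + 1) / \<kappa> * g \<xi> \<and>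
     norm (a \<xi> * d \<xi>) * (1 - (norm (c \<xi>))\<^sup>2) powr (- (1 / p)) \<le> (4 / \<kappa> + 2 * 2 powr (1 / p)) * g \<xi>"
    using lim
  proof eventually_elim
    case (elim \<xi>)
    have cl: "norm (c \<xi>) < 1" using elim by simp
    \<comment> \<open>Nonnegativity of g is not part of order boundedness; it comes from the
      constant test function, which gives |b| <= g.\<close>
    have g0: "g \<xi> \<ge> 0" using elim norm_ge_zero order_trans by blast
    have "E k w \<xi> \<le> g \<xi> / \<kappa>" if k: "k \<in> {K, Suc K}" and w: "norm w < 1" for k w
    proof (rule le_on_ball_of_dense[OF _ D(2) _ w])
      have nz: "1 - cnj w * c \<xi> \<noteq> 0" if "norm w < 1" for w
        using one_minus_cnj_mult_nonzero[OF that] cl by simp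
      have s: "1 - (norm w)\<^sup>2 > 0" if "norm w < 1" for w :: complex
        using that by (simp add: power_less_one_iff)
      have e: "E k w \<xi> = norm (b \<xi> * Sp_test p k w (c \<xi>) + a \<xi> * (complex_of_real ((1 - (norm w)\<^sup>2) powr (real k + 1 - 1 / p)) * of_nat k * cnj w / (1 - cnj w * c \<xi>) ^ Suc k * d \<xi>))"
        if "norm w < 1" for w
        unfolding E_def DERIV_imp_deriv[OF Sp_test_has_deriv[OF that cl]] ..
      show "continuous_on (ball 0 1) (\<lambda>w. E k w \<xi>)"
      proof (rule continuous_on_eq)
        show "continuous_on (ball 0 1) (\<lambda>w. norm (b \<xi> * Sp_test p k w (c \<xi>) + a \<xi> * (complex_of_real ((1 - (norm w)\<^sup>2) powr (real k + 1 - 1 / p)) * of_nat k * cnj w / (1 - cnj w * c \<xi>) ^ Suc k * d \<xi>)))"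
          unfolding Sp_test_def using nz s
          by (intro continuous_intros ballI) (simp_all add: less_imp_neq[symmetric] del: power_Suc)
      qed (simp add: e)
    qed (use elim k in auto)
    from this[OF _ cl] have "norm (b \<xi> * complex_of_real ((1 - (norm (c \<xi>))\<^sup>2) powr (1 - 1 / p)) + a \<xi> * ((of_nat k * cnj (c \<xi>) * complex_of_real ((1 - (norm (c \<xi>))\<^sup>2) powr (- (1 / p)))) * d \<xi>)) \<le> g \<xi> / \<kappa>"
      if "k \<in> {K, Suc K}" for k
      using that unfolding E_def Sp_test_diagonal[OF cl] .
    from separate_terms[OF cl p g0 this] elim g0 cl show ?case
      by (simp add: algebra_simps add_divide_distrib)
  qed
  \<comment> \<open>Used with weight exponents (1 - p) / p and 1 / p; the q-th power multiplies them
    by q.\<close>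
  have finite: "(\<integral>\<^sup>+ \<xi>. ennreal (h \<xi> powr q / (1 - (norm (c \<xi>))\<^sup>2) powr (q * e)) \<partial>circle_measure) < \<infinity>"
    if C: "C \<ge> 0" and h: "\<And>\<xi>. h \<xi> \<ge> 0" and le: "AE \<xi> in circle_measure. norm (c \<xi>) < 1 \<and> g \<xi> \<ge> 0 \<and> h \<xi> * (1 - (norm (c \<xi>))\<^sup>2) powr (- e) \<le> C * g \<xi>"
    for h :: "complex \<Rightarrow> real" and C e
  proof -
    have "(\<integral>\<^sup>+ \<xi>. ennreal (h \<xi> powr q / (1 - (norm (c \<xi>))\<^sup>2) powr (q * e)) \<partial>circle_measure)
      \<le> (\<integral>\<^sup>+ \<xi>. ennreal (C powr q) * ennreal (\<bar>g \<xi>\<bar> powr q) \<partial>circle_measure)"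
    proof (rule nn_integral_mono_AE, use le in eventually_elim)
      case (elim \<xi>)
      have s: "1 - (norm (c \<xi>))\<^sup>2 > 0" using elim by (simp add: power_less_one_iff)
      have "(h \<xi> * (1 - (norm (c \<xi>))\<^sup>2) powr (- e)) powr q \<le> (C * g \<xi>) powr q"
        using elim h q by (intro powr_mono2) auto
      then have "h \<xi> powr q / (1 - (norm (c \<xi>))\<^sup>2) powr (q * e) \<le> C powr q * \<bar>g \<xi>\<bar> powr q"
        unfolding powr_mult_powr_minus[OF h s] using elim C by (simp add: powr_mult)
      then show ?case by (simp add: ennreal_leI flip: ennreal_mult)
    qed
    also have "\<dots> = ennreal (C powr q) * (\<integral>\<^sup>+ \<xi>. ennreal (\<bar>g \<xi>\<bar> powr q) \<partial>circle_measure)"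
      by (rule nn_integral_cmult) measurable
    also have "\<dots> < \<infinity>" using g_int by (simp add: ennreal_mult_less_top)
    finally show ?thesis .
  qed
  show ?I2
    by (rule finite[of "(2 * real K + 1) / \<kappa>"]) (use bounds \<kappa>(1) in \<open>auto elim: eventually_mono\<close>)
  have "(\<integral>\<^sup>+ \<xi>. ennreal (norm (a \<xi> * d \<xi>) powr q / (1 - (norm (c \<xi>))\<^sup>2) powr (q * (1 / p))) \<partial>circle_measure) < \<infinity>"
    by (rule finite[of "4 / \<kappa> + 2 * 2 powr (1 / p)"]) (use bounds \<kappa>(1) in \<open>auto elim: eventually_mono\<close>)
  then show ?I1 by simp
qed

end

theorem theorem3p2:
  fixes p q :: real and \<phi> \<psi> :: "complex \<Rightarrow> complex"
  assumes "0 < p" and "0 < q"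
    and "in_Sp q \<phi>"
    and "in_Sp q \<psi>"
    and "\<forall>z\<in>ball 0 1. \<psi> z \<in> ball 0 1"
    and "AE \<xi> in circle_measure. norm (radial_lim \<psi> \<xi>) < 1"
  shows "(p < 1 \<longrightarrow>
            (order_bounded p q \<phi> \<psi> \<longleftrightarrow>
              (\<integral>\<^sup>+ \<xi>. ennreal (norm (radial_lim \<phi> \<xi> * radial_lim (deriv \<psi>) \<xi>) powr q
                       / (1 - (norm (radial_lim \<psi> \<xi>))\<^sup>2) powr (q / p)) \<partial>circle_measure)
            + (\<integral>\<^sup>+ \<xi>. ennreal (norm (radial_lim (deriv \<phi>) \<xi>) powr q
                       / (1 - (norm (radial_lim \<psi> \<xi>))\<^sup>2) powr (q * (1 - p) / p)) \<partial>circle_measure)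
            < \<infinity>))
       \<and> (1 \<le> p \<longrightarrow>
            (order_bounded p q \<phi> \<psi> \<longleftrightarrow>
              (\<integral>\<^sup>+ \<xi>. ennreal (norm (radial_lim \<phi> \<xi> * radial_lim (deriv \<psi>) \<xi>) powr q
                       / (1 - (norm (radial_lim \<psi> \<xi>))\<^sup>2) powr (q / p)) \<partial>circle_measure)
            < \<infinity>))"
proof -
  have hol: "\<phi> holomorphic_on ball 0 1" "\<psi> holomorphic_on ball 0 1"
    and fin: "hardy_pow q (deriv \<phi>) < \<infinity>" "hardy_pow q (deriv \<psi>) < \<infinity>"
    using assms(3,4) by (auto simp: in_Sp_def)
  have hold: "deriv \<phi> holomorphic_on ball 0 1" "deriv \<psi> holomorphic_on ball 0 1"
    using hol by (auto intro: holomorphic_deriv)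
  note lim' = Hardy_radial_limit[OF hold(1) assms(2) fin(1)] Hardy_radial_limit[OF hold(2) assms(2) fin(2)]
  \<comment> \<open>Membership in the space controls derivatives only; the functions themselves have
    a radial limit wherever their derivative has one.\<close>
  have ex: "AE \<xi> in circle_measure. \<exists>L. has_radial_lim f \<xi> L"
    if "f holomorphic_on ball 0 1" "AE \<xi> in circle_measure. \<exists>L. has_radial_lim (deriv f) \<xi> L" for f
    using that(2) AE_circle_measure_sphere
    by eventually_elim (use has_radial_lim_of_deriv[OF that(1)] in auto)
  obtain a where a: "a \<in> borel_measurable borel" "AE \<xi> in circle_measure. has_radial_lim \<phi> \<xi> (a \<xi>)"
    using radial_lim_borel_version[OF hol(1) ex[OF hol(1) lim'(1)] assms(2)] by metis
  obtain b where b: "b \<in> borel_measurable borel" "AE \<xi> in circle_measure. has_radial_lim (deriv \<phi>) \<xi> (b \<xi>)"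
    and b_int: "(\<integral>\<^sup>+ \<xi>. ennreal (norm (b \<xi>) powr q) \<partial>circle_measure) \<le> hardy_pow q (deriv \<phi>)"
    using radial_lim_borel_version[OF hold(1) lim'(1) assms(2)] by metis
  obtain c where c: "c \<in> borel_measurable borel" "AE \<xi> in circle_measure. has_radial_lim \<psi> \<xi> (c \<xi>)"
    using radial_lim_borel_version[OF hol(2) ex[OF hol(2) lim'(2)] assms(2)] by metis
  obtain d where d: "d \<in> borel_measurable borel" "AE \<xi> in circle_measure. has_radial_lim (deriv \<psi>) \<xi> (d \<xi>)"
    using radial_lim_borel_version[OF hold(2) lim'(2) assms(2)] by metis
  have lims: "AE \<xi> in circle_measure. norm \<xi> = 1 \<and> has_radial_lim \<phi> \<xi> (a \<xi>) \<and> has_radial_lim (deriv \<phi>) \<xi> (b \<xi>) \<and>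
       has_radial_lim \<psi> \<xi> (c \<xi>) \<and> has_radial_lim (deriv \<psi>) \<xi> (d \<xi>) \<and> norm (c \<xi>) < 1"
    using a(2) b(2) c(2) d(2) AE_circle_measure_sphere assms(6)
    by eventually_elim (auto simp: radial_lim_eq)
  interpret boundary_values p q \<phi> \<psi> a b c d
    by unfold_locales (use assms hol a b c d lims in auto)
  have J1: "(\<integral>\<^sup>+ \<xi>. ennreal (norm (radial_lim \<phi> \<xi> * radial_lim (deriv \<psi>) \<xi>) powr q
                       / (1 - (norm (radial_lim \<psi> \<xi>))\<^sup>2) powr (q / p)) \<partial>circle_measure)
     = (\<integral>\<^sup>+ \<xi>. ennreal (norm (a \<xi> * d \<xi>) powr q / (1 - (norm (c \<xi>))\<^sup>2) powr (q / p)) \<partial>circle_measure)"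
    by (rule nn_integral_cong_AE, use lims in eventually_elim) (auto simp: radial_lim_eq)
  have J2: "(\<integral>\<^sup>+ \<xi>. ennreal (norm (radial_lim (deriv \<phi>) \<xi>) powr q
                       / (1 - (norm (radial_lim \<psi> \<xi>))\<^sup>2) powr (q * (1 - p) / p)) \<partial>circle_measure)
     = (\<integral>\<^sup>+ \<xi>. ennreal (norm (b \<xi>) powr q / (1 - (norm (c \<xi>))\<^sup>2) powr (q * ((1 - p) / p))) \<partial>circle_measure)"
    by (rule nn_integral_cong_AE, use lims in eventually_elim) (auto simp: radial_lim_eq)
  show ?thesis unfolding J1 J2
  proof (intro conjI impI)
    assume p1: "p < 1"
    have e: "- ((1 - p) / p) = 1 - 1 / p" using p by (simp add: field_simps)
    show "order_bounded p q \<phi> \<psi> \<longleftrightarrow>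
      (\<integral>\<^sup>+ \<xi>. ennreal (norm (a \<xi> * d \<xi>) powr q / (1 - (norm (c \<xi>))\<^sup>2) powr (q / p)) \<partial>circle_measure)
      + (\<integral>\<^sup>+ \<xi>. ennreal (norm (b \<xi>) powr q / (1 - (norm (c \<xi>))\<^sup>2) powr (q * ((1 - p) / p))) \<partial>circle_measure) < \<infinity>"
      (is "_ \<longleftrightarrow> ?I1 + ?I2 < \<infinity>")
    proof
      assume "order_bounded p q \<phi> \<psi>"
      from integrals_finite_if_order_bounded[OF this] show "?I1 + ?I2 < \<infinity>" by simp
    next
      assume "?I1 + ?I2 < \<infinity>"
      then have I: "?I1 < \<infinity>" "?I2 < \<infinity>" by auto
      show "order_bounded p q \<phi> \<psi>"
      proof (rule order_bounded_if_integrals_finite[OF _ _ _ I])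
        show "norm (f w) \<le> (1 + 8 powr (1 / p) / (1 / p - 1)) * (1 - norm w) powr (- ((1 - p) / p))"
          if "in_Sp p f" "Sp_norm p f \<le> 1" "norm w < 1" for f w
          unfolding e using Sp_growth_lt_1[OF _ p p1] Sp_normD[OF that(1,2) p] that(3) by blast
        have "1 / p - 1 \<ge> 0" using p p1 by (simp add: field_simps)
        then show "1 + 8 powr (1 / p) / (1 / p - 1) \<ge> 0" by (simp add: add_nonneg_nonneg)
      qed (use p p1 in simp)
    qed
  next
    assume p1: "1 \<le> p"
    show "order_bounded p q \<phi> \<psi> \<longleftrightarrow>
      (\<integral>\<^sup>+ \<xi>. ennreal (norm (a \<xi> * d \<xi>) powr q / (1 - (norm (c \<xi>))\<^sup>2) powr (q / p)) \<partial>circle_measure) < \<infinity>"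
      (is "_ \<longleftrightarrow> ?I1 < \<infinity>")
    proof
      assume "order_bounded p q \<phi> \<psi>"
      from integrals_finite_if_order_bounded(1)[OF this] show "?I1 < \<infinity>" .
    next
      assume I: "?I1 < \<infinity>"
      \<comment> \<open>With growth exponent 0 the weight is 1 except at base 0, where
        \<open>0 powr 0 = 0\<close> and division by zero makes the quotient 0; hence an inequality.
        The right side is finite by the Fatou bound for the boundary values of \<phi>'.\<close>
      have "(\<integral>\<^sup>+ \<xi>. ennreal (norm (b \<xi>) powr q / (1 - (norm (c \<xi>))\<^sup>2) powr (q * 0)) \<partial>circle_measure)
         \<le> (\<integral>\<^sup>+ \<xi>. ennreal (norm (b \<xi>) powr q) \<partial>circle_measure)"
        by (intro nn_integral_mono ennreal_leI) (simp add: divide_le_eq)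
      also have "\<dots> < \<infinity>" using b_int fin(1) by (rule le_less_trans)
      finally have I2: "(\<integral>\<^sup>+ \<xi>. ennreal (norm (b \<xi>) powr q / (1 - (norm (c \<xi>))\<^sup>2) powr (q * 0)) \<partial>circle_measure) < \<infinity>" .
      show "order_bounded p q \<phi> \<psi>"
      proof (rule order_bounded_if_integrals_finite[OF _ _ _ I I2])
        show "norm (f w) \<le> (1 + 4 * pi) * (1 - norm w) powr (- 0)"
          if "in_Sp p f" "Sp_norm p f \<le> 1" "norm w < 1" for f w
          using Sp_bounded_ge_1[OF _ p1] Sp_normD[OF that(1,2) p] that(3) by simp
      qed auto
    qed
  qed
qed

end
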